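(* Let $2<q<\infty$ and let $\Omega\subset\mathbb{R}^2$ be a Jordan domain that is a $W^{1,q}$-extension domain, with an extension operator satisfying $\|Eu\|_{W^{1,q}(\mathbb{R}^2)}\le C_0\|u\|_{W^{1,q}(\Omega)}$ for all $u\in W^{1,q}(\Omega)$. Then there is a constant $C$ depending only on $q$ and $C_0$ such that for any two points $z_1,z_2\in\Omega$ there exists a curve $\gamma\subset\Omega$ joining $z_1$ and $z_2$ with $$\int_{\gamma}\mathrm{dist}(z,\partial\Omega)^{\frac{1}{1-q}}\,ds(z)\le C\,|z_1-z_2|^{\frac{q-2}{q-1}}.$$
   Context: A Jordan domain is the bounded connected component of $\mathbb{R}^2\setminus\Gamma$ for a Jordan curve $\Gamma$. A curve is the image of a continuous map from an interval, and $ds$ denotes integration with respect to arc length. For $1\le q\le\infty$, $W^{1,q}(\Omega)=\{u\in L^1_{\mathrm{loc}}(\Omega):\nabla u\in L^q(\Omega,\mathbb{R}^2)\}$, where $\nabla u$ is the distributional gradient, equipped with the (semi-)norm $\|u\|_{W^{1,q}(\Omega)}=\|\nabla u\|_{L^q(\Omega)}$ (and likewise with $\mathbb{R}^2$ in place of $\Omega$). $\Omega$ is a $W^{1,q}$-extension domain if there exist an extension operator $E:W^{1,q}(\Omega)\to W^{1,q}(\mathbb{R}^2)$ and a constant $C_0\ge1$ such that for every $u\in W^{1,q}(\Omega)$ one has $Eu|_\Omega=u$ and $\|Eu\|_{W^{1,q}(\mathbb{R}^2)}\le C_0\|u\|_{W^{1,q}(\Omega)}$. *)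

theory Defs
  imports "HOL-Analysis.Analysis"
begin

text \<open>The plane is the type \<^typ>\<open>complex\<close>, viewed as a real Euclidean space: distances, Lebesgue
  measure and (real) differentiability are those of the plane.\<close>

definition jordan_domain :: "complex set \<Rightarrow> bool" where
  "jordan_domain \<Omega> \<longleftrightarrow>
     (\<exists>c. simple_path c \<and> pathfinish c = pathstart c \<and>
          \<Omega> \<in> components (- path_image c) \<and> bounded \<Omega>)"

subsection \<open>Sobolev spaces\<close>

text \<open>Functions on an open set are represented by total functions whose values off that set are
  irrelevant.\<close>

definition locally_integrable ::
    "'a::euclidean_space set \<Rightarrow> ('a \<Rightarrow> 'b::{banach, second_countable_topology}) \<Rightarrow> bool" where
  "locally_integrable \<Omega> u \<longleftrightarrow> (\<forall>K. compact K \<and> K \<subseteq> \<Omega> \<longrightarrow> set_integrable lebesgue K u)"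

fun times_continuously_diff :: "nat \<Rightarrow> ('a::euclidean_space \<Rightarrow> real) \<Rightarrow> bool" where
  "times_continuously_diff 0 f \<longleftrightarrow> continuous_on UNIV f"
| "times_continuously_diff (Suc k) f \<longleftrightarrow>
     (\<forall>x. f differentiable (at x)) \<and>
     (\<forall>v. times_continuously_diff k (\<lambda>x. frechet_derivative f (at x) v))"

definition test_function :: "'a::euclidean_space set \<Rightarrow> ('a \<Rightarrow> real) \<Rightarrow> bool" where
  "test_function \<Omega> \<phi> \<longleftrightarrow>
     (\<forall>k. times_continuously_diff k \<phi>) \<and>
     compact (closure {x. \<phi> x \<noteq> 0}) \<and> closure {x. \<phi> x \<noteq> 0} \<subseteq> \<Omega>"

definition has_weak_gradient ::
    "'a::euclidean_space set \<Rightarrow> ('a \<Rightarrow> real) \<Rightarrow> ('a \<Rightarrow> 'a) \<Rightarrow> bool" where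
  "has_weak_gradient \<Omega> u g \<longleftrightarrow>
     locally_integrable \<Omega> g \<and>
     (\<forall>\<phi>. test_function \<Omega> \<phi> \<longrightarrow> (\<forall>e\<in>Basis.
        (LINT x:\<Omega>|lebesgue. u x * frechet_derivative \<phi> (at x) e) =
        - (LINT x:\<Omega>|lebesgue. (g x \<bullet> e) * \<phi> x)))"

text \<open>On an open set the weak gradient of a locally integrable function is determined up to null
  sets; the following picks a representative.\<close>

definition weak_gradient ::
    "'a::euclidean_space set \<Rightarrow> ('a \<Rightarrow> real) \<Rightarrow> ('a \<Rightarrow> 'a)" where
  "weak_gradient \<Omega> u = (SOME g. has_weak_gradient \<Omega> u g)"

definition in_Lq :: "real \<Rightarrow> 'a::euclidean_space set \<Rightarrow> ('a \<Rightarrow> 'a) \<Rightarrow> bool" where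
  "in_Lq q \<Omega> g \<longleftrightarrow>
     set_borel_measurable lebesgue \<Omega> g \<and> set_integrable lebesgue \<Omega> (\<lambda>x. norm (g x) powr q)"

definition sobolev :: "real \<Rightarrow> 'a::euclidean_space set \<Rightarrow> ('a \<Rightarrow> real) set" where
  "sobolev q \<Omega> =
     {u. locally_integrable \<Omega> u \<and> (\<exists>g. has_weak_gradient \<Omega> u g) \<and> in_Lq q \<Omega> (weak_gradient \<Omega> u)}"

definition sobolev_norm :: "real \<Rightarrow> 'a::euclidean_space set \<Rightarrow> ('a \<Rightarrow> real) \<Rightarrow> real" where
  "sobolev_norm q \<Omega> u = (LINT x:\<Omega>|lebesgue. norm (weak_gradient \<Omega> u x) powr q) powr (1 / q)"

text \<open>The operator acts on representatives, and the extension property holds almost everywhere. An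
  operator on classes modulo null sets gives one on representatives and, by choosing a
  representative of each class, conversely. Linearity is not part of the notion.\<close>

definition sobolev_extension_operator ::
    "real \<Rightarrow> real \<Rightarrow> 'a::euclidean_space set \<Rightarrow> (('a \<Rightarrow> real) \<Rightarrow> ('a \<Rightarrow> real)) \<Rightarrow> bool" where
  "sobolev_extension_operator q C0 \<Omega> E \<longleftrightarrow>
     C0 \<ge> 1 \<and>
     (\<forall>u\<in>sobolev q \<Omega>.
        E u \<in> sobolev q UNIV \<and>
        (AE x in lebesgue. x \<in> \<Omega> \<longrightarrow> E u x = u x) \<and>
        sobolev_norm q UNIV (E u) \<le> C0 * sobolev_norm q \<Omega> u)"

subsection \<open>Arc length\<close>

definition curve_length :: "real \<Rightarrow> real \<Rightarrow> (real \<Rightarrow> 'a::metric_space) \<Rightarrow> ennreal" where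
  "curve_length a b \<gamma> =
     (SUP ts \<in> {ts. sorted ts \<and> set ts \<subseteq> {a..b}}.
        \<Sum>i < length ts - 1. ennreal (dist (\<gamma> (ts ! i)) (\<gamma> (ts ! Suc i))))"

definition rectifiable :: "(real \<Rightarrow> 'a::metric_space) \<Rightarrow> bool" where
  "rectifiable \<gamma> \<longleftrightarrow> curve_length 0 1 \<gamma> < \<infinity>"

text \<open>The point reached after arc length \<open>s\<close>. For a rectifiable path \<open>\<gamma>\<close> the choice of the parameter
  is immaterial: \<open>\<gamma>\<close> is constant between two parameters with the same arc length.\<close>

definition arc_length_param :: "(real \<Rightarrow> 'a::metric_space) \<Rightarrow> real \<Rightarrow> 'a" where
  "arc_length_param \<gamma> s = \<gamma> (SOME t. t \<in> {0..1} \<and> curve_length 0 t \<gamma> = ennreal s)"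

text \<open>The integral of \<open>f\<close> with respect to arc length along a rectifiable path.\<close>

definition arc_length_integral ::
    "(real \<Rightarrow> 'a::metric_space) \<Rightarrow> ('a \<Rightarrow> ennreal) \<Rightarrow> ennreal" where
  "arc_length_integral \<gamma> f =
     (\<integral>\<^sup>+ s \<in> {0..enn2real (curve_length 0 1 \<gamma>)}. f (arc_length_param \<gamma> s) \<partial>lborel)"

end

theory Submission
  imports Defs
begin

text \<open>Testing the extension operator on \<open>C\<^sup>1\<close> functions and applying Morrey's inequality to the
  extension gives \<open>|w z\<^sub>1 - w z\<^sub>2|\<^sup>q \<le> const D\<^bsup>q-2\<^esup> \<integral>\<^bsub>\<Omega>\<^esub> |\<nabla>w|\<^sup>q\<close> with \<open>D = |z\<^sub>1 - z\<^sub>2|\<close>. Let \<open>W\<close> be the intersection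
  of \<open>\<Omega>\<close> with a large disc \<open>B(z\<^sub>1, 3KD)\<close> and \<open>\<delta>\<close> the distance to the complement of \<open>W\<close>, which is
  connected because \<open>\<Omega>\<close> is a Jordan domain. The points \<open>p\<close> for which the disc \<open>B(p, 2\<delta>(p))\<close> contains
  \<open>z\<^sub>1\<close> or \<open>z\<^sub>2\<close> or separates them in \<open>W\<close> connect \<open>z\<^sub>1\<close> to \<open>z\<^sub>2\<close>: otherwise a continuous logarithm of
  \<open>(z - z\<^sub>1) / (z - z\<^sub>2)\<close> on the complement of \<open>W\<close> would extend to all other points, contradicting
  Borsuk's separation criterion. So there is a chain of Whitney discs around such points \<open>p\<close>, and the
  polygon along it has weighted length at most the sum of the \<open>\<delta>(p)\<^bsup>\<alpha>\<^esup>\<close>, \<open>\<alpha> = (q - 2) / (q - 1)\<close>. The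
  discs near \<open>z\<^sub>1\<close> or \<open>z\<^sub>2\<close> contribute \<open>O(D\<^bsup>\<alpha>\<^esup>)\<close>. Every other disc separates, so there is a function
  with gradient supported near the disc that jumps by \<open>\<delta>(p)\<^bsup>\<alpha>\<^esup>\<close> from \<open>z\<^sub>1\<close> to \<open>z\<^sub>2\<close>; adding these up
  gives \<open>w\<close> with jump \<open>S\<close> and energy \<open>O(S)\<close>, where \<open>S\<close> is the remaining sum, up to the error of cutting
  \<open>w\<close> off outside the large disc, which is absorbed for large \<open>K\<close>. Hence \<open>S\<^sup>q \<le> const D\<^bsup>q-2\<^esup> S\<close>.\<close>

subsection \<open>Arc length of polygons\<close>

text \<open>The exponent is forced by scaling. A slice of height \<open>d powr \<alpha>\<close>
  around a disc of radius comparable to d has gradient of size \<open>d powr (\<alpha> - 1)\<close>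
  on an area of order d^2, and q (\<alpha> - 1) + 2 = \<alpha>, so its energy is again of order
  \<open>d powr \<alpha>\<close>. Jump and energy of the sum are then both of order S, and q > 1
  turns S^q <= const S into a bound. Three obstacles shape the rest. Discs of many sizes can overlap
  at one point z; but those with z within 6 d of the centre number boundedly many per dyadic scale,
  so the gradients at z form a geometric-type sum governed by the smallest disc. Discs near z1 or z2
  need not separate and could be huge compared with D inside \<Omega>; the truncation caps their
  size by a multiple of K D. The truncation itself costs S^q times a multiple of K^(2-q), which is
  small for large K because q > 2; absorbing it needs S finite, so a finite chain is extracted from
  a compact path before any estimate. All constants depend on the domain through C0 only.\<close>

fun polygon_length :: "(real \<Rightarrow> 'a::metric_space) \<Rightarrow> real list \<Rightarrow> ennreal" where
  "polygon_length \<gamma> (s # t # ts) = ennreal (dist (\<gamma> s) (\<gamma> t)) + polygon_length \<gamma> (t # ts)"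
| "polygon_length \<gamma> _ = 0"

lemma polygon_length_eq_sum:
  "(\<Sum>i < length ts - 1. ennreal (dist (\<gamma> (ts ! i)) (\<gamma> (ts ! Suc i)))) = polygon_length \<gamma> ts"
proof (induction \<gamma> ts rule: polygon_length.induct)
  case (1 \<gamma> s t ts)
  have "{..<length (s # t # ts) - 1} = {..<Suc (length (t # ts) - 1)}" by simp
  then show ?case using 1 by (simp add: sum.lessThan_Suc_shift del: sum.lessThan_Suc)
qed auto

lemma curve_length_eq_SUP_polygon:
  "curve_length a b \<gamma> = (SUP ts \<in> {ts. sorted ts \<and> set ts \<subseteq> {a..b}}. polygon_length \<gamma> ts)"
  unfolding curve_length_def polygon_length_eq_sum ..

lemma polygon_length_le_curve_length:
  "sorted ts \<Longrightarrow> set ts \<subseteq> {a..b} \<Longrightarrow> polygon_length \<gamma> ts \<le> curve_length a b \<gamma>"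
  unfolding curve_length_eq_SUP_polygon by (rule SUP_upper) simp

lemma curve_length_mono: "b \<le> c \<Longrightarrow> curve_length a b \<gamma> \<le> curve_length a c \<gamma>"
  unfolding curve_length_eq_SUP_polygon by (rule SUP_subset_mono) auto

text \<open>Triangle inequality at the junction of \<open>us\<close> and \<open>vs\<close>, where
  the node b is inserted. It allows a partition to be split at an arbitrary parameter.\<close>

lemma polygon_length_le_insert:
  "polygon_length \<gamma> (us @ vs) \<le> polygon_length \<gamma> (us @ [b]) + polygon_length \<gamma> (b # vs)"
proof (induction \<gamma> us rule: polygon_length.induct)
  case (1 \<gamma> s t ts)
  then show ?case by (simp add: add.assoc add_left_mono)
next
  case ("2_1" \<gamma>)
  then show ?case by (cases vs) auto
next
  case ("2_2" \<gamma> x)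
  show ?case
  proof (cases vs)
    case (Cons v r)
    have "ennreal (dist (\<gamma> x) (\<gamma> v)) \<le> ennreal (dist (\<gamma> x) (\<gamma> b)) + ennreal (dist (\<gamma> b) (\<gamma> v))"
      by (simp add: ennreal_plus[symmetric] dist_triangle del: ennreal_plus)
    then show ?thesis using Cons by (simp add: add.assoc[symmetric] add_right_mono)
  qed simp
qed

text \<open>Inserting b into a partition of [a, c] does not decrease its polygon length, and the
  refined partition is one of [a, b] followed by one of [b, c].\<close>

lemma curve_length_subadditive:
  assumes "a \<le> b" "b \<le> c"
  shows "curve_length a c \<gamma> \<le> curve_length a b \<gamma> + curve_length b c \<gamma>"
  unfolding curve_length_eq_SUP_polygon[of a c]
proof (rule SUP_least)
  fix ts assume ts: "ts \<in> {ts. sorted ts \<and> set ts \<subseteq> {a..c}}"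
  let ?us = "takeWhile (\<lambda>t. t \<le> b) ts" and ?vs = "dropWhile (\<lambda>t. t \<le> b) ts"
  have split: "sorted (?us @ ?vs)" "set (?us @ ?vs) \<subseteq> {a..c}" using ts by auto
  have sub: "set ?us \<subseteq> {a..c}" "set ?vs \<subseteq> {a..c}"
    using ts by (auto dest: set_takeWhileD set_dropWhileD)
  have us: "set ?us \<subseteq> {..b}" by (auto dest: set_takeWhileD)
  have vs: "set ?vs \<subseteq> {b..}"
  proof (cases ?vs)
    case (Cons v r)
    then have "v > b" by (metis hd_dropWhile linorder_not_less list.sel(1) list.distinct(1))
    then show ?thesis using split(1) Cons by (auto simp: sorted_append)
  next
    case Nil
    then show ?thesis by (simp only: list.set empty_subsetI)
  qed
  have "polygon_length \<gamma> ts \<le> polygon_length \<gamma> (?us @ [b]) + polygon_length \<gamma> (b # ?vs)"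
    using polygon_length_le_insert[of \<gamma> ?us ?vs b] by simp
  also have "\<dots> \<le> curve_length a b \<gamma> + curve_length b c \<gamma>"
    using split(1) sub us vs assms
    by (intro add_mono polygon_length_le_curve_length) (auto simp: sorted_append subset_iff)
  finally show "polygon_length \<gamma> ts \<le> curve_length a b \<gamma> + curve_length b c \<gamma>" .
qed

text \<open>Measuring from the first node s to the right end b, and not over the whole interval,
  makes the induction over the list telescope.\<close>

lemma polygon_length_le_Lipschitz:
  assumes "0 \<le> L" and lip: "\<And>s t. s \<in> {a..b} \<Longrightarrow> t \<in> {a..b} \<Longrightarrow> dist (\<gamma> s) (\<gamma> t) \<le> L * \<bar>s - t\<bar>"
  shows "sorted (s # ts) \<Longrightarrow> set (s # ts) \<subseteq> {a..b} \<Longrightarrow> polygon_length \<gamma> (s # ts) \<le> ennreal (L * (b - s))"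
proof (induction ts arbitrary: s)
  case (Cons t ts)
  have "polygon_length \<gamma> (s # t # ts) \<le> ennreal (L * (t - s)) + ennreal (L * (b - t))"
    using Cons.prems lip[of s t] Cons.IH[of t] by (auto intro!: add_mono ennreal_leI)
  also have "\<dots> = ennreal (L * (b - s))"
    using Cons.prems assms(1)
    by (subst ennreal_plus[symmetric]) (auto simp: algebra_simps mult_left_mono)
  finally show ?case .
qed simp

lemma curve_length_le_Lipschitz:
  assumes "0 \<le> L" and lip: "\<And>s t. s \<in> {a..b} \<Longrightarrow> t \<in> {a..b} \<Longrightarrow> dist (\<gamma> s) (\<gamma> t) \<le> L * \<bar>s - t\<bar>"
  shows "curve_length a b \<gamma> \<le> ennreal (L * (b - a))"
  unfolding curve_length_eq_SUP_polygon
proof (rule SUP_least)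
  fix ts assume ts: "ts \<in> {ts. sorted ts \<and> set ts \<subseteq> {a..b}}"
  show "polygon_length \<gamma> ts \<le> ennreal (L * (b - a))"
  proof (cases ts)
    case (Cons s r)
    then have "polygon_length \<gamma> ts \<le> ennreal (L * (b - s))"
      using polygon_length_le_Lipschitz[OF assms] ts by simp
    also have "\<dots> \<le> ennreal (L * (b - a))"
      using ts Cons assms(1) by (intro ennreal_leI mult_left_mono) auto
    finally show ?thesis .
  qed simp
qed

lemma unit_interval_subdivision:
  assumes "0 < n" "t \<in> {0..1}"
  shows "\<exists>j<n. t \<in> {real j / real n..real (Suc j) / real n}"
proof (cases "t = 1")
  case True
  then show ?thesis using assms(1) by (intro exI[of _ "n - 1"]) (auto simp: field_simps of_nat_diff)
next
  case False
  let ?j = "nat \<lfloor>t * real n\<rfloor>"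
  have "real ?j \<le> t * real n" "t * real n < real ?j + 1" using assms by auto
  moreover have "?j < n"
  proof -
    have "t * real n < real n" using False assms by auto
    then show ?thesis using \<open>real ?j \<le> t * real n\<close> by linarith
  qed
  ultimately show ?thesis using assms by (intro exI[of _ ?j]) (auto simp: field_simps)
qed

text \<open>The arc-length interval is covered by the intervals \<open>?I j\<close> of arc lengths
  reached on the j-th piece, each of length at most L j / n, and f is at most c j at the points
  reached there. So the integrand is dominated by a step function in s.\<close>

lemma
  fixes \<gamma> :: "real \<Rightarrow> 'a::metric_space"
  assumes n: "0 < n" and L: "\<And>j. 0 \<le> L j" and c: "\<And>j. 0 \<le> c j"
    and lip: "\<And>j s t. j < n \<Longrightarrow> s \<in> {real j / real n..real (Suc j) / real n} \<Longrightarrow>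
               t \<in> {real j / real n..real (Suc j) / real n} \<Longrightarrow> dist (\<gamma> s) (\<gamma> t) \<le> L j * \<bar>s - t\<bar>"
    and f: "\<And>j t. j < n \<Longrightarrow> t \<in> {real j / real n..real (Suc j) / real n} \<Longrightarrow> f (\<gamma> t) \<le> ennreal (c j)"
  shows curve_length_piecewise_Lipschitz: "curve_length 0 1 \<gamma> < \<infinity>"
    and arc_length_integral_le_piecewise:
      "arc_length_integral \<gamma> f \<le> ennreal (\<Sum>j<n. c j * (L j / real n))"
proof -
  let ?T = "\<lambda>j. {real j / real n..real (Suc j) / real n}"
  let ?CL = "\<lambda>t. curve_length 0 t \<gamma>"
  have step: "?CL t \<le> ?CL s + ennreal (L j * (t - s))" if "j < n" "s \<in> ?T j" "t \<in> ?T j" "s \<le> t" for j s t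
  proof -
    have "0 \<le> real j / real n" by simp
    then have "0 \<le> s" using that(2) by (meson atLeastAtMost_iff order_trans)
    have "?CL t \<le> ?CL s + curve_length s t \<gamma>"
      by (rule curve_length_subadditive) fact+
    also have "curve_length s t \<gamma> \<le> ennreal (L j * (t - s))"
      by (rule curve_length_le_Lipschitz[OF L]) (use that in \<open>auto intro!: lip\<close>)
    finally show ?thesis by (simp add: add_left_mono)
  qed
  have CL0: "?CL 0 = 0"
    using curve_length_le_Lipschitz[of 0 0 0 \<gamma>] by simp
  have fin_node: "?CL (real j / real n) < \<infinity>" if "j \<le> n" for j
    using that
  proof (induction j)
    case (Suc j)
    have "?CL (real (Suc j) / real n) \<le>
        ?CL (real j / real n) + ennreal (L j * (real (Suc j) / real n - real j / real n))"
      by (rule step) (use Suc n in \<open>auto simp: divide_right_mono\<close>)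
    also have "\<dots> < \<infinity>" using Suc by (simp add: ennreal_add_less_top)
    finally show ?case .
  qed (simp add: CL0)
  show fin1: "?CL 1 < \<infinity>" using fin_node[of n] n by simp
  have fin: "?CL t < top" if "t \<le> 1" for t
    using fin1 curve_length_mono[OF that, of 0 \<gamma>] by (simp add: le_less_trans)
  define len where "len = (\<lambda>t. enn2real (?CL t))"
  have CL: "?CL t = ennreal (len t)" if "t \<le> 1" for t
    using fin[OF that] by (simp add: len_def)
  have len0: "len 0 = 0" "\<And>t. len t \<ge> 0" by (simp_all add: len_def CL0)
  have lenmono: "len s \<le> len t" if "s \<le> t" "t \<le> 1" for s t
    unfolding len_def by (rule enn2real_mono) (use that fin curve_length_mono in auto)
  have T1: "t \<le> 1" "0 \<le> t" if "j < n" "t \<in> ?T j" for j t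
  proof -
    have "real (Suc j) / real n \<le> 1" "0 \<le> real j / real n" using that n by auto
    then show "t \<le> 1" "0 \<le> t" using that(2) by (meson atLeastAtMost_iff order_trans)+
  qed
  have lenlip: "len t - len s \<le> L j * (t - s)" if "j < n" "s \<in> ?T j" "t \<in> ?T j" "s \<le> t" for j s t
  proof -
    have "ennreal (len t) \<le> ennreal (len s) + ennreal (L j * (t - s))"
      using step[OF that] CL T1 that by simp
    then have "ennreal (len t) \<le> ennreal (len s + L j * (t - s))"
      using L[of j] len0(2)[of s] that(4) by (subst ennreal_plus) auto
    then have "len t \<le> len s + L j * (t - s)"
      using L[of j] len0(2)[of s] that(4) by (subst (asm) ennreal_le_iff) auto
    then show ?thesis by simp
  qed
  have cont: "continuous_on (?T j) len" if "j < n" for j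
  proof (rule lipschitz_on_continuous_on)
    show "(L j)-lipschitz_on (?T j) len"
    proof (rule lipschitz_onI)
      fix x y assume xy: "x \<in> ?T j" "y \<in> ?T j"
      have "dist (len s) (len t) \<le> L j * dist s t" if "s \<le> t" "s \<in> ?T j" "t \<in> ?T j" for s t
        using lenlip[OF \<open>j < n\<close> that(2,3,1)] lenmono[of s t] T1[OF \<open>j < n\<close>] that
        by (simp add: dist_real_def)
      then show "dist (len x) (len y) \<le> L j * dist x y"
        using xy by (metis dist_commute linorder_linear)
    qed (rule L)
  qed
  \<comment> \<open>\<open>len\<close> is known to be continuous on each piece only, so the
    intermediate value theorem is applied piece by piece. Every s up to the total length is then an
    arc length, which gives the choice in \<open>arc_length_param\<close> a witness.\<close>
  have attained: "\<exists>t\<in>{0..real m / real n}. len t = s" if "m \<le> n" "s \<in> {0..len (real m / real n)}" for m s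
    using that
  proof (induction m)
    case 0 then show ?case by (simp add: len0)
  next
    case (Suc m)
    show ?case
    proof (cases "s \<le> len (real m / real n)")
      case True
      then obtain t where "t \<in> {0..real m / real n}" "len t = s" using Suc by auto
      moreover have "real m / real n \<le> real (Suc m) / real n" using n by (simp add: divide_right_mono)
      ultimately show ?thesis by (intro bexI[of _ t]) simp_all
    next
      case False
      have "\<exists>t. real m / real n \<le> t \<and> t \<le> real (Suc m) / real n \<and> len t = s"
        by (rule IVT') (use False Suc n cont in \<open>auto simp: divide_right_mono\<close>)
      moreover have "0 \<le> real m / real n" by simp
      ultimately show ?thesis by (metis atLeastAtMost_iff order_trans)
    qed
  qed
  let ?I = "\<lambda>j. {len (real j / real n)..len (real (Suc j) / real n)}"
  have pt: "f (arc_length_param \<gamma> s) * indicator {0..enn2real (?CL 1)} s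
      \<le> (\<Sum>j<n. ennreal (c j) * indicator (?I j) s)" for s
  proof (cases "s \<in> {0..len 1}")
    case True
    \<comment> \<open>This is the parameter that \<open>arc_length_param\<close> picks. It may
      differ from the one found by \<open>attained\<close>, but it lies in some piece j and has arc
      length s, which places s in \<open>?I j\<close>.\<close>
    let ?t = "SOME t. t \<in> {0..1} \<and> ?CL t = ennreal s"
    have "\<exists>t. t \<in> {0..1} \<and> ?CL t = ennreal s"
      using attained[of n s] True n CL by fastforce
    then have t: "?t \<in> {0..1}" "?CL ?t = ennreal s" by (metis (mono_tags, lifting) someI_ex)+
    then have s: "len ?t = s" using True by (simp add: len_def)
    obtain j where j: "j < n" "?t \<in> ?T j" using unit_interval_subdivision[OF n t(1)] by blast
    have "real (Suc j) / real n \<le> 1" using j by simp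
    then have sI: "s \<in> ?I j"
      using lenmono[of "real j / real n" ?t] lenmono[of ?t "real (Suc j) / real n"] j(2) t(1) s
      by (simp add: atLeastAtMost_iff)
    have "f (arc_length_param \<gamma> s) \<le> ennreal (c j) * indicator (?I j) s"
      using f[OF j] sI by (simp add: arc_length_param_def)
    also have "\<dots> \<le> (\<Sum>j<n. ennreal (c j) * indicator (?I j) s)"
      by (rule member_le_sum) (use j in auto)
    finally show ?thesis using True by (simp add: len_def)
  qed (simp add: len_def)
  have "arc_length_integral \<gamma> f \<le> (\<integral>\<^sup>+ s. (\<Sum>j<n. ennreal (c j) * indicator (?I j) s) \<partial>lborel)"
    unfolding arc_length_integral_def by (intro nn_integral_mono pt)
  also have "\<dots> = (\<Sum>j<n. ennreal (c j) * emeasure lborel (?I j))"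
    by (subst nn_integral_sum) (auto simp: nn_integral_cmult)
  also have "\<dots> \<le> (\<Sum>j<n. ennreal (c j * (L j / real n)))"
  proof (rule sum_mono)
    fix j assume j: "j \<in> {..<n}"
    have le: "real j / real n \<le> real (Suc j) / real n" using n by (simp add: divide_right_mono)
    have "len (real (Suc j) / real n) - len (real j / real n) \<le> L j * (real (Suc j) / real n - real j / real n)"
      by (rule lenlip) (use j le in auto)
    also have "\<dots> = L j / real n" by (simp add: diff_divide_distrib[symmetric])
    finally have "emeasure lborel (?I j) \<le> ennreal (L j / real n)"
      using lenmono[OF le] j by (simp add: ennreal_leI)
    then show "ennreal (c j) * emeasure lborel (?I j) \<le> ennreal (c j * (L j / real n))"
      using c L by (subst ennreal_mult) (simp_all add: mult_left_mono)
  qed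
  also have "\<dots> = ennreal (\<Sum>j<n. c j * (L j / real n))"
    using c L by (simp add: sum_ennreal)
  finally show "arc_length_integral \<gamma> f \<le> ennreal (\<Sum>j<n. c j * (L j / real n))" .
qed

text \<open>Each edge gets a parameter interval of length 1/n and is traversed at n times its
  length; this is the Lipschitz constant \<open>L j\<close>, and \<open>L j / n\<close> is the edge
  length again.\<close>

lemma polygon_path_exists:
  fixes v :: "nat \<Rightarrow> 'a::real_normed_vector"
  assumes n: "0 < n" and c: "\<And>j. 0 \<le> c j"
    and seg: "\<And>j z. j < n \<Longrightarrow> z \<in> closed_segment (v j) (v (Suc j)) \<Longrightarrow> z \<in> S \<and> f z \<le> ennreal (c j)"
  shows "\<exists>\<gamma>. path \<gamma> \<and> rectifiable \<gamma> \<and> path_image \<gamma> \<subseteq> S \<and> pathstart \<gamma> = v 0 \<and> pathfinish \<gamma> = v n \<and>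
           arc_length_integral \<gamma> f \<le> ennreal (\<Sum>j<n. c j * dist (v j) (v (Suc j)))"
proof -
  let ?T = "\<lambda>j. {real j / real n..real (Suc j) / real n}"
  \<comment> \<open>At t = 1 the index is j = n with factor 0, so the value is v n whatever v (Suc
    n) is.\<close>
  define \<gamma> where "\<gamma> = (\<lambda>t. let j = nat \<lfloor>t * real n\<rfloor> in v j + (t * real n - real j) *\<^sub>R (v (Suc j) - v j))"
  have \<gamma>T: "\<gamma> t = v j + (t * real n - real j) *\<^sub>R (v (Suc j) - v j)" if "t \<in> ?T j" for j t
  proof (cases "t * real n = real (Suc j)")
    \<comment> \<open>At the right end of \<open>?T j\<close> the floor is already Suc j; both
      formulas give v (Suc j) there, so the pieces fit together.\<close>
    case True
    then have "nat \<lfloor>t * real n\<rfloor> = Suc j" by simp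
    then show ?thesis using True by (simp add: \<gamma>_def Let_def)
  next
    case False
    have "real j \<le> t * real n" "t * real n \<le> real (Suc j)" using that n by (auto simp: field_simps)
    then have "nat \<lfloor>t * real n\<rfloor> = j" using False by linarith
    then show ?thesis by (simp add: \<gamma>_def)
  qed
  have \<gamma>seg: "\<gamma> t \<in> closed_segment (v j) (v (Suc j))" if "t \<in> ?T j" for j t
  proof -
    have "real j \<le> t * real n" "t * real n \<le> real (Suc j)" using that n by (auto simp: field_simps)
    then show ?thesis unfolding in_segment
      by (intro exI[of _ "t * real n - real j"]) (auto simp: \<gamma>T[OF that] algebra_simps)
  qed
  define L where "L = (\<lambda>j. real n * dist (v j) (v (Suc j)))"
  have lip: "dist (\<gamma> s) (\<gamma> t) \<le> L j * \<bar>s - t\<bar>" if "s \<in> ?T j" "t \<in> ?T j" for j s t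
  proof -
    have "\<gamma> s - \<gamma> t = ((s - t) * real n) *\<^sub>R (v (Suc j) - v j)"
      by (simp add: \<gamma>T[OF that(1)] \<gamma>T[OF that(2)] algebra_simps)
    then have "dist (\<gamma> s) (\<gamma> t) = \<bar>s - t\<bar> * real n * dist (v (Suc j)) (v j)"
      by (simp add: dist_norm abs_mult)
    then show ?thesis by (simp add: L_def mult_ac dist_commute)
  qed
  have L0: "0 \<le> L j" for j by (simp add: L_def)
  have f: "f (\<gamma> t) \<le> ennreal (c j)" if "j < n" "t \<in> ?T j" for j t using seg[OF that(1) \<gamma>seg[OF that(2)]] by simp
  have cover: "{0..1} = (\<Union>j<n. ?T j)"
  proof
    show "{0..1} \<subseteq> (\<Union>j<n. ?T j)" using unit_interval_subdivision[OF n] by blast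
    show "(\<Union>j<n. ?T j) \<subseteq> {0..1}"
    proof
      fix t assume "t \<in> (\<Union>j<n. ?T j)"
      then obtain j where j: "j < n" "real j / real n \<le> t" "t \<le> real (Suc j) / real n" by auto
      moreover have "real (Suc j) / real n \<le> 1" "0 \<le> real j / real n" using j by auto
      ultimately show "t \<in> {0..1}" by (meson atLeastAtMost_iff order_trans)
    qed
  qed
  have "path \<gamma>"
    unfolding path_def cover
  proof (rule continuous_on_closed_Union)
    fix j assume "j \<in> {..<n}"
    show "continuous_on (?T j) \<gamma>"
      by (rule lipschitz_on_continuous_on[where L = "L j"], rule lipschitz_onI)
         (use lip L0 in \<open>auto simp: dist_real_def\<close>)
  qed auto
  moreover have "path_image \<gamma> \<subseteq> S"
    unfolding path_image_def cover using seg \<gamma>seg by fast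
  moreover have "pathstart \<gamma> = v 0" by (simp add: pathstart_def \<gamma>_def)
  moreover have "pathfinish \<gamma> = v n" by (simp add: pathfinish_def \<gamma>_def)
  moreover have "rectifiable \<gamma>" unfolding rectifiable_def
    by (rule curve_length_piecewise_Lipschitz[where f = f and n = n and L = L and c = c]) (fact n L0 c | rule lip f; assumption)+
  moreover have "arc_length_integral \<gamma> f \<le> ennreal (\<Sum>j<n. c j * (L j / real n))"
    by (rule arc_length_integral_le_piecewise) (fact n L0 c | rule lip f; assumption)+
  moreover have "L j / real n = dist (v j) (v (Suc j))" for j using n by (simp add: L_def)
  ultimately show ?thesis by auto
qed

subsection \<open>Continuous logarithms and separation\<close>

text \<open>The quotient differs from 1 by (x - z) / (z - a), of modulus less than 1, so it stays
  off the branch cut of \<open>Ln\<close>. Principal logarithms of such quotients are therefore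
  continuous.\<close>

lemma quotient_notin_nonpos_Reals:
  fixes a x z :: complex
  assumes "norm (x - z) < norm (z - a)"
  shows "(x - a) / (z - a) \<notin> \<real>\<^sub>\<le>\<^sub>0"
proof
  assume "(x - a) / (z - a) \<in> \<real>\<^sub>\<le>\<^sub>0"
  then obtain t where t: "t \<le> 0" "(x - a) / (z - a) = complex_of_real t"
    by (auto elim!: nonpos_Reals_cases)
  have "z \<noteq> a" using assms by auto
  then have "x - z = (of_real t - 1) * (z - a)" using t by (simp add: field_simps)
  then have "norm (x - z) = \<bar>t - 1\<bar> * norm (z - a)"
    by (metis norm_mult norm_of_real of_real_1 of_real_diff)
  moreover have "\<dots> \<ge> 1 * norm (z - a)"
    by (rule mult_right_mono) (use t in auto)
  ultimately show False using assms by simp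
qed

text \<open>For points x, y off S the existence of a continuous logarithm of (z - x) / (z - y) on S
  is an equivalence relation, and it holds for y near x through the principal branch. Hence each
  component of the complement lies in one class.\<close>

lemma connected_component_imp_quotient_log:
  fixes a b :: complex
  assumes "closed S" "connected_component (- S) a b"
  shows "\<exists>g. continuous_on S g \<and> (\<forall>z\<in>S. exp (g z) = (z - a) / (z - b))"
proof -
  let ?C = "connected_component_set (- S) a"
  let ?R = "\<lambda>x y. \<exists>g. continuous_on S g \<and> (\<forall>z\<in>S. exp (g z) = (z - x) / (z - y))"
  have CS: "x \<notin> S" if "x \<in> ?C" for x
    using that connected_component_subset by fastforce
  have "?R a b"
  proof (rule connected_equivalence_relation[of ?C])
    show "connected ?C" by simp
    show "a \<in> ?C" "b \<in> ?C"
      using assms by (auto simp: connected_component_eq_empty dest: connected_component_in)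
  next
    fix x y assume "?R x y"
    then obtain g where g: "continuous_on S g" "\<forall>z\<in>S. exp (g z) = (z - x) / (z - y)" by blast
    then show "?R y x"
      by (intro exI[of _ "\<lambda>z. - g z"]) (auto intro!: continuous_intros simp: exp_minus)
  next
    fix x y z assume "?R x y" "?R y z" and C: "x \<in> ?C" "y \<in> ?C" "z \<in> ?C"
    then obtain g h where g: "continuous_on S g" "\<forall>w\<in>S. exp (g w) = (w - x) / (w - y)"
      and h: "continuous_on S h" "\<forall>w\<in>S. exp (h w) = (w - y) / (w - z)" by blast
    have "w \<noteq> y" if "w \<in> S" for w using CS[OF C(2)] that by blast
    then show "?R x z" using g h
      by (intro exI[of _ "\<lambda>w. g w + h w"]) (auto intro!: continuous_intros simp: exp_add)
  next
    fix x assume x: "x \<in> ?C"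
    have "open (- S)" using assms by blast
    then obtain e where e: "e > 0" "ball x e \<subseteq> - S"
      using CS[OF x] by (meson ComplI openE)
    have R: "?R x y" if "y \<in> ball x e" for y
    proof (intro exI conjI ballI)
      have *: "(z - y) / (z - x) \<notin> \<real>\<^sub>\<le>\<^sub>0" if "z \<in> S" for z
      proof -
        have "(y - z) / (x - z) \<notin> \<real>\<^sub>\<le>\<^sub>0"
        proof (rule quotient_notin_nonpos_Reals)
          have "z \<notin> ball x e" using e that by blast
          then show "norm (y - x) < norm (x - z)" using \<open>y \<in> ball x e\<close>
            by (auto simp: dist_norm norm_minus_commute)
        qed
        then show ?thesis by (metis minus_diff_eq minus_divide_divide)
      qed
      have ne: "z \<noteq> x" "z \<noteq> y" if "z \<in> S" for z using e that \<open>y \<in> ball x e\<close> by (auto simp: subset_iff)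
      show "continuous_on S (\<lambda>z. - Ln ((z - y) / (z - x)))"
        by (intro continuous_intros) (use * ne in auto)
      show "exp (- Ln ((z - y) / (z - x))) = (z - x) / (z - y)" if "z \<in> S" for z
        using ne[OF that] by (simp add: exp_minus)
    qed
    show "\<exists>T. openin (top_of_set ?C) T \<and> x \<in> T \<and> (\<forall>y\<in>T. ?R x y)"
      by (intro exI[of _ "?C \<inter> ball x e"] conjI)
         (use x e R in \<open>auto intro: openin_open_Int\<close>)
  qed
  then show ?thesis .
qed

text \<open>Dividing the radial projections onto the circle from a and from b gives exp (i Im g), an
  inessential circle map. So the two projections are homotopic on S, and Borsuk's criterion puts a
  and b in one component.\<close>

lemma quotient_log_imp_connected_component:
  fixes a b :: complex
  assumes "compact S" "a \<notin> S" "b \<notin> S"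
    and g: "continuous_on S g" "\<And>z. z \<in> S \<Longrightarrow> exp (g z) = (z - a) / (z - b)"
  shows "connected_component (- S) a b"
proof -
  have ne: "z \<noteq> a" "z \<noteq> b" if "z \<in> S" for z using that assms by auto
  have 1: "(x - a) /\<^sub>R cmod (x - a) / ((x - b) /\<^sub>R cmod (x - b)) = exp (\<i> * of_real (Im (g x)))"
    if "x \<in> S" for x
  proof -
    have "exp (\<i> * of_real (Im (g x))) = exp (g x) /\<^sub>R norm (exp (g x))"
      by (subst (1) exp_eq_polar[of "g x"]) (simp add: cis_conv_exp scaleR_conv_of_real)
    also have "\<dots> = ((x - a) / (x - b)) /\<^sub>R norm ((x - a) / (x - b))" using g(2)[OF that] by simp
    finally show ?thesis using ne[OF that]
      by (simp add: scaleR_conv_of_real norm_divide field_simps)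
  qed
  have "homotopic_with_canon (\<lambda>x. True) S (sphere 0 1)
          (\<lambda>x. (x - a) /\<^sub>R cmod (x - a))  (\<lambda>x. (x - b) /\<^sub>R cmod (x - b))"
  proof (subst homotopic_circlemaps_divide, intro conjI)
    show "continuous_on S (\<lambda>x. (x - a) /\<^sub>R cmod (x - a))" "continuous_on S (\<lambda>x. (x - b) /\<^sub>R cmod (x - b))"
      by (intro continuous_intros; use ne in force)+
    show "\<exists>c. homotopic_with_canon (\<lambda>x. True) S (sphere 0 1)
            (\<lambda>x. (x - a) /\<^sub>R cmod (x - a) / ((x - b) /\<^sub>R cmod (x - b))) (\<lambda>x. c)"
      unfolding inessential_eq_continuous_logarithm_circle
      by (rule exI[of _ "\<lambda>x. Im (g x)"]) (use 1 g(1) in \<open>auto intro!: continuous_intros\<close>)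
  qed (use ne in \<open>auto simp: divide_simps\<close>)
  then show ?thesis
    using assms Borsuk_maps_homotopic_in_connected_component_eq[of S a b] by simp
qed

text \<open>All values of g - h have exponential c, so distinct ones are at least 2 pi apart; a
  continuous function on a connected set cannot jump between them.\<close>

lemma exp_eq_diff_constant_on:
  fixes g h :: "complex \<Rightarrow> complex"
  assumes "connected S" "continuous_on S g" "continuous_on S h"
    and eq: "\<And>x. x \<in> S \<Longrightarrow> exp (g x) = c * exp (h x)"
  shows "\<exists>k. \<forall>x\<in>S. g x - h x = k"
proof -
  have "(\<lambda>x. g x - h x) constant_on S"
  proof (rule continuous_discrete_range_constant)
    show "continuous_on S (\<lambda>x. g x - h x)" using assms by (intro continuous_intros)
    fix x assume x: "x \<in> S"
    have "2 * pi \<le> cmod (g y - h y - (g x - h x))"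
      if y: "y \<in> S" and ne: "g y - h y \<noteq> g x - h x" for y
    proof -
      have "exp (g x - h x) = c" "exp (g y - h y) = c"
        using eq[OF x] eq[OF y] by (auto simp: exp_diff)
      then have "\<not> \<bar>Im (g y - h y) - Im (g x - h x)\<bar> < 2 * pi"
        using ne exp_complex_eqI by metis
      then show ?thesis
        using abs_Im_le_cmod[of "g y - h y - (g x - h x)"] by simp
    qed
    then show "\<exists>e>0. \<forall>y. y \<in> S \<and> g y - h y \<noteq> g x - h x \<longrightarrow> e \<le> cmod (g y - h y - (g x - h x))"
      by (intro exI[of _ "2 * pi"]) auto
  qed (rule assms)
  then show ?thesis by (auto simp: constant_on_def)
qed

text \<open>With \<open>f z = (z - a) / (z - b)\<close> and a logarithm \<open>lam\<close> of \<open>f\<close> on the complement \<open>K\<close> of \<open>W\<close>, the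
  logarithm of \<open>f x / f z\<close> that vanishes at \<open>x = z\<close> is \<open>ell x z\<close>. At the points \<open>z\<close> of \<open>N\<close> the difference
  \<open>lam k - ell k z\<close> does not depend on \<open>k \<in> K\<close> near \<open>z\<close>, and its value extends \<open>lam\<close> continuously to
  \<open>K \<union> N\<close>. The factor 2 in the radius makes the disc around \<open>z\<close> meet \<open>K\<close>, also after moving \<open>z\<close> a little.\<close>

lemma separating_points_connect:
  fixes W :: "complex set"
  assumes W: "open W" "bounded W" and conn: "connected (- W)" and ab: "connected_component W a b"
  shows "\<exists>G. open G \<and> connected_component G a b \<and>
           G \<subseteq> {z \<in> W. a \<in> ball z (2 * infdist z (- W)) \<or> b \<in> ball z (2 * infdist z (- W)) \<or>
                   \<not> connected_component (W - cball z (2 * infdist z (- W))) a b}"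
proof -
  define K where "K = - W"
  define \<delta> where "\<delta> = (\<lambda>z. infdist z K)"
  define B where "B = (\<lambda>z. ball z (2 * \<delta> z))"
  have clK: "closed K" using W by (simp add: K_def closed_Compl)
  have neK: "K \<noteq> {}" using W(2) unfolding K_def
    by (metis Compl_eq_Compl_iff Compl_empty_eq double_compl not_bounded_UNIV)
  have abW: "a \<in> W" "b \<in> W" using ab connected_component_in by blast+
  have \<delta>pos: "\<delta> z > 0" if "z \<in> W" for z
    using that clK neK by (simp add: \<delta>_def K_def infdist_pos_not_in_closed)
  have cont\<delta>: "continuous_on UNIV \<delta>" unfolding \<delta>_def by (intro continuous_intros)
  obtain lam where lam: "continuous_on K lam" "\<And>k. k \<in> K \<Longrightarrow> exp (lam k) = (k - a) / (k - b)"
    using connected_component_imp_quotient_log[of K a b] clK ab by (auto simp: K_def)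
  define ell where "ell = (\<lambda>x z. Ln ((x - a) / (z - a)) - Ln ((x - b) / (z - b)))"
  have exp_ell: "exp (ell x z) = ((x - a) / (x - b)) / ((z - a) / (z - b))"
    if "x \<noteq> a" "x \<noteq> b" "z \<noteq> a" "z \<noteq> b" for x z
    using that by (simp add: ell_def exp_diff field_simps)
  have ell_lim: "((\<lambda>i. ell (X i) (Z i)) \<longlongrightarrow> ell x z) F"
    if "(X \<longlongrightarrow> x) F" "(Z \<longlongrightarrow> z) F" "dist x z < dist z a" "dist x z < dist z b" for X Z x z F
  proof -
    have "z \<noteq> a" "z \<noteq> b" using that by auto
    then show ?thesis unfolding ell_def
      by (intro tendsto_intros that quotient_notin_nonpos_Reals)
         (use that in \<open>auto simp: dist_norm\<close>)
  qed
  \<comment> \<open>A choice of nearest points, not continuous in general. Near a point z0 of K it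
    is controlled by dist (p z) z0 <= 2 dist z z0; near a point z0 of N the fixed point
    \<open>p z0\<close> replaces it, since it stays in \<open>B z\<close>.\<close>
  obtain p where p: "\<And>z. p z \<in> K" "\<And>z. dist z (p z) = \<delta> z"
    unfolding \<delta>_def by (metis infdist_attains_inf[OF clK neK])
  define N where "N = {z \<in> W. a \<notin> B z \<and> b \<notin> B z \<and> (\<exists>c. \<forall>k\<in>K \<inter> B z. lam k - ell k z = c)}"
  define \<Lambda> where "\<Lambda> = (\<lambda>z. if z \<in> K then lam z else lam (p z) - ell (p z) z)"
  have NW: "N \<subseteq> W" by (auto simp: N_def)
  have Kab: "k \<noteq> a" "k \<noteq> b" if "k \<in> K" for k using that abW by (auto simp: K_def)
  have pB: "p z \<in> B z" if "z \<in> W" for z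
    using p(2)[of z] \<delta>pos[OF that] by (auto simp: B_def)
  have N_eq: "\<Lambda> z = lam k - ell k z" if "z \<in> N" "k \<in> K" "k \<in> B z" for z k
  proof -
    have "z \<in> W" "z \<notin> K" using that by (auto simp: N_def K_def)
    then show ?thesis using that pB[of z] p(1)[of z] by (auto simp: N_def \<Lambda>_def)
  qed
  have B_dist: "dist k z < dist z a" "dist k z < dist z b" if "k \<in> B z" "a \<notin> B z" "b \<notin> B z" for k z
    using that by (auto simp: B_def dist_commute)
  have NB: "z \<noteq> a" "z \<noteq> b" if "a \<notin> B z" "b \<notin> B z" "z \<in> W" for z
    using that \<delta>pos by (auto simp: B_def)
  have exp\<Lambda>: "exp (\<Lambda> z) = (z - a) / (z - b)" if "z \<in> K \<union> N" for z
  proof (cases "z \<in> K")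
    case True then show ?thesis using lam by (simp add: \<Lambda>_def)
  next
    case False
    then have z: "z \<in> N" "z \<in> W" using that NW by auto
    have zab: "z \<noteq> a" "z \<noteq> b" using z NB by (auto simp: N_def)
    have "exp (\<Lambda> z) = exp (lam (p z)) / exp (ell (p z) z)"
      using False by (simp add: \<Lambda>_def exp_diff)
    moreover have "(p z - a) / (p z - b) \<noteq> 0" using Kab[OF p(1)] by simp
    ultimately show ?thesis
      unfolding lam(2)[OF p(1)] exp_ell[OF Kab[OF p(1)] zab] by simp
  qed
  have cont\<Lambda>: "continuous_on (K \<union> N) \<Lambda>"
    unfolding continuous_on_def
  proof
    fix z0 assume z0: "z0 \<in> K \<union> N"
    show "(\<Lambda> \<longlongrightarrow> \<Lambda> z0) (at z0 within K \<union> N)"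
    proof (cases "z0 \<in> K")
      case True
      have 1: "(\<Lambda> \<longlongrightarrow> \<Lambda> z0) (at z0 within K)"
      proof -
        have "(lam \<longlongrightarrow> lam z0) (at z0 within K)" using lam(1) True by (simp add: continuous_on_def)
        moreover have "eventually (\<lambda>z. lam z = \<Lambda> z) (at z0 within K)"
          by (auto simp: eventually_at_filter \<Lambda>_def)
        ultimately show ?thesis using True by (auto simp: \<Lambda>_def intro: Lim_transform_eventually)
      qed
      have 2: "(\<Lambda> \<longlongrightarrow> \<Lambda> z0) (at z0 within N)"
      proof -
        have id: "((\<lambda>z. z) \<longlongrightarrow> z0) (at z0 within N)" by (simp add: tendsto_ident_at)
        have plim: "(p \<longlongrightarrow> z0) (at z0 within N)"
        proof (rule tendstoI)
          fix e :: real assume "e > 0"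
          have "dist (p z) z0 \<le> 2 * dist z z0" for z
          proof -
            have "\<delta> z \<le> dist z z0" unfolding \<delta>_def using True by (rule infdist_le)
            then show ?thesis using p(2)[of z] dist_triangle[of "p z" z0 z] by (simp add: dist_commute)
          qed
          moreover have "eventually (\<lambda>z. dist z z0 < e / 2) (at z0 within N)"
            using tendstoD[OF id, of "e / 2"] \<open>e > 0\<close> by simp
          ultimately show "eventually (\<lambda>z. dist (p z) z0 < e) (at z0 within N)"
            by (smt (verit) eventually_mono field_sum_of_halves)
        qed
        have "((\<lambda>z. lam (p z) - ell (p z) z) \<longlongrightarrow> lam z0 - ell z0 z0) (at z0 within N)"
        proof (intro tendsto_diff ell_lim plim id)
          show "((\<lambda>z. lam (p z)) \<longlongrightarrow> lam z0) (at z0 within N)"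
            by (rule continuous_on_tendsto_compose[OF lam(1) plim True]) (simp add: p)
        qed (use Kab[OF True] in auto)
        moreover have "lam z0 - ell z0 z0 = \<Lambda> z0"
          using True Kab[OF True] by (simp add: ell_def \<Lambda>_def)
        moreover have "eventually (\<lambda>z. lam (p z) - ell (p z) z = \<Lambda> z) (at z0 within N)"
          using NW by (auto simp: eventually_at_filter \<Lambda>_def K_def intro!: always_eventually)
        ultimately show ?thesis by (auto intro: Lim_transform_eventually)
      qed
      show ?thesis using 1 2 by (simp add: at_within_union filterlim_sup)
    next
      case False
      then have z: "z0 \<in> N" "z0 \<in> W" using z0 NW by auto
      have id: "((\<lambda>z. z) \<longlongrightarrow> z0) (at z0 within K \<union> N)" by (simp add: tendsto_ident_at)
      have c\<delta>: "(\<delta> \<longlongrightarrow> \<delta> z0) (at z0 within K \<union> N)"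
        using cont\<delta> by (meson UNIV_I continuous_on_def tendsto_within_subset top_greatest)
      have "((\<lambda>z. lam (p z0) - ell (p z0) z) \<longlongrightarrow> lam (p z0) - ell (p z0) z0) (at z0 within K \<union> N)"
        using B_dist[OF pB[OF z(2)]] z(1)
        by (intro tendsto_intros ell_lim id) (auto simp: N_def)
      moreover have "eventually (\<lambda>z. lam (p z0) - ell (p z0) z = \<Lambda> z) (at z0 within K \<union> N)"
      proof -
        have "((\<lambda>z. 2 * \<delta> z - dist z (p z0)) \<longlongrightarrow> 2 * \<delta> z0 - dist z0 (p z0)) (at z0 within K \<union> N)"
          by (intro tendsto_intros id c\<delta>)
        then have "eventually (\<lambda>z. 2 * \<delta> z - dist z (p z0) > 0) (at z0 within K \<union> N)"
          by (rule order_tendstoD) (use p(2)[of z0] \<delta>pos[OF z(2)] in auto)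
        moreover have "eventually (\<lambda>z. z \<in> W) (at z0 within K \<union> N)"
          using W(1) z(2) topological_tendstoD[OF id] by blast
        moreover have "eventually (\<lambda>z. z \<in> K \<union> N) (at z0 within K \<union> N)"
          by (simp add: eventually_at_filter)
        ultimately show ?thesis
        proof eventually_elim
          case (elim z)
          then show ?case using N_eq[of z "p z0"] p(1) by (auto simp: B_def K_def)
        qed
      qed
      moreover have "\<Lambda> z0 = lam (p z0) - ell (p z0) z0" using False by (simp add: \<Lambda>_def)
      ultimately show ?thesis by (auto intro: Lim_transform_eventually)
    qed
  qed
  \<comment> \<open>Closedness makes W - N open. The conditions on a and b pass to limits because
    \<open>B z\<close> is an open disc whose radius is continuous in z, and so does the constancy: a
    point k of the open disc B l lies in B (x n) for all large n.\<close>
  have closed: "closed (K \<union> N)"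
    unfolding closed_sequential_limits
  proof (intro allI impI, elim conjE)
    fix x l assume x: "\<forall>n. x n \<in> K \<union> N" and xl: "x \<longlonglongrightarrow> l"
    show "l \<in> K \<union> N"
    proof (cases "l \<in> K")
      case False
      then have lW: "l \<in> W" by (simp add: K_def)
      have "eventually (\<lambda>n. x n \<in> W) sequentially" using W(1) lW xl by (simp add: topological_tendstoD)
      then have evN: "eventually (\<lambda>n. x n \<in> N) sequentially"
        by eventually_elim (use x in \<open>auto simp: K_def\<close>)
      have \<delta>l: "(\<lambda>n. \<delta> (x n)) \<longlonglongrightarrow> \<delta> l"
        using continuous_on_tendsto_compose[OF cont\<delta> xl] by simp
      have notB: "c \<notin> B l" if "\<And>z. z \<in> N \<Longrightarrow> c \<notin> B z" for c
      proof -
        have "2 * \<delta> l \<le> dist l c"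
        proof (rule tendsto_le)
          show "(\<lambda>n. dist (x n) c) \<longlonglongrightarrow> dist l c" "(\<lambda>n. 2 * \<delta> (x n)) \<longlonglongrightarrow> 2 * \<delta> l"
            by (intro tendsto_intros xl \<delta>l)+
          show "eventually (\<lambda>n. 2 * \<delta> (x n) \<le> dist (x n) c) sequentially"
            using evN by eventually_elim (use that in \<open>auto simp: B_def not_less\<close>)
        qed simp
        then show ?thesis by (simp add: B_def)
      qed
      have ab: "a \<notin> B l" "b \<notin> B l" by (rule notB; simp add: N_def)+
      have evB: "eventually (\<lambda>n. k \<in> B (x n)) sequentially" if "k \<in> B l" for k
      proof -
        have "(\<lambda>n. 2 * \<delta> (x n) - dist (x n) k) \<longlonglongrightarrow> 2 * \<delta> l - dist l k"
          by (intro tendsto_intros xl \<delta>l)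
        then have "eventually (\<lambda>n. 2 * \<delta> (x n) - dist (x n) k > 0) sequentially"
          by (rule order_tendstoD) (use that in \<open>auto simp: B_def\<close>)
        then show ?thesis by eventually_elim (simp add: B_def)
      qed
      have "lam k - ell k l = lam (p l) - ell (p l) l" if k: "k \<in> K" "k \<in> B l" for k
      proof (rule tendsto_unique[OF sequentially_bot])
        show "(\<lambda>n. lam k - ell k (x n)) \<longlonglongrightarrow> lam k - ell k l"
          using B_dist[OF k(2) ab] by (intro tendsto_intros ell_lim xl) auto
        have "(\<lambda>n. lam (p l) - ell (p l) (x n)) \<longlonglongrightarrow> lam (p l) - ell (p l) l"
          using B_dist[OF pB[OF lW] ab] by (intro tendsto_intros ell_lim xl) auto
        moreover have "eventually (\<lambda>n. lam (p l) - ell (p l) (x n) = lam k - ell k (x n)) sequentially"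
          using evB[OF k(2)] evB[OF pB[OF lW]] evN
          by eventually_elim (metis N_eq k(1) p(1))
        ultimately show "(\<lambda>n. lam k - ell k (x n)) \<longlonglongrightarrow> lam (p l) - ell (p l) l"
          by (rule Lim_transform_eventually)
      qed
      then show ?thesis using lW ab by (auto simp: N_def)
    qed simp
  qed
  obtain R where R: "W \<subseteq> ball 0 R"
    using W(2) bounded_subset_ballD by blast
  \<comment> \<open>Borsuk's criterion is for compact sets, so K \<union> N is cut by a disc that
    contains W.\<close>
  let ?S = "(K \<union> N) \<inter> cball 0 R"
  have aN: "a \<notin> N" "b \<notin> N" using abW \<delta>pos by (auto simp: N_def B_def)
  have "connected_component (- ?S) a b"
  proof (rule quotient_log_imp_connected_component)
    show "compact ?S" using closed by (simp add: closed_Int_compact)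
    show "continuous_on ?S \<Lambda>" by (rule continuous_on_subset[OF cont\<Lambda>]) auto
    show "a \<notin> ?S" "b \<notin> ?S" using aN abW by (auto simp: K_def)
    show "exp (\<Lambda> z) = (z - a) / (z - b)" if "z \<in> ?S" for z using that exp\<Lambda> by blast
  qed
  then obtain T where T: "connected T" "T \<subseteq> - ?S" "a \<in> T" "b \<in> T"
    by (auto simp: connected_component_def)
  \<comment> \<open>Outside the large disc everything belongs to K. Otherwise the complement of K
    \<union> N and the outside of the disc would be disjoint open sets that cover T and both meet
    it.\<close>
  have "T \<subseteq> - (K \<union> N)"
  proof (rule ccontr)
    assume "\<not> T \<subseteq> - (K \<union> N)"
    then have "- cball 0 R \<inter> T \<noteq> {}" using T by blast
    moreover have "- (K \<union> N) \<inter> T \<noteq> {}" using T(3) aN Kab by blast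
    moreover have "- (K \<union> N) \<inter> - cball 0 R \<inter> T = {}" using R by (auto simp: K_def)
    moreover have "T \<subseteq> - (K \<union> N) \<union> - cball 0 R" using T(2) by blast
    moreover have "open (- (K \<union> N))" "open (- cball (0::complex) R)"
      using open_Compl[OF closed] by auto
    ultimately show False using T(1) connectedD by blast
  qed
  then have "connected_component (W - N) a b"
    unfolding connected_component_def using T by (intro exI[of _ T]) (auto simp: K_def)
  moreover have "W - N \<subseteq> {z \<in> W. a \<in> B z \<or> b \<in> B z \<or> \<not> connected_component (W - cball z (2 * \<delta> z)) a b}"
  proof
    fix z assume z: "z \<in> W - N"
    \<comment> \<open>A non-separating disc gives a logarithm h on K together with the closed disc.
      As K is connected, h differs from \<open>lam\<close> by a constant on K; as B z is connected,
      h differs from \<open>ell\<close> by a constant on B z. Subtracting the two shows z \<in> N.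
      This is where the connectedness of the complement of W enters.\<close>
    have False if ab: "a \<notin> B z" "b \<notin> B z" and cc: "connected_component (W - cball z (2 * \<delta> z)) a b"
    proof -
      have zab: "z \<noteq> a" "z \<noteq> b" using NB ab z by auto
      have Bab: "x \<noteq> a" "x \<noteq> b" if "x \<in> B z" for x using that ab by auto
      have eq: "- (K \<union> cball z (2 * \<delta> z)) = W - cball z (2 * \<delta> z)" by (auto simp: K_def)
      have "\<exists>h. continuous_on (K \<union> cball z (2 * \<delta> z)) h \<and>
              (\<forall>x\<in>K \<union> cball z (2 * \<delta> z). exp (h x) = (x - a) / (x - b))"
        by (rule connected_component_imp_quotient_log) (use cc clK in \<open>simp_all only: eq closed_Un closed_cball\<close>)
      then obtain h where h: "continuous_on (K \<union> cball z (2 * \<delta> z)) h"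
        "\<And>x. x \<in> K \<union> cball z (2 * \<delta> z) \<Longrightarrow> exp (h x) = (x - a) / (x - b)" by blast
      have BB: "B z \<subseteq> cball z (2 * \<delta> z)" by (auto simp: B_def)
      have "\<exists>c1. \<forall>x\<in>K. h x - lam x = c1"
        by (rule exp_eq_diff_constant_on[where c = 1])
           (use conn lam h in \<open>auto simp: K_def[symmetric] intro: continuous_on_subset\<close>)
      moreover have "\<exists>c2. \<forall>x\<in>B z. h x - ell x z = c2"
      proof (rule exp_eq_diff_constant_on[where c = "(z - a) / (z - b)"])
        show "connected (B z)" by (simp add: B_def)
        show "continuous_on (B z) h" using h(1) BB by (auto intro: continuous_on_subset)
        show "continuous_on (B z) (\<lambda>x. ell x z)"
          unfolding continuous_on_def
        proof
          fix x assume "x \<in> B z"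
          then show "((\<lambda>x. ell x z) \<longlongrightarrow> ell x z) (at x within B z)"
            using B_dist[of x z] ab by (intro ell_lim tendsto_intros) auto
        qed
        fix x assume x: "x \<in> B z"
        then show "exp (h x) = (z - a) / (z - b) * exp (ell x z)"
          using h(2)[of x] BB exp_ell[of x z] zab Bab[OF x] by auto
      qed
      ultimately obtain c1 c2 where c: "\<forall>x\<in>K. h x - lam x = c1" "\<forall>x\<in>B z. h x - ell x z = c2" by blast
      have "\<forall>k\<in>K \<inter> B z. lam k - ell k z = c2 - c1"
      proof
        fix k assume "k \<in> K \<inter> B z"
        then have "h k - lam k = c1" "h k - ell k z = c2" using c by auto
        then show "lam k - ell k z = c2 - c1" by (metis add_diff_cancel_left' diff_add_cancel diff_diff_eq2)
      qed
      then show False using z ab by (auto simp: N_def)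
    qed
    then show "z \<in> {z \<in> W. a \<in> B z \<or> b \<in> B z \<or> \<not> connected_component (W - cball z (2 * \<delta> z)) a b}"
      using z by blast
  qed
  moreover have "open (W - N)"
  proof -
    have "W - N = - (K \<union> N)" by (auto simp: K_def)
    then show ?thesis using open_Compl[OF closed] by simp
  qed
  ultimately show ?thesis unfolding B_def \<delta>_def K_def by blast
qed

subsection \<open>Smooth functions\<close>

lemma times_continuously_diff_SucI:
  assumes "\<And>x. (f has_derivative f' x) (at x)" "\<And>v. times_continuously_diff k (\<lambda>x. f' x v)"
  shows "times_continuously_diff (Suc k) f"
proof -
  have "frechet_derivative f (at x) = f' x" for x
    using frechet_derivative_at[OF assms(1)] by simp
  then show ?thesis using assms by (auto intro: differentiableI)
qed

lemma times_continuously_diff_SucD: "times_continuously_diff (Suc k) f \<Longrightarrow> times_continuously_diff k f"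
proof (induction k arbitrary: f)
  case 0
  then show ?case
    by (auto intro!: differentiable_imp_continuous_on simp: differentiable_on_def
        intro: differentiable_at_withinI)
next
  case (Suc k)
  then show ?case by auto
qed

lemma times_continuously_diff_has_derivative:
  "times_continuously_diff (Suc k) f \<Longrightarrow> (f has_derivative frechet_derivative f (at x)) (at x)"
  by (simp add: frechet_derivative_works[symmetric])

lemma times_continuously_diff_const: "times_continuously_diff k (\<lambda>x. c)"
proof (induction k arbitrary: c)
  case (Suc k)
  show ?case
    by (rule times_continuously_diff_SucI[where f' = "\<lambda>x v. 0"]) (use Suc in auto)
qed simp

lemma times_continuously_diff_bounded_linear:
  assumes "bounded_linear f" shows "times_continuously_diff k f"
proof (cases k)
  case 0
  then show ?thesis using assms by (simp add: linear_continuous_on)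
next
  case (Suc j)
  show ?thesis unfolding Suc
    by (rule times_continuously_diff_SucI[where f' = "\<lambda>x v. f v"])
       (use assms in \<open>auto intro: bounded_linear_imp_has_derivative times_continuously_diff_const\<close>)
qed

lemma times_continuously_diff_add:
  "times_continuously_diff k f \<Longrightarrow> times_continuously_diff k g \<Longrightarrow> times_continuously_diff k (\<lambda>x. f x + g x)"
proof (induction k arbitrary: f g)
  case (Suc k)
  show ?case
    by (rule times_continuously_diff_SucI[where
          f' = "\<lambda>x v. frechet_derivative f (at x) v + frechet_derivative g (at x) v"])
       (use Suc in \<open>auto intro!: has_derivative_add simp: frechet_derivative_works[symmetric]\<close>)
qed (auto intro: continuous_intros)

lemma times_continuously_diff_mult:
  "times_continuously_diff k f \<Longrightarrow> times_continuously_diff k g \<Longrightarrow> times_continuously_diff k (\<lambda>x. f x * g x)"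
proof (induction k arbitrary: f g)
  case (Suc k)
  show ?case
  proof (rule times_continuously_diff_SucI[where
          f' = "\<lambda>x v. f x * frechet_derivative g (at x) v + frechet_derivative f (at x) v * g x"])
    show "((\<lambda>x. f x * g x) has_derivative
        (\<lambda>v. f x * frechet_derivative g (at x) v + frechet_derivative f (at x) v * g x)) (at x)" for x
      using Suc.prems by (intro has_derivative_mult times_continuously_diff_has_derivative)
    show "times_continuously_diff k
        (\<lambda>x. f x * frechet_derivative g (at x) v + frechet_derivative f (at x) v * g x)" for v
      using Suc.prems times_continuously_diff_SucD
      by (intro times_continuously_diff_add Suc.IH) auto
  qed
qed (auto intro: continuous_intros)

lemma times_continuously_diff_cmult: "times_continuously_diff k f \<Longrightarrow> times_continuously_diff k (\<lambda>x. c * f x)"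
  by (intro times_continuously_diff_mult times_continuously_diff_const)

lemma times_continuously_diff_sum:
  "(\<And>i. i \<in> I \<Longrightarrow> times_continuously_diff k (f i)) \<Longrightarrow> times_continuously_diff k (\<lambda>x. \<Sum>i\<in>I. f i x)"
  by (induction I rule: infinite_finite_induct)
     (auto intro: times_continuously_diff_const times_continuously_diff_add)

lemma times_continuously_diff_prod:
  "(\<And>i. i \<in> I \<Longrightarrow> times_continuously_diff k (f i)) \<Longrightarrow> times_continuously_diff k (\<lambda>x. \<Prod>i\<in>I. f i x)"
  by (induction I rule: infinite_finite_induct)
     (auto intro: times_continuously_diff_const times_continuously_diff_mult)

text \<open>The sequence h carries its own derivatives: the chain rule produces h (Suc n) composed
  with p times a derivative of p, so the induction over k closes with n left arbitrary.\<close>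

lemma times_continuously_diff_compose:
  assumes h: "\<And>n t. (h n has_real_derivative h (Suc n) t) (at t)"
    and p: "\<And>k. times_continuously_diff k p"
  shows "times_continuously_diff k (\<lambda>x. h n (p x))"
proof (induction k arbitrary: n)
  case 0
  have "continuous_on UNIV (h n)" by (meson DERIV_isCont continuous_at_imp_continuous_on h)
  then show ?case using p[of 0] by (auto intro: continuous_on_compose2)
next
  case (Suc k)
  show ?case
  proof (rule times_continuously_diff_SucI[where
          f' = "\<lambda>x v. frechet_derivative p (at x) v * h (Suc n) (p x)"])
    show "((\<lambda>x. h n (p x)) has_derivative (\<lambda>v. frechet_derivative p (at x) v * h (Suc n) (p x))) (at x)" for x
      using has_derivative_compose[OF times_continuously_diff_has_derivative[OF p]
          has_field_derivative_imp_has_derivative[OF h]]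
      by (simp add: mult_ac)
    show "times_continuously_diff k (\<lambda>x. frechet_derivative p (at x) v * h (Suc n) (p x))" for v
      using p[of "Suc k"] Suc by (intro times_continuously_diff_mult) auto
  qed
qed

lemma test_functionI:
  assumes "\<And>k. times_continuously_diff k \<phi>" "compact K" "K \<subseteq> \<Omega>" "\<And>x. x \<notin> K \<Longrightarrow> \<phi> x = 0"
  shows "test_function \<Omega> \<phi>"
proof -
  have "{x. \<phi> x \<noteq> 0} \<subseteq> K" using assms(4) by blast
  then have "closure {x. \<phi> x \<noteq> 0} \<subseteq> K"
    using assms(2) by (simp add: closure_minimal compact_imp_closed)
  then show ?thesis unfolding test_function_def
    using assms compact_Int_closed[of K "closure {x. \<phi> x \<noteq> 0}"] by (simp add: Int_absorb1 subset_trans)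
qed

text \<open>The recursion is the chain rule in x = 1/t: the derivative of P(1/t) exp(-1/t) in t is
  x^2 (P - P')(x) exp(-x), and the two \<open>pCons 0\<close> multiply by x^2.\<close>

primrec flat_poly :: "nat \<Rightarrow> real poly" where
  "flat_poly 0 = 1"
| "flat_poly (Suc n) = pCons 0 (pCons 0 (flat_poly n - pderiv (flat_poly n)))"

text \<open>The \<open>n\<close>-th derivative of the flat function \<open>exp (- 1 / t)\<close>.\<close>

definition flat :: "nat \<Rightarrow> real \<Rightarrow> real" where
  "flat n t = (if t > 0 then poly (flat_poly n) (inverse t) * exp (- inverse t) else 0)"

lemma poly_times_exp_minus_tendsto_0: "((\<lambda>x::real. poly p x * exp (- x)) \<longlongrightarrow> 0) at_top"
proof -
  have "((\<lambda>x::real. \<Sum>i\<le>degree p. coeff p i * (x ^ i / exp x)) \<longlongrightarrow> (\<Sum>i\<le>degree p. coeff p i * 0)) at_top"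
    by (intro tendsto_sum tendsto_mult tendsto_const tendsto_power_div_exp_0)
  then show ?thesis by (simp add: poly_altdef sum_distrib_right exp_minus divide_inverse mult_ac sum_distrib_left)
qed

lemma DERIV_flat: "(flat n has_real_derivative flat (Suc n) t) (at t)"
proof -
  consider "t > 0" | "t < 0" | "t = 0" by linarith
  then show ?thesis
  proof cases
    case 1
    have "((\<lambda>t. poly (flat_poly n) (inverse t) * exp (- inverse t)) has_real_derivative
        (poly (pderiv (flat_poly n)) (inverse t) * (- (inverse t ^ Suc (Suc 0)))) * exp (- inverse t)
        + exp (- inverse t) * (inverse t ^ Suc (Suc 0)) * poly (flat_poly n) (inverse t)) (at t)"
      using 1 by (auto intro!: derivative_eq_intros)
    moreover have "(poly (pderiv (flat_poly n)) (inverse t) * (- (inverse t ^ Suc (Suc 0)))) * exp (- inverse t)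
        + exp (- inverse t) * (inverse t ^ Suc (Suc 0)) * poly (flat_poly n) (inverse t) = flat (Suc n) t"
      using 1 by (simp add: flat_def algebra_simps)
    ultimately have "((\<lambda>t. poly (flat_poly n) (inverse t) * exp (- inverse t)) has_real_derivative flat (Suc n) t) (at t)"
      by simp
    then show ?thesis
      by (rule DERIV_cong_ev[THEN iffD1, rotated 3])
         (use 1 in \<open>auto simp: flat_def eventually_nhds_metric dist_real_def intro!: exI[of _ t]\<close>)
  next
    case 2
    have "((\<lambda>t. 0) has_real_derivative flat (Suc n) t) (at t)" using 2 by (simp add: flat_def)
    then show ?thesis
      by (rule DERIV_cong_ev[THEN iffD1, rotated 3])
         (use 2 in \<open>auto simp: flat_def eventually_nhds_metric dist_real_def intro!: exI[of _ "- t"]\<close>)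
  next
    case 3
    \<comment> \<open>Dividing by h multiplies the polynomial in 1/h by one more factor 1/h, hence
      the extra \<open>pCons 0\<close>.\<close>
    have "((\<lambda>h. flat n h / h) \<longlongrightarrow> 0) (at_right 0)"
    proof (rule Lim_transform_eventually)
      show "((\<lambda>h. poly (pCons 0 (flat_poly n)) (inverse h) * exp (- inverse h)) \<longlongrightarrow> 0) (at_right (0::real))"
        using filterlim_compose[OF poly_times_exp_minus_tendsto_0 filterlim_inverse_at_top_right] .
      show "\<forall>\<^sub>F h in at_right 0. poly (pCons 0 (flat_poly n)) (inverse h) * exp (- inverse h) = flat n h / h"
        by (auto simp: eventually_at_right_field flat_def field_simps intro!: exI[of _ 1])
    qed
    moreover have "((\<lambda>h. flat n h / h) \<longlongrightarrow> 0) (at_left 0)"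
      by (rule tendsto_eventually) (auto simp: eventually_at_left_field flat_def intro!: exI[of _ "-1"])
    ultimately show ?thesis
      by (simp add: 3 DERIV_def flat_def filterlim_at_split)
  qed
qed

lemma flat_0_nonneg: "0 \<le> flat 0 t" and flat_0_le_1: "flat 0 t \<le> 1" and flat_nonpos: "t \<le> 0 \<Longrightarrow> flat n t = 0"
  and flat_0_pos: "t > 0 \<Longrightarrow> flat 0 t > 0"
  by (auto simp: flat_def)

lemma continuous_on_flat [continuous_intros]: "continuous_on S f \<Longrightarrow> continuous_on S (\<lambda>x. flat n (f x))"
  by (rule continuous_on_compose2[where t = UNIV])
     (auto intro!: DERIV_isCont DERIV_flat continuous_at_imp_continuous_on)

lemma times_continuously_diff_flat:
  "(\<And>k. times_continuously_diff k p) \<Longrightarrow> times_continuously_diff k (\<lambda>x. flat n (p x))"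
  by (rule times_continuously_diff_compose[where h = flat]) (rule DERIV_flat)

text \<open>Scaling turns the flat function into smooth approximations of the indicator of the open
  half-line; products of them approximate boxes later.\<close>

lemma flat_tendsto_1:
  assumes "t > 0" shows "(\<lambda>n. flat 0 (real n * t)) \<longlonglongrightarrow> 1"
proof (rule Lim_transform_eventually)
  have "(\<lambda>n. inverse t * inverse (real n)) \<longlonglongrightarrow> inverse t * 0"
    by (intro tendsto_intros lim_inverse_n)
  from tendsto_exp[OF tendsto_minus[OF this]]
  have "(\<lambda>n. exp (- (inverse t * inverse (real n)))) \<longlonglongrightarrow> exp (- (inverse t * 0))" .
  then show "(\<lambda>n. exp (- inverse (real n * t))) \<longlonglongrightarrow> 1" by (simp add: mult_ac)
  show "\<forall>\<^sub>F n in sequentially. exp (- inverse (real n * t)) = flat 0 (real n * t)"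
    using eventually_gt_at_top[of 0] by eventually_elim (use assms in \<open>simp add: flat_def\<close>)
qed

subsection \<open>Weak gradients\<close>

lemma set_integrable_lebesgue_compact:
  fixes f :: "'a::euclidean_space \<Rightarrow> 'b::{banach, second_countable_topology}"
  assumes "compact K" "continuous_on K f"
  shows "set_integrable lebesgue K f"
proof -
  have "integrable lborel (\<lambda>x. indicator K x *\<^sub>R f x)" by (rule borel_integrable_compact) fact+
  then show ?thesis
    unfolding set_integrable_def by (simp add: integrable_completion)
qed

lemma set_integrable_compactly_supported:
  fixes f :: "'a::euclidean_space \<Rightarrow> 'b::{banach, second_countable_topology}"
  assumes "continuous_on \<Omega> f" "compact K" "K \<subseteq> \<Omega>" "\<And>x. x \<in> \<Omega> - K \<Longrightarrow> f x = 0"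
  shows "set_integrable lebesgue \<Omega> f"
proof -
  have "set_integrable lebesgue K f"
    using assms by (intro set_integrable_lebesgue_compact) (auto intro: continuous_on_subset)
  moreover have "(\<lambda>x. indicator \<Omega> x *\<^sub>R f x) = (\<lambda>x. indicator K x *\<^sub>R f x)"
    using assms by (force simp: indicator_def)
  ultimately show ?thesis by (simp add: set_integrable_def)
qed

lemma continuous_on_imp_borel_measurable_lebesgue:
  "continuous_on UNIV f \<Longrightarrow> f \<in> borel_measurable lebesgue"
  by (intro measurable_completion) (simp add: borel_measurable_continuous_onI)

lemma norm_mult_le_commute:
  fixes a b B :: real
  assumes "\<bar>b\<bar> \<le> B" shows "norm (a * b) \<le> norm (B * a)"
proof -
  have "\<bar>b\<bar> * \<bar>a\<bar> \<le> \<bar>B\<bar> * \<bar>a\<bar>" using assms by (intro mult_right_mono) auto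
  then show ?thesis by (simp add: abs_mult mult.commute)
qed

section \<open>Differentiation under the integral and integration by parts\<close>

text \<open>Dominated convergence for the difference quotients: they are at most B by the mean value
  inequality, so B |U| on K is a majorant. The common support K allows U, controlled on K alone, to
  be replaced by the integrable function V.\<close>

lemma DERIV_integral_parameter:
  fixes \<phi> :: "real \<Rightarrow> 'a::euclidean_space \<Rightarrow> real"
  assumes U: "set_integrable lebesgue K U" and e: "e > 0"
    and deriv: "\<And>s y. s \<in> ball t e \<Longrightarrow> ((\<lambda>s. \<phi> s y) has_real_derivative \<phi>' s y) (at s)"
    and bound: "\<And>s y. s \<in> ball t e \<Longrightarrow> \<bar>\<phi> s y\<bar> \<le> B" "\<And>s y. s \<in> ball t e \<Longrightarrow> \<bar>\<phi>' s y\<bar> \<le> B"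
    and supp: "\<And>s y. s \<in> ball t e \<Longrightarrow> y \<notin> K \<Longrightarrow> \<phi> s y = 0"
    and meas: "\<And>s. s \<in> ball t e \<Longrightarrow> \<phi> s \<in> borel_measurable lebesgue" "\<phi>' t \<in> borel_measurable lebesgue"
  shows "((\<lambda>s. \<integral>y. U y * \<phi> s y \<partial>lebesgue) has_real_derivative (\<integral>y. U y * \<phi>' t y \<partial>lebesgue)) (at t)"
proof -
  define V where "V = (\<lambda>y. indicator K y *\<^sub>R U y)"
  have V: "integrable lebesgue V" using U by (simp add: V_def set_integrable_def)
  have [measurable]: "V \<in> borel_measurable lebesgue" using V by auto
  note [measurable] = meas(2)
  have t: "t \<in> ball t e" using e by simp
  have supp': "\<phi>' t y = 0" if "y \<notin> K" for y
  proof -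
    have "((\<lambda>s. 0) has_real_derivative \<phi>' t y) (at t)"
      using deriv[OF t] by (rule has_field_derivative_transform_within_open[where S = "ball t e"])
        (use supp that e in auto)
    then show ?thesis using DERIV_unique DERIV_const by blast
  qed
  have eqV: "(\<lambda>y. U y * \<phi> s y) = (\<lambda>y. V y * \<phi> s y)" if "s \<in> ball t e" for s
    using supp[OF that] by (force simp: V_def indicator_def)
  have eqV': "(\<lambda>y. U y * \<phi>' t y) = (\<lambda>y. V y * \<phi>' t y)"
    using supp' by (force simp: V_def indicator_def)
  have B: "0 \<le> B" using bound(1)[OF t] by (meson abs_ge_zero order_trans)
  have int: "integrable lebesgue (\<lambda>y. V y * \<phi> s y)" if "s \<in> ball t e" for s
  proof (rule Bochner_Integration.integrable_bound)
    show "integrable lebesgue (\<lambda>y. B * V y)" using V by simp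
    have [measurable]: "\<phi> s \<in> borel_measurable lebesgue" using meas(1)[OF that] .
    show "(\<lambda>y. V y * \<phi> s y) \<in> borel_measurable lebesgue" by measurable
    show "AE y in lebesgue. norm (V y * \<phi> s y) \<le> norm (B * V y)"
      using bound(1)[OF that] by (intro always_eventually allI) (simp only: norm_mult_le_commute abs_abs)
  qed
  let ?m = "\<lambda>s. \<integral>y. U y * \<phi> s y \<partial>lebesgue"
  have "((\<lambda>h. (?m (t + h) - ?m t) / h) \<longlongrightarrow> (\<integral>y. U y * \<phi>' t y \<partial>lebesgue)) (at 0 within ball 0 e)"
    unfolding tendsto_at_iff_sequentially
  proof (intro allI impI)
    fix X :: "nat \<Rightarrow> real" assume X: "\<forall>i. X i \<in> ball 0 e - {0}" "X \<longlonglongrightarrow> 0"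
    have X1: "t + X i \<in> ball t e" "X i \<noteq> 0" for i using X(1) by (auto simp: dist_real_def)
    define s where "s = (\<lambda>i y. V y * ((\<phi> (t + X i) y - \<phi> t y) / X i))"
    have "(\<lambda>i. \<integral>y. s i y \<partial>lebesgue) \<longlonglongrightarrow> (\<integral>y. V y * \<phi>' t y \<partial>lebesgue)"
    proof (rule integral_dominated_convergence)
      show "(\<lambda>y. V y * \<phi>' t y) \<in> borel_measurable lebesgue" by measurable
      show "integrable lebesgue (\<lambda>y. B * norm (V y))" using V by simp
      show "s i \<in> borel_measurable lebesgue" for i
      proof -
        have [measurable]: "\<phi> (t + X i) \<in> borel_measurable lebesgue" "\<phi> t \<in> borel_measurable lebesgue"
          using meas(1) X1 t by auto
        show ?thesis unfolding s_def by measurable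
      qed
      have "(\<lambda>i. s i y) \<longlonglongrightarrow> V y * \<phi>' t y" for y
      proof -
        have "((\<lambda>h. (\<phi> (t + h) y - \<phi> t y) / h) \<longlongrightarrow> \<phi>' t y) (at 0)"
          using deriv[OF t] by (simp add: DERIV_def)
        then have "(\<lambda>i. (\<phi> (t + X i) y - \<phi> t y) / X i) \<longlonglongrightarrow> \<phi>' t y"
          by (rule filterlim_compose) (use X X1 in \<open>auto simp: filterlim_at\<close>)
        then show ?thesis unfolding s_def by (intro tendsto_intros)
      qed
      then show "AE y in lebesgue. (\<lambda>i. s i y) \<longlonglongrightarrow> V y * \<phi>' t y" by simp
      have "norm (s i y) \<le> B * norm (V y)" for i y
      proof -
        have "norm (\<phi> (t + X i) y - \<phi> t y) \<le> B * norm (t + X i - t)"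
          by (rule field_differentiable_bound[where S = "ball t e"])
             (use deriv bound X1 t in \<open>auto intro: has_field_derivative_at_within\<close>)
        then have "\<bar>(\<phi> (t + X i) y - \<phi> t y) / X i\<bar> \<le> B"
          using X1(2)[of i] by (simp add: field_simps)
        then have "norm (s i y) \<le> norm (B * V y)"
          unfolding s_def by (rule norm_mult_le_commute)
        then show ?thesis using B by (simp add: abs_mult)
      qed
      then show "AE y in lebesgue. norm (s i y) \<le> B * norm (V y)" for i by simp
    qed
    moreover have "(\<integral>y. s i y \<partial>lebesgue) = (?m (t + X i) - ?m t) / X i" for i
    proof -
      have "(\<integral>y. s i y \<partial>lebesgue) = (\<integral>y. (V y * \<phi> (t + X i) y - V y * \<phi> t y) / X i \<partial>lebesgue)"
        by (simp add: s_def right_diff_distrib)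
      also have "\<dots> = (?m (t + X i) - ?m t) / X i"
        using int[OF X1(1)] int[OF t] by (simp add: eqV[OF X1(1)] eqV[OF t])
      finally show ?thesis .
    qed
    ultimately show "((\<lambda>h. (?m (t + h) - ?m t) / h) \<circ> X) \<longlonglongrightarrow> (\<integral>y. U y * \<phi>' t y \<partial>lebesgue)"
      by (simp add: o_def eqV')
  qed
  then show ?thesis using e by (simp add: DERIV_def at_within_open[of 0 "ball 0 e"])
qed

text \<open>Translation invariance makes the integral of F (y + s e) independent of s, and its
  derivative at s = 0 can be taken under the integral sign. For |s| < 1 the translates are supported
  in a disc around K enlarged by norm e.\<close>

lemma integral_directional_derivative_eq_0:
  fixes F :: "'a::euclidean_space \<Rightarrow> real"
  assumes F: "\<And>x. (F has_derivative F' x) (at x)" and cont: "continuous_on UNIV (\<lambda>x. F' x e)"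
    and K: "compact K" "\<And>x. x \<notin> K \<Longrightarrow> F x = 0"
  shows "(\<integral>x. F' x e \<partial>lebesgue) = 0"
proof -
  have contF: "continuous_on UNIV F"
    using F by (auto intro: has_derivative_continuous continuous_at_imp_continuous_on)
  have F'0: "F' x e = 0" if "x \<notin> K" for x
  proof -
    have "((\<lambda>x. 0) has_derivative F' x) (at x)"
      by (rule has_derivative_transform_within_open[OF F, where s = "- K"])
         (use K that in \<open>auto intro: compact_imp_closed\<close>)
    then have "F' x = (\<lambda>v. 0)" using has_derivative_unique has_derivative_const by blast
    then show ?thesis by simp
  qed
  have "bounded (F ` K)" "bounded ((\<lambda>x. F' x e) ` K)"
    using K(1) contF cont by (auto intro!: compact_imp_bounded compact_continuous_image intro: continuous_on_subset)
  then obtain B1 B2 where B12: "\<forall>x\<in>K. \<bar>F x\<bar> \<le> B1" "\<forall>x\<in>K. \<bar>F' x e\<bar> \<le> B2"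
    by (auto simp: bounded_iff)
  define B where "B = max 0 (max B1 B2)"
  have B: "\<bar>F x\<bar> \<le> B" "\<bar>F' x e\<bar> \<le> B" for x
    using B12 F'0[of x] K(2)[of x] by (cases "x \<in> K"; force simp: B_def)+
  obtain R where R: "K \<subseteq> ball 0 R" using K(1) compact_imp_bounded bounded_subset_ballD by blast
  have meas: "(\<lambda>y. F (y + s *\<^sub>R e)) \<in> borel_measurable lebesgue" for s
    using contF by (intro continuous_on_imp_borel_measurable_lebesgue continuous_on_compose2[OF contF] continuous_intros) auto
  have const: "(\<integral>y. 1 * F (y + s *\<^sub>R e) \<partial>lebesgue) = (\<integral>y. F y \<partial>lebesgue)" for s
  proof -
    have 1: "F \<in> borel_measurable borel" "(\<lambda>y. F (s *\<^sub>R e + y)) \<in> borel_measurable borel"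
      by (intro borel_measurable_continuous_onI continuous_on_compose2[OF contF] continuous_intros; simp)+
    have "(\<integral>y. F y \<partial>lborel) = (\<integral>y. F y \<partial>(distr lborel borel ((+) (s *\<^sub>R e))))"
      by (simp add: lborel_distr_plus)
    also have "\<dots> = (\<integral>y. F (s *\<^sub>R e + y) \<partial>lborel)"
      by (rule integral_distr) (use 1 in auto)
    finally show ?thesis using 1 by (simp add: integral_completion add.commute)
  qed
  have "((\<lambda>s. \<integral>y. 1 * F (y + s *\<^sub>R e) \<partial>lebesgue) has_real_derivative
          (\<integral>y. 1 * F' (y + 0 *\<^sub>R e) e \<partial>lebesgue)) (at 0)"
  proof (rule DERIV_integral_parameter[where K = "cball 0 (R + norm e)" and e = 1 and B = B])
    show "set_integrable lebesgue (cball 0 (R + norm e)) (\<lambda>y::'a. 1::real)"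
      by (intro set_integrable_lebesgue_compact) auto
    fix s :: real and y assume s: "s \<in> ball 0 1"
    have "((\<lambda>s. F (y + s *\<^sub>R e)) has_derivative (\<lambda>h. F' (y + s *\<^sub>R e) (h *\<^sub>R e))) (at s)"
      by (rule has_derivative_compose[OF _ F, of "\<lambda>s. y + s *\<^sub>R e"]) (auto intro!: derivative_eq_intros)
    moreover have "(\<lambda>h. F' (y + s *\<^sub>R e) (h *\<^sub>R e)) = (*) (F' (y + s *\<^sub>R e) e)"
      using linear_cmul[OF has_derivative_linear[OF F]] by (auto simp: mult.commute)
    ultimately show "((\<lambda>s. F (y + s *\<^sub>R e)) has_real_derivative F' (y + s *\<^sub>R e) e) (at s)"
      by (simp add: has_field_derivative_def)
    show "F (y + s *\<^sub>R e) = 0" if "y \<notin> cball 0 (R + norm e)"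
    proof (rule K(2))
      have "norm (s *\<^sub>R e) \<le> norm e" using s by (simp add: mult_left_le_one_le)
      then have "norm (y + s *\<^sub>R e) \<ge> R" using that norm_triangle_ineq4[of "y + s *\<^sub>R e" "s *\<^sub>R e"] by simp
      then show "y + s *\<^sub>R e \<notin> K" using R by auto
    qed
  next
    show "(\<lambda>y. F' (y + 0 *\<^sub>R e) e) \<in> borel_measurable lebesgue"
      using cont by (auto intro!: continuous_on_imp_borel_measurable_lebesgue)
  qed (use B meas in auto)
  then have "((\<lambda>s::real. \<integral>y. F y \<partial>lebesgue) has_real_derivative (\<integral>y. F' y e \<partial>lebesgue)) (at 0)"
    unfolding const by simp
  then show ?thesis using DERIV_unique DERIV_const by blast
qed

definition C1_gradient :: "'a::euclidean_space set \<Rightarrow> ('a \<Rightarrow> real) \<Rightarrow> ('a \<Rightarrow> 'a) \<Rightarrow> bool" where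
  "C1_gradient \<Omega> w g \<longleftrightarrow>
     (\<forall>x\<in>\<Omega>. (w has_derivative (\<lambda>v. g x \<bullet> v)) (at x)) \<and> continuous_on \<Omega> g"

lemma test_functionD:
  fixes \<phi> :: "'a::euclidean_space \<Rightarrow> real"
  assumes "test_function \<Omega> \<phi>"
  obtains K where "compact K" "K \<subseteq> \<Omega>" "\<And>x. x \<notin> K \<Longrightarrow> \<phi> x = 0"
    "\<And>x v. x \<notin> K \<Longrightarrow> frechet_derivative \<phi> (at x) v = 0"
    "\<And>x. (\<phi> has_derivative frechet_derivative \<phi> (at x)) (at x)"
    "continuous_on UNIV \<phi>" "\<And>v. continuous_on UNIV (\<lambda>x. frechet_derivative \<phi> (at x) v)"
proof
  let ?K = "closure {x. \<phi> x \<noteq> 0}"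
  have td: "times_continuously_diff k \<phi>" for k using assms by (simp add: test_function_def)
  show 1: "compact ?K" "?K \<subseteq> \<Omega>" using assms by (auto simp: test_function_def)
  show 2: "\<phi> x = 0" if "x \<notin> ?K" for x using that closure_subset[of "{x. \<phi> x \<noteq> 0}"] by blast
  show 3: "(\<phi> has_derivative frechet_derivative \<phi> (at x)) (at x)" for x
    using td[of "Suc 0"] by (rule times_continuously_diff_has_derivative)
  show "continuous_on UNIV \<phi>" using td[of 0] by simp
  show "continuous_on UNIV (\<lambda>x. frechet_derivative \<phi> (at x) v)" for v using td[of "Suc 0"] by simp
  show "frechet_derivative \<phi> (at x) v = 0" if "x \<notin> ?K" for x v
  proof -
    have "((\<lambda>x. 0) has_derivative frechet_derivative \<phi> (at x)) (at x)"
    proof (rule has_derivative_transform_within_open[OF 3])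
      show "open (- ?K)" by (rule open_Compl) (rule closed_closure)
      show "x \<in> - ?K" using that by blast
      show "\<phi> y = 0" if "y \<in> - ?K" for y by (rule 2) (rule ComplD[OF that])
    qed
    then have "frechet_derivative \<phi> (at x) = (\<lambda>v. 0)" using has_derivative_unique has_derivative_const by blast
    then show ?thesis by simp
  qed
qed

lemma C1_gradient_imp_continuous_on: "C1_gradient \<Omega> w g \<Longrightarrow> continuous_on \<Omega> w"
  unfolding C1_gradient_def
  by (meson continuous_at_imp_continuous_on has_derivative_continuous)

lemma continuous_on_imp_locally_integrable:
  "continuous_on \<Omega> f \<Longrightarrow> locally_integrable \<Omega> f"
  unfolding locally_integrable_def by (auto intro: set_integrable_lebesgue_compact continuous_on_subset)

text \<open>Extended by zero, w \<phi> is a C^1 function on the whole space with compact support, so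
  its directional derivatives integrate to zero; the product rule splits this into the two required
  integrals.\<close>

lemma C1_gradient_imp_has_weak_gradient:
  fixes w :: "'a::euclidean_space \<Rightarrow> real"
  assumes \<Omega>: "open \<Omega>" and w: "C1_gradient \<Omega> w g"
  shows "has_weak_gradient \<Omega> w g"
  unfolding has_weak_gradient_def
proof (intro conjI allI impI ballI)
  have contg: "continuous_on \<Omega> g" and contw: "continuous_on \<Omega> w"
    using w C1_gradient_imp_continuous_on by (auto simp: C1_gradient_def)
  show "locally_integrable \<Omega> g" using contg by (rule continuous_on_imp_locally_integrable)
  fix \<phi> :: "'a \<Rightarrow> real" and e :: 'a assume "test_function \<Omega> \<phi>" "e \<in> Basis"
  from test_functionD[OF this(1)] obtain K where K: "compact K" "K \<subseteq> \<Omega>" "\<And>x. x \<notin> K \<Longrightarrow> \<phi> x = 0"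
    "\<And>x v. x \<notin> K \<Longrightarrow> frechet_derivative \<phi> (at x) v = 0"
    "\<And>x. (\<phi> has_derivative frechet_derivative \<phi> (at x)) (at x)"
    "continuous_on UNIV \<phi>" "\<And>v. continuous_on UNIV (\<lambda>x. frechet_derivative \<phi> (at x) v)" by blast
  have cont\<phi>: "continuous_on \<Omega> \<phi>" "\<And>v. continuous_on \<Omega> (\<lambda>x. frechet_derivative \<phi> (at x) v)"
    using K(6,7) continuous_on_subset by blast+
  let ?D = "frechet_derivative \<phi>"
  define F where "F = (\<lambda>x. if x \<in> \<Omega> then w x * \<phi> x else 0)"
  define F' where "F' = (\<lambda>x v. if x \<in> \<Omega> then w x * ?D (at x) v + (g x \<bullet> v) * \<phi> x else 0)"
  have clK: "open (- K)" using K(1) by (simp add: compact_imp_closed open_Compl)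
  have i1: "set_integrable lebesgue \<Omega> (\<lambda>x. w x * ?D (at x) e)"
    by (rule set_integrable_compactly_supported[OF _ K(1,2)])
       (use K contw cont\<phi> in \<open>auto intro!: continuous_intros\<close>)
  have i2: "set_integrable lebesgue \<Omega> (\<lambda>x. (g x \<bullet> e) * \<phi> x)"
    by (rule set_integrable_compactly_supported[OF _ K(1,2)])
       (use K contg cont\<phi> in \<open>auto intro!: continuous_intros\<close>)
  have "(\<integral>x. F' x e \<partial>lebesgue) = 0"
  proof (rule integral_directional_derivative_eq_0[OF _ _ K(1), of F])
    show "(F has_derivative F' x) (at x)" for x
    proof (cases "x \<in> \<Omega>")
      case True
      have "((\<lambda>x. w x * \<phi> x) has_derivative (\<lambda>v. w x * ?D (at x) v + (g x \<bullet> v) * \<phi> x)) (at x)"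
        using w True K(5) by (intro has_derivative_mult) (auto simp: C1_gradient_def)
      then have "(F has_derivative (\<lambda>v. w x * ?D (at x) v + (g x \<bullet> v) * \<phi> x)) (at x)"
        by (rule has_derivative_transform_within_open[OF _ \<Omega> True]) (simp add: F_def)
      then show ?thesis using True by (simp add: F'_def)
    next
      case False
      then have "x \<in> - K" using K(2) by blast
      have "(F has_derivative (\<lambda>v. 0)) (at x)"
        by (rule has_derivative_transform_within_open[OF has_derivative_const clK \<open>x \<in> - K\<close>])
           (auto simp: F_def K)
      then show ?thesis using False by (simp add: F'_def)
    qed
    show "continuous_on UNIV (\<lambda>x. F' x e)"
    proof -
      have "continuous_on \<Omega> (\<lambda>x. w x * ?D (at x) e + (g x \<bullet> e) * \<phi> x)"
        using cont\<phi> contw contg by (auto intro!: continuous_intros)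
      then have "continuous_on \<Omega> (\<lambda>x. F' x e)"
        by (rule continuous_on_eq) (simp add: F'_def)
      moreover have "continuous_on (- K) (\<lambda>x. F' x e)"
        by (rule continuous_on_eq[OF continuous_on_const[of _ 0]]) (simp add: F'_def K)
      ultimately have "continuous_on (\<Omega> \<union> - K) (\<lambda>x. F' x e)"
        using \<Omega> clK by (intro continuous_on_open_Un)
      moreover have "\<Omega> \<union> - K = UNIV" using K(2) by blast
      ultimately show ?thesis by simp
    qed
    show "F x = 0" if "x \<notin> K" for x using K(3)[OF that] by (simp add: F_def)
  qed
  moreover have "(\<integral>x. F' x e \<partial>lebesgue) = (LINT x:\<Omega>|lebesgue. w x * ?D (at x) e + (g x \<bullet> e) * \<phi> x)"
    unfolding set_lebesgue_integral_def
    by (rule Bochner_Integration.integral_cong) (auto simp: F'_def indicator_def)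
  ultimately show "(LINT x:\<Omega>|lebesgue. w x * ?D (at x) e) = - (LINT x:\<Omega>|lebesgue. (g x \<bullet> e) * \<phi> x)"
    using i1 i2 by (simp add: set_integral_add)
qed

lemma set_integrable_times_test_function:
  assumes f: "locally_integrable \<Omega> f" and \<phi>: "test_function \<Omega> \<phi>"
  shows "set_integrable lebesgue \<Omega> (\<lambda>x. f x * \<phi> x :: real)"
proof -
  obtain K where K: "compact K" "K \<subseteq> \<Omega>" "\<And>x. x \<notin> K \<Longrightarrow> \<phi> x = 0" "continuous_on UNIV \<phi>"
    by (rule test_functionD[OF \<phi>]) (rule that)
  have fK: "integrable lebesgue (\<lambda>x. indicator K x * f x)"
    using f K by (simp add: locally_integrable_def set_integrable_def)
  have [measurable]: "\<phi> \<in> borel_measurable lebesgue"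
    using K(4) by (intro continuous_on_imp_borel_measurable_lebesgue) simp
  have [measurable]: "(\<lambda>x. indicator K x * f x) \<in> borel_measurable lebesgue" using fK by auto
  have "bounded (\<phi> ` K)"
    using K by (auto intro!: compact_imp_bounded compact_continuous_image intro: continuous_on_subset)
  then obtain B where "\<forall>x\<in>K. \<bar>\<phi> x\<bar> \<le> B" by (auto simp: bounded_iff)
  then have B: "\<bar>\<phi> x\<bar> \<le> \<bar>B\<bar>" for x using K(3)[of x] by (cases "x \<in> K"; force)
  have "integrable lebesgue (\<lambda>x. (indicator K x * f x) * \<phi> x)"
  proof (rule Bochner_Integration.integrable_bound)
    show "integrable lebesgue (\<lambda>x. \<bar>B\<bar> * (indicator K x * f x))" using fK by simp
    show "(\<lambda>x. (indicator K x * f x) * \<phi> x) \<in> borel_measurable lebesgue" by measurable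
    show "AE x in lebesgue. norm (indicator K x * f x * \<phi> x) \<le> norm (\<bar>B\<bar> * (indicator K x * f x))"
      using B by (intro always_eventually allI) (simp only: norm_mult_le_commute abs_abs)
  qed
  moreover have "(\<lambda>x. (indicator K x * f x) * \<phi> x) = (\<lambda>x. indicator \<Omega> x *\<^sub>R (f x * \<phi> x))"
    using K by (auto simp: indicator_def fun_eq_iff)
  ultimately show ?thesis by (simp add: set_integrable_def)
qed

section \<open>Uniqueness of weak gradients\<close>

text \<open>The products \<psi> of flat functions are test functions that vanish off the open box
  and converge boundedly to its indicator; dominated convergence carries the hypothesis over to the
  box.\<close>

lemma integral_box_eq_0:
  fixes f :: "'a::euclidean_space \<Rightarrow> real"
  assumes f: "locally_integrable \<Omega> f"
    and zero: "\<And>\<phi>. test_function \<Omega> \<phi> \<Longrightarrow> (LINT x:\<Omega>|lebesgue. f x * \<phi> x) = 0"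
    and ac: "cbox a c \<subseteq> \<Omega>"
  shows "integral (cbox a c) f = 0"
proof -
  define \<psi> where "\<psi> = (\<lambda>n x. \<Prod>b\<in>Basis. flat 0 (real n * ((x - a) \<bullet> b)) * flat 0 (real n * ((c - x) \<bullet> b)))"
  have supp: "\<psi> n x = 0" if nx: "x \<notin> box a c" for n x
  proof -
    obtain b where b: "b \<in> Basis" "\<not> (a \<bullet> b < x \<bullet> b \<and> x \<bullet> b < c \<bullet> b)"
      using nx unfolding mem_box by fast
    then have "(x - a) \<bullet> b \<le> 0 \<or> (c - x) \<bullet> b \<le> 0"
      unfolding inner_diff_left by linarith
    then have "flat 0 (real n * ((x - a) \<bullet> b)) * flat 0 (real n * ((c - x) \<bullet> b)) = 0"
      by (auto intro!: flat_nonpos simp: mult_nonneg_nonpos)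
    then show ?thesis unfolding \<psi>_def using b(1) by (auto intro!: prod_zero)
  qed
  have td: "times_continuously_diff k (\<psi> n)" for k n
  proof -
    have lin: "times_continuously_diff k (\<lambda>x::'a. x \<bullet> b)" for b k
      by (rule times_continuously_diff_bounded_linear) (rule bounded_linear_inner_left)
    have t: "times_continuously_diff k (\<lambda>x. real n * ((x - a) \<bullet> b))" "times_continuously_diff k (\<lambda>x. real n * ((c - x) \<bullet> b))" for b k
      using times_continuously_diff_add[OF times_continuously_diff_cmult[OF lin[of k b], of "real n"]
              times_continuously_diff_const[of k "- real n * (a \<bullet> b)"]]
            times_continuously_diff_add[OF times_continuously_diff_cmult[OF lin[of k b], of "- real n"]
              times_continuously_diff_const[of k "real n * (c \<bullet> b)"]]
      by (simp_all add: inner_diff_left algebra_simps)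
    then show ?thesis unfolding \<psi>_def
      by (intro times_continuously_diff_prod times_continuously_diff_mult[OF
            times_continuously_diff_flat[OF t(1)] times_continuously_diff_flat[OF t(2)]])
  qed
  have test: "test_function \<Omega> (\<psi> n)" for n
    by (rule test_functionI[OF td compact_cbox ac]) (use supp box_subset_cbox in blast)
  have fac: "integrable lebesgue (\<lambda>x. indicator (cbox a c) x * f x)"
    using f ac by (simp add: locally_integrable_def set_integrable_def)
  have \<psi>1: "0 \<le> \<psi> n x" "\<psi> n x \<le> 1" for n x
    unfolding \<psi>_def by (auto intro!: prod_nonneg prod_le_1 mult_le_one simp: flat_0_nonneg flat_0_le_1)
  have lim: "(\<lambda>n. \<psi> n x) \<longlonglongrightarrow> indicator (box a c) x" for x
  proof (cases "x \<in> box a c")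
    case True
    then have "(\<lambda>n. \<psi> n x) \<longlonglongrightarrow> (\<Prod>b\<in>(Basis::'a set). 1 * 1)" unfolding \<psi>_def
      by (intro tendsto_prod tendsto_mult flat_tendsto_1) (auto simp: mem_box inner_diff_left)
    then show ?thesis using True by simp
  qed (simp add: supp)
  have [measurable]: "\<psi> n \<in> borel_measurable lebesgue" for n
    using td[of 0 n] by (intro continuous_on_imp_borel_measurable_lebesgue) simp
  define V where "V = (\<lambda>x. indicator (cbox a c) x * f x)"
  have V: "integrable lebesgue V" using fac by (simp add: V_def)
  have [measurable]: "V \<in> borel_measurable lebesgue" using V by auto
  have "(\<lambda>n. \<integral>x. V x * \<psi> n x \<partial>lebesgue) \<longlonglongrightarrow>
        (\<integral>x. V x * indicator (box a c) x \<partial>lebesgue)"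
  proof (rule integral_dominated_convergence)
    show "integrable lebesgue (\<lambda>x. norm (V x))" using V by (rule integrable_norm)
    show "(\<lambda>x. V x * indicator (box a c) x) \<in> borel_measurable lebesgue"
      by (intro borel_measurable_times borel_measurable_indicator) auto
    show "AE x in lebesgue. (\<lambda>n. V x * \<psi> n x) \<longlonglongrightarrow> V x * indicator (box a c) x"
      by (intro always_eventually allI tendsto_intros lim)
    show "AE x in lebesgue. norm (V x * \<psi> n x) \<le> norm (V x)" for n
      using \<psi>1 by (intro always_eventually allI) (simp add: abs_mult mult_left_le)
  qed measurable
  moreover have "(\<integral>x. V x * \<psi> n x \<partial>lebesgue) = (LINT x:\<Omega>|lebesgue. f x * \<psi> n x)" for n
    unfolding set_lebesgue_integral_def
    by (rule Bochner_Integration.integral_cong)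
       (use supp[of _ n] ac box_subset_cbox[of a c] in \<open>auto simp: indicator_def V_def\<close>)
  ultimately have "(\<integral>x. V x * indicator (box a c) x \<partial>lebesgue) = 0"
    using zero[OF test] by (simp add: LIMSEQ_const_iff)
  moreover have "(\<integral>x. V x * indicator (box a c) x \<partial>lebesgue) = (LINT x:box a c|lebesgue. f x)"
    unfolding set_lebesgue_integral_def
    by (rule Bochner_Integration.integral_cong)
       (use box_subset_cbox[of a c] in \<open>auto simp: indicator_def V_def\<close>)
  moreover have "set_integrable lebesgue (box a c) f"
    by (rule set_integrable_subset[of _ "cbox a c"])
       (use fac box_subset_cbox in \<open>auto simp: set_integrable_def\<close>)
  ultimately have "integral (box a c) f = 0"
    using set_lebesgue_integral_eq_integral(2)[of "box a c" f] by simp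
  then show ?thesis by (simp add: integral_open_interval)
qed

text \<open>The fundamental lemma of the calculus of variations. Integrals over boxes vanish, so
  Lebesgue differentiation along shrinking boxes gives f = 0 almost everywhere in each box, and
  countably many boxes cover \<Omega>.\<close>

lemma AE_eq_0_if_test_functions:
  fixes f :: "'a::euclidean_space \<Rightarrow> real"
  assumes \<Omega>: "open \<Omega>" and f: "locally_integrable \<Omega> f"
    and zero: "\<And>\<phi>. test_function \<Omega> \<phi> \<Longrightarrow> (LINT x:\<Omega>|lebesgue. f x * \<phi> x) = 0"
  shows "AE x in lebesgue. x \<in> \<Omega> \<longrightarrow> f x = 0"
proof -
  have box: "AE x in lebesgue. x \<in> box a c \<longrightarrow> f x = 0" if ac: "cbox a c \<subseteq> \<Omega>" for a c
  proof -
    define F where "F = (\<lambda>x. if x \<in> cbox a c then f x else 0)"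
    have "set_integrable lebesgue (cbox a c) f" using f ac by (simp add: locally_integrable_def)
    then have "f integrable_on (cbox a c)" by (rule set_lebesgue_integral_eq_integral)
    then have "F integrable_on UNIV" unfolding F_def by (simp add: integrable_restrict_UNIV)
    then have "F integrable_on cbox a' c'" for a' c' by (meson integrable_on_subcbox subset_UNIV)
    then obtain N where N: "negligible N" "\<And>x e. x \<notin> N \<Longrightarrow> 0 < e \<Longrightarrow>
        \<exists>d>0. \<forall>h. 0 < h \<and> h < d \<longrightarrow> norm (integral (cbox x (x + h *\<^sub>R One)) F /\<^sub>R h ^ DIM('a) - F x) < e"
      using integrable_ccontinuous_explicit[of F] by metis
    have "f x = 0" if x: "x \<in> box a c" "x \<notin> N" for x
    proof (rule ccontr)
      assume ne: "f x \<noteq> 0"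
      have Fx: "F x = f x" using x box_subset_cbox by (auto simp: F_def)
      obtain d where d: "d > 0" "\<And>h. 0 < h \<and> h < d \<Longrightarrow>
          norm (integral (cbox x (x + h *\<^sub>R One)) F /\<^sub>R h ^ DIM('a) - F x) < \<bar>f x\<bar>"
        using N(2)[OF x(2), of "\<bar>f x\<bar>"] ne by auto
      obtain r where r: "r > 0" "ball x r \<subseteq> box a c" using x(1) open_box openE by blast
      define h where "h = min (d / 2) (r / (2 * norm (One::'a)))"
      have No: "norm (One::'a) > 0" by (simp add: One_non_0)
      have h: "0 < h" "h < d" "h * norm (One::'a) < r"
      proof -
        show "0 < h" "h < d" using d r No by (auto simp: h_def)
        have "h * norm (One::'a) \<le> r / (2 * norm (One::'a)) * norm (One::'a)"
          by (rule mult_right_mono) (auto simp: h_def)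
        then show "h * norm (One::'a) < r" using No r by simp
      qed
      have sub: "cbox x (x + h *\<^sub>R One) \<subseteq> box a c"
      proof
        fix y assume y: "y \<in> cbox x (x + h *\<^sub>R One)"
        have "norm (y - x) \<le> norm (h *\<^sub>R (One::'a))"
        proof (rule norm_le_componentwise)
          fix b :: 'a assume "b \<in> Basis"
          then show "\<bar>(y - x) \<bullet> b\<bar> \<le> \<bar>(h *\<^sub>R (One::'a)) \<bullet> b\<bar>"
            using y h by (auto simp: mem_box inner_diff_left inner_add_left)
        qed
        then have "norm (y - x) < r" using h by simp
        then show "y \<in> box a c" using r(2) by (auto simp: dist_norm norm_minus_commute)
      qed
      have "integral (cbox x (x + h *\<^sub>R One)) F = integral (cbox x (x + h *\<^sub>R One)) f"
        by (rule Henstock_Kurzweil_Integration.integral_cong)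
           (use sub box_subset_cbox in \<open>auto simp: F_def\<close>)
      also have "\<dots> = 0"
        using sub box_subset_cbox ac by (intro integral_box_eq_0[OF f zero]) blast+
      finally show False using d(2)[of h] h Fx by simp
    qed
    moreover have "AE x in lebesgue. x \<notin> N"
      using N(1) by (auto simp: negligible_iff_null_sets intro: AE_not_in)
    ultimately show ?thesis by (auto elim!: eventually_mono)
  qed
  define \<B> where "\<B> = {box a c |a c. cbox a c \<subseteq> \<Omega>}"
  have "\<And>B. B \<in> \<B> \<Longrightarrow> open B" unfolding \<B>_def by (auto simp: open_box)
  then obtain \<B>' where \<B>': "\<B>' \<subseteq> \<B>" "countable \<B>'" "\<Union>\<B>' = \<Union>\<B>"
    using Lindelof[of \<B>] by blast
  have "\<Omega> \<subseteq> \<Union>\<B>"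
  proof
    fix x assume "x \<in> \<Omega>"
    then obtain a b where "cbox a b \<subseteq> \<Omega>" "x \<in> box a b"
      by (rule open_contains_cbox[OF \<Omega>])
    then show "x \<in> \<Union>\<B>" unfolding \<B>_def by blast
  qed
  moreover have "AE x in lebesgue. \<forall>B\<in>\<B>'. x \<in> B \<longrightarrow> f x = 0"
    using \<B>'(1,2) box by (subst AE_ball_countable) (auto simp: \<B>_def)
  ultimately show ?thesis using \<B>'(3) by (auto elim!: eventually_mono)
qed

lemma locally_integrable_inner:
  fixes f :: "'a::euclidean_space \<Rightarrow> 'a"
  assumes "locally_integrable \<Omega> f"
  shows "locally_integrable \<Omega> (\<lambda>x. f x \<bullet> e)"
  unfolding locally_integrable_def set_integrable_def
proof (intro allI impI)
  fix K assume "compact K \<and> K \<subseteq> \<Omega>"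
  then have "integrable lebesgue (\<lambda>x. indicator K x *\<^sub>R f x)"
    using assms by (simp add: locally_integrable_def set_integrable_def)
  then have "integrable lebesgue (\<lambda>x. (indicator K x *\<^sub>R f x) \<bullet> e)" by (rule integrable_inner_left)
  then show "integrable lebesgue (\<lambda>x. indicator K x *\<^sub>R (f x \<bullet> e))" by simp
qed

text \<open>\<open>weak_gradient\<close> picks a representative by \<open>SOME\<close>; uniqueness
  lets its L^q norm be computed from any other one, in particular from a classical gradient.\<close>

lemma weak_gradient_unique:
  fixes u :: "'a::euclidean_space \<Rightarrow> real"
  assumes \<Omega>: "open \<Omega>" and g: "has_weak_gradient \<Omega> u g" "has_weak_gradient \<Omega> u h"
  shows "AE x in lebesgue. x \<in> \<Omega> \<longrightarrow> g x = h x"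
proof -
  have "AE x in lebesgue. x \<in> \<Omega> \<longrightarrow> g x \<bullet> e - h x \<bullet> e = 0" if e: "e \<in> Basis" for e
  proof (rule AE_eq_0_if_test_functions[OF \<Omega>])
    have li: "locally_integrable \<Omega> (\<lambda>x. g x \<bullet> e)" "locally_integrable \<Omega> (\<lambda>x. h x \<bullet> e)"
      using g by (auto simp: has_weak_gradient_def intro: locally_integrable_inner)
    then show "locally_integrable \<Omega> (\<lambda>x. g x \<bullet> e - h x \<bullet> e)"
      unfolding locally_integrable_def by (auto intro: set_integral_diff)
    fix \<phi> :: "'a \<Rightarrow> real" assume \<phi>: "test_function \<Omega> \<phi>"
    have "(LINT x:\<Omega>|lebesgue. (g x \<bullet> e) * \<phi> x) = (LINT x:\<Omega>|lebesgue. (h x \<bullet> e) * \<phi> x)"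
      using g \<phi> e by (simp add: has_weak_gradient_def)
    then show "(LINT x:\<Omega>|lebesgue. (g x \<bullet> e - h x \<bullet> e) * \<phi> x) = 0"
      using set_integrable_times_test_function[OF li(1) \<phi>] set_integrable_times_test_function[OF li(2) \<phi>]
      by (simp add: left_diff_distrib set_integral_diff)
  qed
  then have "AE x in lebesgue. \<forall>e\<in>Basis. x \<in> \<Omega> \<longrightarrow> g x \<bullet> e - h x \<bullet> e = 0"
    by (subst AE_ball_countable) (auto intro: countable_finite)
  then show ?thesis by (auto elim!: eventually_mono intro: euclidean_eqI)
qed

subsection \<open>Morrey's inequality\<close>

lemma test_function_frechet_derivative:
  assumes "test_function \<Omega> \<phi>"
  shows "test_function \<Omega> (\<lambda>x. frechet_derivative \<phi> (at x) v)"
proof -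
  have "times_continuously_diff k (\<lambda>x. frechet_derivative \<phi> (at x) v)" for k
  proof -
    have "times_continuously_diff (Suc k) \<phi>" using assms unfolding test_function_def by blast
    then show ?thesis by simp
  qed
  moreover obtain K where "compact K" "K \<subseteq> \<Omega>" "\<And>x v. x \<notin> K \<Longrightarrow> frechet_derivative \<phi> (at x) v = 0"
    by (rule test_functionD[OF assms]) (rule that)
  ultimately show ?thesis by (auto intro: test_functionI)
qed

text \<open>The factor 1 / r^2 makes the mass independent of centre and radius in the plane
  (\<open>integral_bump\<close>). The mass is kept as a constant \<open>bump_mass\<close> instead of
  being normalised to 1.\<close>

definition bump :: "complex \<Rightarrow> real \<Rightarrow> complex \<Rightarrow> real" where
  "bump x r y = flat 0 (1 - ((y - x) \<bullet> (y - x)) / r\<^sup>2) / r\<^sup>2"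

lemma bump_nonneg: "0 \<le> bump x r y"
  by (simp add: bump_def flat_0_nonneg)

lemma bump_le: "bump x r y \<le> 1 / r\<^sup>2"
  by (simp add: bump_def flat_0_le_1 divide_right_mono)

lemma flat_quadratic_eq_0:
  assumes "r > 0" "y \<notin> ball x r"
  shows "flat n (1 - ((y - x) \<bullet> (y - x)) / r\<^sup>2) = 0"
proof -
  have "r \<le> norm (y - x)" using assms by (auto simp: dist_norm norm_minus_commute)
  then have "r\<^sup>2 \<le> (norm (y - x))\<^sup>2" using assms by (intro power_mono) auto
  then show ?thesis using assms by (intro flat_nonpos) (simp add: power2_norm_eq_inner field_simps)
qed

lemma bump_eq_0: "r > 0 \<Longrightarrow> y \<notin> ball x r \<Longrightarrow> bump x r y = 0"
  by (simp add: bump_def flat_quadratic_eq_0)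

lemma times_continuously_diff_quadratic:
  "times_continuously_diff k (\<lambda>y::'a::euclidean_space. 1 - ((y - x) \<bullet> (y - x)) / c)"
proof -
  have lin: "times_continuously_diff k (\<lambda>y::'a. (y - x) \<bullet> b)" for b
    using times_continuously_diff_add[OF times_continuously_diff_bounded_linear[OF bounded_linear_inner_left, of k b]
        times_continuously_diff_const[of k "- (x \<bullet> b)"]]
    by (simp add: inner_diff_left)
  have "times_continuously_diff k (\<lambda>y. 1 + (- 1 / c) * (\<Sum>b\<in>Basis. ((y - x) \<bullet> b) * ((y - x) \<bullet> b)))"
    by (intro times_continuously_diff_add times_continuously_diff_const times_continuously_diff_cmult
        times_continuously_diff_sum times_continuously_diff_mult lin)
  then show ?thesis by (simp add: euclidean_inner[of "_ - x" "_ - x"])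
qed

lemma continuous_on_bump: "continuous_on S (bump x r)"
  unfolding bump_def
  by (cases "r = 0") (auto intro!: continuous_intros)

text \<open>The vector field \<open>(v + (\<rho> / r) (y - x)) bump x r y\<close> transports the mass of the bump
  functions when their centre moves with velocity \<open>v\<close> and their radius with velocity \<open>\<rho>\<close>: the time
  derivative is minus its divergence.\<close>

lemma bump_transport:
  fixes x v :: complex and r \<rho> :: real
  defines "\<Psi> \<equiv> \<lambda>e y. bump x r y * ((v + (\<rho> / r) *\<^sub>R (y - x)) \<bullet> e)"
  defines "N \<equiv> \<lambda>y. (y - x) \<bullet> (y - x)"
  assumes r: "r > 0"
  shows "test_function UNIV (\<Psi> e)"
    and "(\<Sum>e\<in>Basis. frechet_derivative (\<Psi> e) (at y) e) =
      - (flat 1 (1 - N y / r\<^sup>2) * (2 * ((y - x) \<bullet> v) / r\<^sup>2 + 2 * N y * \<rho> / r ^ 3) / r\<^sup>2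
         - 2 * \<rho> / r ^ 3 * flat 0 (1 - N y / r\<^sup>2))"
proof -
  have \<Psi>_alt: "\<Psi> e = (\<lambda>y. (1 / r\<^sup>2) * flat 0 (1 - ((y - x) \<bullet> (y - x)) / r\<^sup>2) *
       ((v \<bullet> e - (\<rho> / r) * (x \<bullet> e)) + (\<rho> / r) * (y \<bullet> e)))" for e
    by (auto simp: \<Psi>_def bump_def fun_eq_iff inner_add_left inner_diff_left algebra_simps)
  show "test_function UNIV (\<Psi> e)"
  proof (rule test_functionI[where K = "cball x r"])
    show "times_continuously_diff k (\<Psi> e)" for k unfolding \<Psi>_alt
      by (intro times_continuously_diff_mult times_continuously_diff_add times_continuously_diff_const
          times_continuously_diff_flat times_continuously_diff_quadratic
          times_continuously_diff_bounded_linear bounded_linear_inner_left)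
    show "\<Psi> e y = 0" if "y \<notin> cball x r" for y
      using bump_eq_0[OF r, of y x] that by (simp add: \<Psi>_def)
  qed auto
  let ?w = "\<lambda>y. v + (\<rho> / r) *\<^sub>R (y - x)"
  have deriv: "(\<Psi> e has_derivative (\<lambda>h. flat 1 (1 - N y / r\<^sup>2) * (- 2 * ((y - x) \<bullet> h) / r\<^sup>2) / r\<^sup>2 * (?w y \<bullet> e)
        + bump x r y * ((\<rho> / r) * (h \<bullet> e)))) (at y)" for e
  proof -
    have 1: "((\<lambda>y. 1 - N y / r\<^sup>2) has_derivative (\<lambda>h. - 2 * ((y - x) \<bullet> h) / r\<^sup>2)) (at y)"
    proof -
      have "(N has_derivative (\<lambda>h. 2 * ((y - x) \<bullet> h))) (at y)"
        unfolding N_def by (auto intro!: derivative_eq_intros simp: inner_commute)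
      from has_derivative_diff[OF has_derivative_const[of 1] has_derivative_mult_right[OF this, of "1 / r\<^sup>2"]]
      show ?thesis by simp
    qed
    have 2: "((\<lambda>y. flat 0 (1 - N y / r\<^sup>2)) has_derivative (\<lambda>h. flat 1 (1 - N y / r\<^sup>2) * (- 2 * ((y - x) \<bullet> h) / r\<^sup>2))) (at y)"
      using has_derivative_compose[OF 1 has_field_derivative_imp_has_derivative[OF DERIV_flat[of 0]]] by simp
    have "((\<lambda>y. flat 0 (1 - N y / r\<^sup>2) / r\<^sup>2 * (?w y \<bullet> e)) has_derivative
       (\<lambda>h. flat 0 (1 - N y / r\<^sup>2) / r\<^sup>2 * ((\<rho> / r) * (h \<bullet> e)) +
          flat 1 (1 - N y / r\<^sup>2) * (- 2 * ((y - x) \<bullet> h) / r\<^sup>2) / r\<^sup>2 * (?w y \<bullet> e))) (at y)"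
    proof (rule has_derivative_mult)
      show "((\<lambda>y. flat 0 (1 - N y / r\<^sup>2) / r\<^sup>2) has_derivative
          (\<lambda>h. flat 1 (1 - N y / r\<^sup>2) * (- 2 * ((y - x) \<bullet> h) / r\<^sup>2) / r\<^sup>2)) (at y)"
        using has_derivative_mult_right[OF 2, of "1 / r\<^sup>2"] by simp
      show "((\<lambda>y. ?w y \<bullet> e) has_derivative (\<lambda>h. (\<rho> / r) * (h \<bullet> e))) (at y)"
        by (auto intro!: derivative_eq_intros)
    qed
    then show ?thesis by (simp add: \<Psi>_def bump_def N_def add.commute)
  qed
  have fd: "frechet_derivative (\<Psi> e) (at y) e =
      (- 2 * flat 1 (1 - N y / r\<^sup>2) / r ^ 4) * (((y - x) \<bullet> e) * (?w y \<bullet> e)) + bump x r y * (\<rho> / r)"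
    if e: "e \<in> Basis" for e
    using e by (subst frechet_derivative_at[OF deriv, symmetric])
      (simp add: inner_Basis power2_eq_square power4_eq_xxxx mult_ac)
  \<comment> \<open>The summand with \<rho> / r occurs once for each of the two basis vectors; the
    resulting 2 matches the exponent of r in the normalisation of \<open>bump\<close>.\<close>
  have "(\<Sum>e\<in>Basis. frechet_derivative (\<Psi> e) (at y) e) =
      (- 2 * flat 1 (1 - N y / r\<^sup>2) / r ^ 4) * ((y - x) \<bullet> ?w y) + 2 * (bump x r y * (\<rho> / r))"
  proof -
    define A where "A = - 2 * flat 1 (1 - N y / r\<^sup>2) / r ^ 4"
    have "(\<Sum>e\<in>Basis. frechet_derivative (\<Psi> e) (at y) e) =
        (\<Sum>e\<in>Basis. A * (((y - x) \<bullet> e) * (?w y \<bullet> e)) + bump x r y * (\<rho> / r))"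
      by (rule sum.cong) (auto simp: fd A_def)
    also have "\<dots> = A * (\<Sum>e\<in>Basis. ((y - x) \<bullet> e) * (?w y \<bullet> e)) + 2 * (bump x r y * (\<rho> / r))"
      by (simp only: sum.distrib sum_distrib_left sum_constant DIM_complex of_nat_numeral)
    finally show ?thesis by (simp only: A_def euclidean_inner[of "y - x" "?w y"])
  qed
  also have "(y - x) \<bullet> ?w y = (y - x) \<bullet> v + (\<rho> / r) * N y"
    by (simp add: inner_add_right N_def)
  also have "(- 2 * flat 1 (1 - N y / r\<^sup>2) / r ^ 4) * ((y - x) \<bullet> v + (\<rho> / r) * N y) + 2 * (bump x r y * (\<rho> / r)) =
      - (flat 1 (1 - N y / r\<^sup>2) * (2 * ((y - x) \<bullet> v) / r\<^sup>2 + 2 * N y * \<rho> / r ^ 3) / r\<^sup>2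
         - 2 * \<rho> / r ^ 3 * flat 0 (1 - N y / r\<^sup>2))"
    using r by (simp add: bump_def N_def field_simps power2_eq_square power3_eq_cube power4_eq_xxxx)
  finally show "(\<Sum>e\<in>Basis. frechet_derivative (\<Psi> e) (at y) e) =
      - (flat 1 (1 - N y / r\<^sup>2) * (2 * ((y - x) \<bullet> v) / r\<^sup>2 + 2 * N y * \<rho> / r ^ 3) / r\<^sup>2
         - 2 * \<rho> / r ^ 3 * flat 0 (1 - N y / r\<^sup>2))" .
qed

text \<open>The derivative is written in the shape of the negative divergence in
  \<open>bump_transport\<close>, at centre x + s v and radius r + s \<rho>, so that the two formulas
  can be identified.\<close>

lemma DERIV_bump:
  fixes x v y :: complex and r \<rho> :: real
  assumes "r + s * \<rho> > 0"
  shows "((\<lambda>s. bump (x + s *\<^sub>R v) (r + s * \<rho>) y) has_real_derivative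
     (let X = x + s *\<^sub>R v; R = r + s * \<rho>; N = (y - X) \<bullet> (y - X) in
       flat 1 (1 - N / R\<^sup>2) * (2 * ((y - X) \<bullet> v) / R\<^sup>2 + 2 * N * \<rho> / R ^ 3) / R\<^sup>2
         - 2 * \<rho> / R ^ 3 * flat 0 (1 - N / R\<^sup>2))) (at s)"
proof -
  define a where "a = (y - x) \<bullet> (y - x)"
  define b where "b = (y - x) \<bullet> v"
  define c where "c = v \<bullet> v"
  have N: "(y - (x + s *\<^sub>R v)) \<bullet> (y - (x + s *\<^sub>R v)) = a - 2 * s * b + s\<^sup>2 * c" for s
    by (simp add: a_def b_def c_def inner_diff_left inner_diff_right inner_add_left inner_add_right
        inner_commute algebra_simps power2_eq_square)
  have M: "(y - (x + s *\<^sub>R v)) \<bullet> v = b - s * c"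
    by (simp add: b_def c_def inner_diff_left inner_add_left)
  have ne: "r + s * \<rho> \<noteq> 0" using assms by simp
  define R where "R = r + s * \<rho>"
  have i: "((\<lambda>s. 1 / (r + s * \<rho>)\<^sup>2) has_real_derivative (- 2 * \<rho> / R ^ 3)) (at s)"
  proof -
    have "((\<lambda>s. inverse ((r + s * \<rho>)\<^sup>2)) has_real_derivative
        - (inverse ((r + s * \<rho>)\<^sup>2) * (2 * (r + s * \<rho>) * \<rho>) * inverse ((r + s * \<rho>)\<^sup>2))) (at s)"
      using ne by (auto intro!: derivative_eq_intros)
    moreover have "- (inverse (R\<^sup>2) * (2 * R * \<rho>) * inverse (R\<^sup>2)) = - 2 * \<rho> / R ^ 3"
      using ne by (simp add: R_def[symmetric] field_simps power2_eq_square power3_eq_cube)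
    ultimately show ?thesis by (simp add: R_def inverse_eq_divide)
  qed
  have p: "((\<lambda>s. a - 2 * s * b + s\<^sup>2 * c) has_real_derivative (- 2 * (b - s * c))) (at s)"
    by (auto intro!: derivative_eq_intros simp: algebra_simps)
  have q: "((\<lambda>s. 1 - (a - 2 * s * b + s\<^sup>2 * c) / (r + s * \<rho>)\<^sup>2) has_real_derivative
       (2 * (b - s * c) / R\<^sup>2 + 2 * (a - 2 * s * b + s\<^sup>2 * c) * \<rho> / R ^ 3)) (at s)"
    by (rule DERIV_cong[OF DERIV_diff[OF DERIV_const[of 1] DERIV_mult[OF p i], unfolded times_divide_eq_right mult_1_right]])
       (simp add: R_def divide_inverse algebra_simps)
  have f: "((\<lambda>s. flat 0 (1 - (a - 2 * s * b + s\<^sup>2 * c) / (r + s * \<rho>)\<^sup>2)) has_real_derivative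
       flat 1 (1 - (a - 2 * s * b + s\<^sup>2 * c) / R\<^sup>2) * (2 * (b - s * c) / R\<^sup>2 + 2 * (a - 2 * s * b + s\<^sup>2 * c) * \<rho> / R ^ 3)) (at s)"
    using DERIV_chain2[OF DERIV_flat[of 0] q] by (simp add: R_def)
  show ?thesis
    unfolding bump_def N M Let_def
    by (rule DERIV_cong[OF DERIV_mult[OF f i, unfolded times_divide_eq_right mult_1_right]])
       (simp add: R_def)
qed

text \<open>For t > l the first summand alone suffices, since t =
  \<open>t powr (1 - q) * t powr q\<close> and the first factor decreases in t. With l free to
  choose, this takes the place of Hoelder's inequality.\<close>

lemma le_powr_Young:
  fixes t l q :: real
  assumes "0 \<le> t" "0 < l" "1 < q"
  shows "t \<le> l powr (1 - q) * t powr q + l"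
proof (cases "t \<le> l")
  case True
  then show ?thesis by (simp add: add_increasing)
next
  case False
  then have "t powr (1 - q) \<le> l powr (1 - q)" using assms by (intro powr_mono2') auto
  then have "t powr (1 - q) * t powr q \<le> l powr (1 - q) * t powr q" by (rule mult_right_mono) simp
  moreover have "t powr (1 - q) * t powr q = t" using False assms by (simp add: powr_add[symmetric])
  ultimately show ?thesis using assms by simp
qed

lemma measure_ball_complex: "0 \<le> r \<Longrightarrow> measure lborel (ball (x::complex) r) = pi * r\<^sup>2"
  by (simp add: content_ball unit_ball_vol_2)

text \<open>Hoelder's inequality on a disc up to a constant, obtained by integrating
  \<open>le_powr_Young\<close> with a well-chosen level l.\<close>

lemma integral_norm_ball_le:
  fixes G :: "complex \<Rightarrow> complex"
  assumes G: "G \<in> borel_measurable lebesgue" "integrable lebesgue (\<lambda>y. norm (G y) powr q)"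
    and \<tau>: "(\<integral>y. norm (G y) powr q \<partial>lebesgue) \<le> \<tau> powr q" "\<tau> > 0" and q: "1 < q" and r: "r > 0"
  shows "integrable lebesgue (\<lambda>y. indicator (ball x r) y * norm (G y))"
    and "(\<integral>y. indicator (ball x r) y * norm (G y) \<partial>lebesgue) \<le> 5 * \<tau> * r powr (2 - 2 / q)"
proof -
  \<comment> \<open>This level balances the two summands: they become 1 and pi times
    \<open>\<tau> * r powr (2 - 2 / q)\<close>, and 1 + pi <= 5.\<close>
  define l where "l = \<tau> * r powr (- 2 / q)"
  have l: "l > 0" using \<tau> r by (simp add: l_def)
  let ?f = "\<lambda>y. indicator (ball x r) y * norm (G y)"
  let ?g = "\<lambda>y. l powr (1 - q) * norm (G y) powr q + l * indicator (ball x r) y"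
  have fg: "?f y \<le> ?g y" for y
    using le_powr_Young[of "norm (G y)" l q] l q by (auto simp: indicator_def)
  have ind: "integrable lebesgue (indicator (ball x r) :: complex \<Rightarrow> real)"
    by (simp add: lmeasurable_iff_integrable[symmetric])
  have ig: "integrable lebesgue ?g" using G ind by simp
  note [measurable] = G(1)
  show 1: "integrable lebesgue ?f"
  proof (rule Bochner_Integration.integrable_bound[OF ig])
    show "?f \<in> borel_measurable lebesgue"
      by (intro borel_measurable_times borel_measurable_indicator) (auto intro: borel_measurable_norm G)
    show "AE y in lebesgue. norm (?f y) \<le> norm (?g y)"
    proof (intro always_eventually allI)
      fix y
      have "0 \<le> ?f y" by (simp add: indicator_def)
      then show "norm (?f y) \<le> norm (?g y)" using fg[of y] by simp
    qed
  qed
  have "(\<integral>y. ?f y \<partial>lebesgue) \<le> (\<integral>y. ?g y \<partial>lebesgue)"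
    by (rule integral_mono[OF 1 ig fg])
  also have "\<dots> = l powr (1 - q) * (\<integral>y. norm (G y) powr q \<partial>lebesgue) + l * (pi * r\<^sup>2)"
    using G ind r by (simp add: measure_ball_complex)
  also have "\<dots> \<le> l powr (1 - q) * \<tau> powr q + l * (pi * r\<^sup>2)"
    using \<tau> by (simp add: mult_left_mono)
  also have "l powr (1 - q) * \<tau> powr q = \<tau> * r powr (2 - 2 / q)"
  proof -
    have "l powr (1 - q) * \<tau> powr q = (\<tau> powr (1 - q) * \<tau> powr q) * r powr (- 2 / q * (1 - q))"
      using \<tau> by (simp add: l_def powr_mult powr_powr)
    also have "\<tau> powr (1 - q) * \<tau> powr q = \<tau>" using \<tau> by (simp add: powr_add[symmetric])
    also have "- 2 / q * (1 - q) = 2 - 2 / q" using q by (simp add: field_simps)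
    finally show ?thesis .
  qed
  also have "l * (pi * r\<^sup>2) = pi * (\<tau> * r powr (2 - 2 / q))"
  proof -
    have "r powr (- 2 / q) * r\<^sup>2 = r powr (2 - 2 / q)"
      using r by (simp add: powr_diff powr_minus field_simps)
    then show ?thesis by (simp add: l_def)
  qed
  also have "\<tau> * r powr (2 - 2 / q) + pi * (\<tau> * r powr (2 - 2 / q)) = (1 + pi) * (\<tau> * r powr (2 - 2 / q))"
    by (simp add: algebra_simps)
  also have "\<dots> \<le> 5 * (\<tau> * r powr (2 - 2 / q))"
    using pi_less_4 \<tau> by (intro mult_right_mono) auto
  finally show "(\<integral>y. ?f y \<partial>lebesgue) \<le> 5 * \<tau> * r powr (2 - 2 / q)" by simp
qed

text \<open>By \<open>bump_transport\<close> the time derivative of the bump is minus the divergence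
  of a test field, so the definition of the weak gradient moves the derivative from that field to
  U.\<close>

lemma DERIV_bump_average:
  fixes U :: "complex \<Rightarrow> real" and G :: "complex \<Rightarrow> complex" and x v :: complex and r \<rho> t :: real
  assumes U: "locally_integrable UNIV U" and G: "has_weak_gradient UNIV U G" and R0: "r + t * \<rho> > 0"
  defines "X \<equiv> \<lambda>s. x + s *\<^sub>R v" and "R \<equiv> \<lambda>s. r + s * \<rho>"
  shows "((\<lambda>s. \<integral>y. U y * bump (X s) (R s) y \<partial>lebesgue) has_real_derivative
     (\<integral>y. bump (X t) (R t) y * ((v + (\<rho> / R t) *\<^sub>R (y - X t)) \<bullet> G y) \<partial>lebesgue)) (at t)"
proof -
  define N where "N = (\<lambda>s y. (y - X s) \<bullet> (y - X s))"
  define \<phi>' where "\<phi>' = (\<lambda>s y. flat 1 (1 - N s y / (R s)\<^sup>2) * (2 * ((y - X s) \<bullet> v) / (R s)\<^sup>2 + 2 * N s y * \<rho> / R s ^ 3) / (R s)\<^sup>2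
         - 2 * \<rho> / R s ^ 3 * flat 0 (1 - N s y / (R s)\<^sup>2))"
  have R: "R t > 0" using R0 by (simp add: R_def)
  \<comment> \<open>For s within e of t the radius changes by at most half of R t and so stays away
    from 0; the summand 1 covers \<rho> = 0.\<close>
  define e where "e = R t / (2 * (\<bar>\<rho>\<bar> + 1))"
  have e: "e > 0" using R by (simp add: e_def)
  have Rs: "R s \<ge> R t / 2" "\<bar>R s - R t\<bar> \<le> e * \<bar>\<rho>\<bar>" "norm (X s - X t) \<le> e * norm v"
    if "s \<in> cball t e" for s
  proof -
    have 1: "\<bar>s - t\<bar> \<le> e" using that by (simp add: dist_real_def abs_minus_commute)
    have "R s - R t = (s - t) * \<rho>" by (simp add: R_def algebra_simps)
    then show 2: "\<bar>R s - R t\<bar> \<le> e * \<bar>\<rho>\<bar>" using 1 by (simp add: abs_mult mult_right_mono)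
    have "e * \<bar>\<rho>\<bar> \<le> R t / 2" using R by (simp add: e_def field_simps)
    then show "R s \<ge> R t / 2" using 2 by linarith
    have "X s - X t = (s - t) *\<^sub>R v" by (simp add: X_def algebra_simps)
    then show "norm (X s - X t) \<le> e * norm v" using 1 by (simp add: mult_right_mono)
  qed
  define K where "K = cball (X t) (e * norm v + R t + e * \<bar>\<rho>\<bar>)"
  have out: "R s > 0" "y \<notin> ball (X s) (R s)" if "s \<in> cball t e" "y \<notin> K" for s y
  proof -
    show "R s > 0" using Rs(1)[OF that(1)] R by linarith
    have "dist (X t) y \<le> norm (X s - X t) + dist (X s) y"
      by (metis dist_commute dist_norm dist_triangle)
    moreover have "dist (X t) y > e * norm v + R t + e * \<bar>\<rho>\<bar>" using that by (simp add: K_def)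
    ultimately have "dist (X s) y > R s" using Rs[OF that(1)] by linarith
    then show "y \<notin> ball (X s) (R s)" by simp
  qed
  have Rne: "R s \<noteq> 0" if "s \<in> cball t e" for s using Rs(1)[OF that] R by auto
  have sub: "ball t e \<subseteq> cball t e" by auto
  have supp: "bump (X s) (R s) y = 0" "\<phi>' s y = 0" if "s \<in> cball t e" "y \<notin> K" for s y
    using flat_quadratic_eq_0[OF out[OF that]] by (simp_all add: bump_def \<phi>'_def N_def)
  have "compact (cball t e \<times> K)" by (simp add: K_def compact_Times)
  moreover have "continuous_on (cball t e \<times> K) (\<lambda>p. \<phi>' (fst p) (snd p))"
    unfolding \<phi>'_def N_def X_def using Rne unfolding R_def
    by (auto intro!: continuous_intros)
  ultimately have "bounded ((\<lambda>p. \<phi>' (fst p) (snd p)) ` (cball t e \<times> K))"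
    by (intro compact_imp_bounded compact_continuous_image)
  then obtain B1 where B1: "\<And>s y. s \<in> cball t e \<Longrightarrow> y \<in> K \<Longrightarrow> \<bar>\<phi>' s y\<bar> \<le> B1"
    by (fastforce simp: bounded_iff)
  define B where "B = max (max 0 B1) (1 / (R t / 2)\<^sup>2)"
  have bound: "\<bar>bump (X s) (R s) y\<bar> \<le> B" "\<bar>\<phi>' s y\<bar> \<le> B" if "s \<in> cball t e" for s y
  proof -
    have "bump (X s) (R s) y \<le> 1 / (R s)\<^sup>2" by (rule bump_le)
    also have "\<dots> \<le> 1 / (R t / 2)\<^sup>2"
      using Rs(1)[OF that] R by (intro divide_left_mono power_mono mult_pos_pos zero_less_power) auto
    finally show "\<bar>bump (X s) (R s) y\<bar> \<le> B" by (simp add: B_def bump_nonneg)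
    show "\<bar>\<phi>' s y\<bar> \<le> B"
      using B1[OF that, of y] supp(2)[OF that, of y] by (cases "y \<in> K") (auto simp: B_def)
  qed
  have deriv: "((\<lambda>s. bump (X s) (R s) y) has_real_derivative \<phi>' s y) (at s)" if "s \<in> cball t e" for s y
    using DERIV_bump[of r s \<rho> x v y] Rs(1)[OF that] R by (simp add: X_def R_def \<phi>'_def N_def Let_def)
  have "((\<lambda>s. \<integral>y. U y * bump (X s) (R s) y \<partial>lebesgue) has_real_derivative
     (\<integral>y. U y * \<phi>' t y \<partial>lebesgue)) (at t)"
  proof (rule DERIV_integral_parameter[where K = K and e = e and B = B])
    show "set_integrable lebesgue K U" using U by (simp add: locally_integrable_def K_def)
    show "\<phi>' t \<in> borel_measurable lebesgue"
      unfolding \<phi>'_def N_def using R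
      by (intro continuous_on_imp_borel_measurable_lebesgue) (auto intro!: continuous_intros)
    show "bump (X s) (R s) \<in> borel_measurable lebesgue" for s
      by (intro continuous_on_imp_borel_measurable_lebesgue continuous_on_bump)
  qed (use e sub deriv bound supp in \<open>auto\<close>)
  moreover have "(\<integral>y. U y * \<phi>' t y \<partial>lebesgue) =
      (\<integral>y. bump (X t) (R t) y * ((v + (\<rho> / R t) *\<^sub>R (y - X t)) \<bullet> G y) \<partial>lebesgue)"
  proof -
    define \<Psi> where "\<Psi> = (\<lambda>e y. bump (X t) (R t) y * ((v + (\<rho> / R t) *\<^sub>R (y - X t)) \<bullet> e))"
    have test: "test_function UNIV (\<Psi> e)" for e
      unfolding \<Psi>_def by (rule bump_transport(1)[OF R])
    have div: "(\<Sum>e\<in>Basis. frechet_derivative (\<Psi> e) (at y) e) = - \<phi>' t y" for y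
      unfolding \<Psi>_def \<phi>'_def N_def by (rule bump_transport(2)[OF R])
    have li: "locally_integrable UNIV (\<lambda>x. G x \<bullet> e)" for e
      using G by (intro locally_integrable_inner) (simp add: has_weak_gradient_def)
    have i1: "integrable lebesgue (\<lambda>y. U y * frechet_derivative (\<Psi> e) (at y) e)" for e
      using set_integrable_times_test_function[OF U test_function_frechet_derivative[OF test]]
      by (simp add: set_integrable_def)
    have i2: "integrable lebesgue (\<lambda>y. (G y \<bullet> e) * \<Psi> e y)" for e
      using set_integrable_times_test_function[OF li test] by (simp add: set_integrable_def)
    have "(\<integral>y. U y * \<phi>' t y \<partial>lebesgue) = (\<integral>y. - (\<Sum>e\<in>Basis. U y * frechet_derivative (\<Psi> e) (at y) e) \<partial>lebesgue)"
      by (simp add: sum_distrib_left[symmetric] div)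
    also have "\<dots> = - (\<Sum>e\<in>Basis. \<integral>y. U y * frechet_derivative (\<Psi> e) (at y) e \<partial>lebesgue)"
      using i1 by simp
    also have "\<dots> = (\<Sum>e\<in>Basis. \<integral>y. (G y \<bullet> e) * \<Psi> e y \<partial>lebesgue)"
    proof -
      have "(\<integral>y. U y * frechet_derivative (\<Psi> e) (at y) e \<partial>lebesgue) = - (\<integral>y. (G y \<bullet> e) * \<Psi> e y \<partial>lebesgue)"
        if "e \<in> Basis" for e
        using G test[of e] that by (simp add: has_weak_gradient_def set_lebesgue_integral_def)
      then show ?thesis by (simp add: sum_negf)
    qed
    also have "\<dots> = (\<integral>y. (\<Sum>e\<in>Basis. (G y \<bullet> e) * \<Psi> e y) \<partial>lebesgue)"
      using i2 by simp
    also have "\<dots> = (\<integral>y. bump (X t) (R t) y * ((v + (\<rho> / R t) *\<^sub>R (y - X t)) \<bullet> G y) \<partial>lebesgue)"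
    proof (rule Bochner_Integration.integral_cong)
      fix y
      show "(\<Sum>e\<in>Basis. (G y \<bullet> e) * \<Psi> e y) = bump (X t) (R t) y * ((v + (\<rho> / R t) *\<^sub>R (y - X t)) \<bullet> G y)"
        unfolding euclidean_inner[of "v + _" "G y"] sum_distrib_left \<Psi>_def
        by (rule sum.cong) (auto simp: mult_ac)
    qed simp
    finally show ?thesis .
  qed
  ultimately show ?thesis by simp
qed

text \<open>On the disc the transport field has norm at most 2 D, because \<rho> / r times y - x
  contributes at most D, and the bump is at most 1 / r^2; the rest is
  \<open>integral_norm_ball_le\<close>.\<close>

lemma DERIV_bump_average_le:
  fixes G :: "complex \<Rightarrow> complex"
  assumes G: "G \<in> borel_measurable lebesgue" "integrable lebesgue (\<lambda>y. norm (G y) powr q)"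
    and \<tau>: "(\<integral>y. norm (G y) powr q \<partial>lebesgue) \<le> \<tau> powr q" "\<tau> > 0" and q: "1 < q" and r: "r > 0"
    and v: "norm v \<le> D" "\<bar>\<rho>\<bar> \<le> D"
  shows "\<bar>\<integral>y. bump x r y * ((v + (\<rho> / r) *\<^sub>R (y - x)) \<bullet> G y) \<partial>lebesgue\<bar> \<le> 10 * \<tau> * D * r powr (- 2 / q)"
proof -
  note I = integral_norm_ball_le[OF G \<tau> q r, of x]
  have D: "0 \<le> D" using v(1) norm_ge_zero order_trans by blast
  have "norm (bump x r y * ((v + (\<rho> / r) *\<^sub>R (y - x)) \<bullet> G y)) \<le> 2 * D / r\<^sup>2 * (indicator (ball x r) y * norm (G y))" for y
  proof (cases "y \<in> ball x r")
    case True
    then have yx: "norm (y - x) \<le> r" by (simp add: dist_norm norm_minus_commute)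
    have "norm ((\<rho> / r) *\<^sub>R (y - x)) \<le> D"
    proof -
      have "\<bar>\<rho>\<bar> * norm (y - x) \<le> D * r" using v yx D by (intro mult_mono) auto
      then show ?thesis unfolding norm_scaleR using r by (simp add: field_simps)
    qed
    then have w: "norm (v + (\<rho> / r) *\<^sub>R (y - x)) \<le> 2 * D"
      using v norm_triangle_ineq[of v "(\<rho> / r) *\<^sub>R (y - x)"] by linarith
    have "\<bar>(v + (\<rho> / r) *\<^sub>R (y - x)) \<bullet> G y\<bar> \<le> 2 * D * norm (G y)"
      using Cauchy_Schwarz_ineq2[of "v + (\<rho> / r) *\<^sub>R (y - x)" "G y"] mult_right_mono[OF w, of "norm (G y)"] by simp
    then have "bump x r y * \<bar>(v + (\<rho> / r) *\<^sub>R (y - x)) \<bullet> G y\<bar> \<le> 1 / r\<^sup>2 * (2 * D * norm (G y))"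
      using D by (intro mult_mono bump_le) auto
    then show ?thesis using True by (simp add: abs_mult bump_nonneg)
  qed (simp add: bump_eq_0[OF r])
  then have "\<bar>\<integral>y. bump x r y * ((v + (\<rho> / r) *\<^sub>R (y - x)) \<bullet> G y) \<partial>lebesgue\<bar>
      \<le> (\<integral>y. 2 * D / r\<^sup>2 * (indicator (ball x r) y * norm (G y)) \<partial>lebesgue)"
    unfolding real_norm_def[symmetric]
    using I(1) D by (intro order_trans[OF integral_norm_bound] integral_mono') (simp_all add: indicator_def)
  also have "\<dots> = 2 * D / r\<^sup>2 * (\<integral>y. indicator (ball x r) y * norm (G y) \<partial>lebesgue)"
    by (rule integral_mult_right_zero)
  also have "\<dots> \<le> 2 * D / r\<^sup>2 * (5 * \<tau> * r powr (2 - 2 / q))"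
    using D by (intro mult_left_mono I(2)) auto
  also have "\<dots> = 10 * \<tau> * D * r powr (- 2 / q)"
    using r by (simp add: powr_diff powr_minus field_simps)
  finally show ?thesis .
qed

text \<open>The centre moves from x to z while the radius grows linearly from r to r + D. Because of
  this growth the derivative bound \<open>(r + s * D) powr (- 2 / q)\<close> has an integral in s
  that stays bounded as r tends to 0, as 2 / q < 1; at a fixed radius it would blow up.\<close>

lemma bump_average_diff_le:
  fixes U :: "complex \<Rightarrow> real" and G :: "complex \<Rightarrow> complex"
  assumes U: "locally_integrable UNIV U" and wG: "has_weak_gradient UNIV U G"
    and G: "G \<in> borel_measurable lebesgue" "integrable lebesgue (\<lambda>y. norm (G y) powr q)"
    and \<tau>: "(\<integral>y. norm (G y) powr q \<partial>lebesgue) \<le> \<tau> powr q" "\<tau> > 0" and q: "2 < q" and r: "r > 0"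
    and D: "norm (z - x) \<le> D" "D > 0"
  shows "\<bar>(\<integral>y. U y * bump z (r + D) y \<partial>lebesgue) - (\<integral>y. U y * bump x r y \<partial>lebesgue)\<bar>
      \<le> 10 * \<tau> / (1 - 2 / q) * (r + D) powr (1 - 2 / q)"
proof -
  define m where "m = (\<lambda>s. \<integral>y. U y * bump (x + s *\<^sub>R (z - x)) (r + s * D) y \<partial>lebesgue)"
  define m' where "m' = (\<lambda>s. \<integral>y. bump (x + s *\<^sub>R (z - x)) (r + s * D) y *
     (((z - x) + (D / (r + s * D)) *\<^sub>R (y - (x + s *\<^sub>R (z - x)))) \<bullet> G y) \<partial>lebesgue)"
  define h where "h = (\<lambda>s. 10 * \<tau> / (1 - 2 / q) * (r + s * D) powr (1 - 2 / q))"
  have pos: "r + s * D > 0" if "0 \<le> s" for s using r D(2) that by (simp add: add_pos_nonneg)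
  have c: "1 - 2 / q > 0" using q by simp
  have dm: "(m has_real_derivative m' s) (at s)" if "0 \<le> s" for s
    unfolding m_def m'_def by (rule DERIV_bump_average[OF U wG pos[OF that]])
  have m'_le: "\<bar>m' s\<bar> \<le> 10 * \<tau> * D * (r + s * D) powr (- 2 / q)" if "0 \<le> s" for s
    unfolding m'_def by (rule DERIV_bump_average_le[OF G \<tau> _ pos[OF that]]) (use q D in auto)
  have dh: "(h has_real_derivative 10 * \<tau> * D * (r + s * D) powr (- 2 / q)) (at s)" if "0 \<le> s" for s
  proof -
    define p where "p = 1 - 2 / q"
    have p: "p > 0" "p - 1 = - 2 / q" using c by (simp_all add: p_def)
    have "((\<lambda>s. (r + s * D) powr p) has_real_derivative p * (r + s * D) powr (p - 1) * D) (at s)"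
      using pos[OF that] by (auto intro!: derivative_eq_intros)
    then have "(h has_real_derivative 10 * \<tau> / p * (p * (r + s * D) powr (p - 1) * D)) (at s)"
      unfolding h_def p_def[symmetric] by (rule DERIV_cmult)
    moreover have "10 * \<tau> / p * (p * (r + s * D) powr (p - 1) * D) = 10 * \<tau> * D * (r + s * D) powr (- 2 / q)"
      using p by simp
    ultimately show ?thesis by simp
  qed
  \<comment> \<open>h is a primitive of the bound for the absolute value of m', so h - m and h + m
    are both nondecreasing.\<close>
  have "h 0 - m 0 \<le> h 1 - m 1"
  proof (rule DERIV_nonneg_imp_nondecreasing[where f = "\<lambda>s. h s - m s"])
    fix s :: real assume "0 \<le> s" "s \<le> 1"
    then show "\<exists>y. ((\<lambda>s. h s - m s) has_real_derivative y) (at s) \<and> 0 \<le> y"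
      using DERIV_diff[OF dh[OF \<open>0 \<le> s\<close>] dm[OF \<open>0 \<le> s\<close>]] m'_le[OF \<open>0 \<le> s\<close>]
      by (intro exI[of _ "10 * \<tau> * D * (r + s * D) powr (- 2 / q) - m' s"] conjI) (assumption | linarith)+
  qed simp
  moreover have "h 0 + m 0 \<le> h 1 + m 1"
  proof (rule DERIV_nonneg_imp_nondecreasing[where f = "\<lambda>s. h s + m s"])
    fix s :: real assume "0 \<le> s" "s \<le> 1"
    then show "\<exists>y. ((\<lambda>s. h s + m s) has_real_derivative y) (at s) \<and> 0 \<le> y"
      using DERIV_add[OF dh[OF \<open>0 \<le> s\<close>] dm[OF \<open>0 \<le> s\<close>]] m'_le[OF \<open>0 \<le> s\<close>]
      by (intro exI[of _ "10 * \<tau> * D * (r + s * D) powr (- 2 / q) + m' s"] conjI) (assumption | linarith)+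
  qed simp
  moreover have "h 0 \<ge> 0" using c \<tau> by (simp add: h_def)
  ultimately have "\<bar>m 1 - m 0\<bar> \<le> h 1" by linarith
  then show ?thesis by (simp add: m_def h_def)
qed

definition bump_mass :: real where
  "bump_mass = (\<integral>y. bump 0 1 y \<partial>lebesgue)"

lemma integrable_bump: "r > 0 \<Longrightarrow> integrable lebesgue (bump x r)"
  using set_integrable_compactly_supported[OF continuous_on_bump[of UNIV x r] compact_cball[of x r]]
    bump_eq_0[of r _ x]
  by (simp add: set_integrable_def)

text \<open>The estimate for bump averages is applied to the constant function 1, whose gradient is
  0, with \<tau> arbitrarily small: moving and growing a bump does not change its integral. The
  exponent 3 is a sample value above 2.\<close>

lemma integral_bump:
  assumes r: "r > 0" shows "(\<integral>y. bump x r y \<partial>lebesgue) = bump_mass"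
proof -
  have const: "(\<integral>y. bump z (r + D) y \<partial>lebesgue) = (\<integral>y. bump x r y \<partial>lebesgue)"
    if "r > 0" "norm (z - x) \<le> D" "D > 0" for x z r D
  proof -
    have "C1_gradient UNIV (\<lambda>_::complex. 1) (\<lambda>_. 0)" by (simp add: C1_gradient_def)
    then have wG: "has_weak_gradient UNIV (\<lambda>_::complex. 1) (\<lambda>_. 0)"
      by (intro C1_gradient_imp_has_weak_gradient) simp
    have U: "locally_integrable UNIV (\<lambda>_::complex. 1 :: real)"
      by (intro continuous_on_imp_locally_integrable continuous_intros)
    let ?d = "\<bar>(\<integral>y. bump z (r + D) y \<partial>lebesgue) - (\<integral>y. bump x r y \<partial>lebesgue)\<bar>"
    have "?d \<le> 0 + e" if "e > 0" for e
    proof -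
      let ?c = "10 / (1 - 2 / 3) * (r + D) powr (1 - 2 / 3 :: real)"
      have "?c > 0" using \<open>r > 0\<close> \<open>D > 0\<close> by simp
      then have "?d \<le> 10 * (e / ?c) / (1 - 2 / 3) * (r + D) powr (1 - 2 / 3)"
        using bump_average_diff_le[OF U wG, of 3 "e / ?c" r z x D] that \<open>r > 0\<close> \<open>D > 0\<close> \<open>norm (z - x) \<le> D\<close>
        by simp
      also have "\<dots> = e" using \<open>?c > 0\<close> by (simp add: field_simps)
      finally show ?thesis by simp
    qed
    then have "?d \<le> 0" by (rule field_le_epsilon)
    then show ?thesis by simp
  qed
  \<comment> \<open>T is large enough for the bump at x of radius r and the one at 0 of radius 1 to
    be both moved to centre 0 and grown to radius T.\<close>
  define T where "T = r + 1 + norm x + 1"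
  have "(\<integral>y. bump 0 (r + (T - r)) y \<partial>lebesgue) = (\<integral>y. bump x r y \<partial>lebesgue)"
    by (rule const) (use r in \<open>auto simp: T_def add_pos_nonneg\<close>)
  moreover have "(\<integral>y. bump 0 (1 + (T - 1)) y \<partial>lebesgue) = (\<integral>y. bump 0 1 y \<partial>lebesgue)"
    by (rule const) (use r in \<open>auto simp: T_def add_pos_nonneg\<close>)
  ultimately show ?thesis by (simp add: bump_mass_def)
qed

lemma bump_mass_pos: "bump_mass > 0"
proof -
  let ?B = "ball (0::complex) (1/2)"
  have c: "flat 0 (3/4) > 0" by (rule flat_0_pos) simp
  have ge: "flat 0 (3/4) * indicator ?B y \<le> bump 0 1 y" for y
  proof (cases "y \<in> ?B")
    case True
    then have "(norm y)\<^sup>2 \<le> (1/2)\<^sup>2" by (intro power_mono) auto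
    then have "3 / 4 \<le> 1 - y \<bullet> y" by (simp add: dot_square_norm power_divide)
    then have "flat 0 (3/4) \<le> flat 0 (1 - y \<bullet> y)"
      using le_imp_inverse_le[of "3/4" "1 - y \<bullet> y"] by (simp add: flat_def del: inverse_eq_divide)
    then show ?thesis using True by (simp add: bump_def)
  qed (simp add: bump_nonneg)
  have ind: "integrable lebesgue (indicator ?B :: complex \<Rightarrow> real)"
    by (simp add: lmeasurable_iff_integrable[symmetric])
  have "0 < flat 0 (3/4) * (pi * (1/2)\<^sup>2)" using c by simp
  also have "\<dots> = (\<integral>y. flat 0 (3/4) * indicator ?B y \<partial>lebesgue)"
    by (simp add: measure_ball_complex)
  also have "\<dots> \<le> bump_mass"
    unfolding bump_mass_def using ind by (intro integral_mono ge integrable_bump) auto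
  finally show ?thesis .
qed

text \<open>U agrees almost everywhere near z with a continuous function, so its averages converge
  at every point z of S and not just at almost every one.\<close>

lemma bump_average_tendsto:
  assumes U: "locally_integrable UNIV U" and S: "open S" "z \<in> S" and f: "continuous_on S f"
    and eq: "AE y in lebesgue. y \<in> S \<longrightarrow> U y = f y"
  shows "((\<lambda>r. \<integral>y. U y * bump z r y \<partial>lebesgue) \<longlongrightarrow> f z * bump_mass) (at_right 0)"
proof (rule tendstoI)
  fix e :: real assume e: "e > 0"
  define \<eta> where "\<eta> = e / (2 * bump_mass)"
  have \<eta>: "\<eta> > 0" using e bump_mass_pos by (simp add: \<eta>_def)
  obtain d1 where d1: "d1 > 0" "ball z d1 \<subseteq> S" using S openE by blast
  obtain d2 where d2: "d2 > 0" "\<And>y. y \<in> S \<Longrightarrow> dist y z < d2 \<Longrightarrow> dist (f y) (f z) < \<eta>"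
    using f S(2) \<eta> unfolding continuous_on_iff by metis
  have "dist (\<integral>y. U y * bump z r y \<partial>lebesgue) (f z * bump_mass) < e" if r: "0 < r" "r < min d1 d2" for r
  proof -
    have iU: "integrable lebesgue (\<lambda>y. U y * bump z r y)"
    proof -
      have "test_function UNIV (bump z r)"
        using bump_transport(1)[OF r(1), of z 1 0 1] by simp
      then show ?thesis using set_integrable_times_test_function[OF U] by (simp add: set_integrable_def)
    qed
    have ib: "integrable lebesgue (bump z r)" by (rule integrable_bump) fact
    have "\<bar>\<integral>y. (U y - f z) * bump z r y \<partial>lebesgue\<bar> \<le> (\<integral>y. \<eta> * bump z r y \<partial>lebesgue)"
    proof -
      have "AE y in lebesgue. norm ((U y - f z) * bump z r y) \<le> \<eta> * bump z r y"
        using eq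
      proof eventually_elim
        case (elim y)
        show ?case
        proof (cases "y \<in> ball z r")
          case True
          then have "y \<in> S" "dist y z < d2" using d1 r by (auto simp: dist_commute subset_iff)
          then have "\<bar>U y - f z\<bar> \<le> \<eta>" using d2(2)[of y] elim by (simp add: dist_real_def)
          then show ?thesis by (simp add: abs_mult bump_nonneg mult_right_mono)
        qed (simp add: bump_eq_0[OF r(1)])
      qed
      then have "(\<integral>y. norm ((U y - f z) * bump z r y) \<partial>lebesgue) \<le> (\<integral>y. \<eta> * bump z r y \<partial>lebesgue)"
        using ib \<eta> by (intro integral_mono_AE') (auto simp: bump_nonneg)
      from order_trans[OF integral_norm_bound this] show ?thesis by simp
    qed
    moreover have "(\<integral>y. (U y - f z) * bump z r y \<partial>lebesgue) = (\<integral>y. U y * bump z r y \<partial>lebesgue) - f z * bump_mass"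
      using iU ib by (simp add: left_diff_distrib integral_bump[OF r(1)])
    moreover have "(\<integral>y. \<eta> * bump z r y \<partial>lebesgue) = e / 2"
      using bump_mass_pos by (simp add: integral_bump[OF r(1)] \<eta>_def)
    ultimately show ?thesis using e by (simp add: dist_real_def)
  qed
  then show "eventually (\<lambda>r. dist (\<integral>y. U y * bump z r y \<partial>lebesgue) (f z * bump_mass) < e) (at_right 0)"
    using d1 d2 by (auto simp: eventually_at_right_field intro!: exI[of _ "min d1 d2"])
qed

definition morrey_const :: "real \<Rightarrow> real" where
  "morrey_const q = 20 / ((1 - 2 / q) * bump_mass)"

lemma morrey_const_pos: "2 < q \<Longrightarrow> morrey_const q > 0"
  using bump_mass_pos by (simp add: morrey_const_def)

text \<open>The averages of radius r at z1 and at z2 are both compared with the one of radius r + D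
  at z2, each with constant 10; this is the 20 in \<open>morrey_const\<close>. Then r tends to
  0.\<close>

lemma Morrey_inequality:
  fixes U :: "complex \<Rightarrow> real" and G :: "complex \<Rightarrow> complex"
  assumes U: "locally_integrable UNIV U" and wG: "has_weak_gradient UNIV U G"
    and G: "G \<in> borel_measurable lebesgue" "integrable lebesgue (\<lambda>y. norm (G y) powr q)"
    and \<tau>: "(\<integral>y. norm (G y) powr q \<partial>lebesgue) \<le> \<tau> powr q" "\<tau> > 0" and q: "2 < q"
    and S: "open S" "z1 \<in> S" "z2 \<in> S" and f: "continuous_on S f"
    and eq: "AE y in lebesgue. y \<in> S \<longrightarrow> U y = f y"
  shows "\<bar>f z1 - f z2\<bar> \<le> morrey_const q * \<tau> * dist z1 z2 powr (1 - 2 / q)"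
proof (cases "z1 = z2")
  case False
  define D where "D = dist z1 z2"
  have D: "D > 0" using False by (simp add: D_def)
  let ?A = "\<lambda>z r. \<integral>y. U y * bump z r y \<partial>lebesgue"
  have c: "1 - 2 / q > 0" using q by simp
  have "\<bar>f z1 * bump_mass - f z2 * bump_mass\<bar> \<le> 20 * \<tau> / (1 - 2 / q) * (0 + D) powr (1 - 2 / q)"
  proof (rule tendsto_le[of "at_right 0"])
    show "((\<lambda>r. \<bar>?A z1 r - ?A z2 r\<bar>) \<longlongrightarrow> \<bar>f z1 * bump_mass - f z2 * bump_mass\<bar>) (at_right 0)"
      by (intro tendsto_intros bump_average_tendsto[OF U S(1) _ f eq] S)
    show "((\<lambda>r. 20 * \<tau> / (1 - 2 / q) * (r + D) powr (1 - 2 / q)) \<longlongrightarrow>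
        20 * \<tau> / (1 - 2 / q) * (0 + D) powr (1 - 2 / q)) (at_right 0)"
      using D by (intro tendsto_intros) auto
    show "eventually (\<lambda>r. \<bar>?A z1 r - ?A z2 r\<bar> \<le> 20 * \<tau> / (1 - 2 / q) * (r + D) powr (1 - 2 / q)) (at_right 0)"
      unfolding eventually_at_right_field
    proof (intro exI[of _ 1] conjI allI impI)
      fix r :: real assume r: "0 < r"
      have "\<bar>?A z2 (r + D) - ?A z1 r\<bar> \<le> 10 * \<tau> / (1 - 2 / q) * (r + D) powr (1 - 2 / q)"
        by (rule bump_average_diff_le[OF U wG G \<tau> q r]) (use D in \<open>auto simp: D_def dist_norm norm_minus_commute\<close>)
      moreover have "\<bar>?A z2 (r + D) - ?A z2 r\<bar> \<le> 10 * \<tau> / (1 - 2 / q) * (r + D) powr (1 - 2 / q)"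
        by (rule bump_average_diff_le[OF U wG G \<tau> q r]) (use D in auto)
      ultimately have "\<bar>?A z1 r - ?A z2 r\<bar> \<le> 2 * (10 * \<tau> / (1 - 2 / q) * (r + D) powr (1 - 2 / q))" by linarith
      then show "\<bar>?A z1 r - ?A z2 r\<bar> \<le> 20 * \<tau> / (1 - 2 / q) * (r + D) powr (1 - 2 / q)" by simp
    qed simp
  qed simp
  moreover have "\<bar>f z1 * bump_mass - f z2 * bump_mass\<bar> = \<bar>f z1 - f z2\<bar> * bump_mass"
    using bump_mass_pos by (simp add: left_diff_distrib[symmetric] abs_mult)
  ultimately have "\<bar>f z1 - f z2\<bar> * bump_mass \<le> 20 * \<tau> / (1 - 2 / q) * D powr (1 - 2 / q)" by simp
  then have "\<bar>f z1 - f z2\<bar> \<le> 20 * \<tau> / (1 - 2 / q) * D powr (1 - 2 / q) / bump_mass"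
    using bump_mass_pos by (simp only: pos_le_divide_eq)
  also have "\<dots> = morrey_const q * \<tau> * D powr (1 - 2 / q)"
    by (simp only: morrey_const_def divide_inverse inverse_mult_distrib mult_ac)
  finally show ?thesis by (simp only: D_def)
qed simp

text \<open>The C^1 function w is a continuous representative of its extension on \<Omega>, so
  Morrey's inequality for the extension holds at the points z1 and z2 themselves.\<close>

lemma extension_operator_Hoelder:
  fixes \<Omega> :: "complex set"
  assumes q: "2 < q" and \<Omega>: "open \<Omega>" and E: "sobolev_extension_operator q C0 \<Omega> E"
    and w: "C1_gradient \<Omega> w g" and g: "set_integrable lebesgue \<Omega> (\<lambda>x. norm (g x) powr q)"
    and A: "(LINT x:\<Omega>|lebesgue. norm (g x) powr q) \<le> A" and z: "z1 \<in> \<Omega>" "z2 \<in> \<Omega>"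
  shows "\<bar>w z1 - w z2\<bar> powr q \<le> (morrey_const q * C0) powr q * dist z1 z2 powr (q - 2) * A"
proof -
  have C0: "C0 \<ge> 1" using E by (simp add: sobolev_extension_operator_def)
  have wg: "has_weak_gradient \<Omega> w g" using \<Omega> w by (rule C1_gradient_imp_has_weak_gradient)
  \<comment> \<open>\<open>sobolev\<close> refers to the chosen representative; it agrees with g
    almost everywhere, and completeness of Lebesgue measure transfers measurability.\<close>
  define g' where "g' = weak_gradient \<Omega> w"
  have wg': "has_weak_gradient \<Omega> w g'"
    unfolding g'_def weak_gradient_def by (rule someI[of _ g]) (rule wg)
  have ae: "AE x in lebesgue. x \<in> \<Omega> \<longrightarrow> g x = g' x" by (rule weak_gradient_unique[OF \<Omega> wg wg'])
  have contg: "continuous_on \<Omega> g" using w by (simp add: C1_gradient_def)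
  have mg: "(\<lambda>x. indicator \<Omega> x *\<^sub>R g x) \<in> borel_measurable lebesgue"
    using borel_measurable_continuous_on_indicator[OF _ contg] \<Omega>
    by (intro measurable_completion) simp
  have mg': "(\<lambda>x. indicator \<Omega> x *\<^sub>R g' x) \<in> borel_measurable lebesgue"
    by (rule borel_measurable_AE[OF mg]) (use ae in \<open>auto elim!: eventually_mono simp: indicator_def\<close>)
  have ig: "integrable lebesgue (\<lambda>x. indicator \<Omega> x *\<^sub>R norm (g x) powr q)"
    using g by (simp add: set_integrable_def)
  have ae': "AE x in lebesgue. indicator \<Omega> x *\<^sub>R norm (g x) powr q = indicator \<Omega> x *\<^sub>R norm (g' x) powr q"
    using ae by (auto elim!: eventually_mono simp: indicator_def)
  have mn: "(\<lambda>x. indicator \<Omega> x *\<^sub>R norm (g x) powr q) \<in> borel_measurable lebesgue"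
    using ig by auto
  have mn': "(\<lambda>x. indicator \<Omega> x *\<^sub>R norm (g' x) powr q) \<in> borel_measurable lebesgue"
    by (rule borel_measurable_AE[OF mn ae'])
  have "integrable lebesgue (\<lambda>x. indicator \<Omega> x *\<^sub>R norm (g' x) powr q)"
    using ig integrable_cong_AE[OF mn mn' ae'] by simp
  then have "in_Lq q \<Omega> g'"
    unfolding in_Lq_def set_borel_measurable_def set_integrable_def using mg' by simp
  moreover have contw: "continuous_on \<Omega> w" by (rule C1_gradient_imp_continuous_on[OF w])
  ultimately have ws: "w \<in> sobolev q \<Omega>"
    unfolding sobolev_def g'_def using wg continuous_on_imp_locally_integrable by blast
  have Iw: "(LINT x:\<Omega>|lebesgue. norm (weak_gradient \<Omega> w x) powr q) \<le> A"
    unfolding g'_def[symmetric] using A integral_cong_AE[OF mn mn' ae']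
    by (simp add: set_lebesgue_integral_def)
  have Iw0: "0 \<le> (LINT x:\<Omega>|lebesgue. norm (weak_gradient \<Omega> w x) powr q)"
    unfolding set_lebesgue_integral_def by (intro Bochner_Integration.integral_nonneg) (simp add: indicator_def)
  define U where "U = E w"
  define G where "G = weak_gradient UNIV U"
  from E ws have U: "U \<in> sobolev q UNIV" "AE x in lebesgue. x \<in> \<Omega> \<longrightarrow> U x = w x"
    "sobolev_norm q UNIV U \<le> C0 * sobolev_norm q \<Omega> w"
    unfolding sobolev_extension_operator_def U_def by blast+
  have wG: "has_weak_gradient UNIV U G"
    using U(1) someI_ex[of "has_weak_gradient UNIV U"] unfolding sobolev_def G_def weak_gradient_def by simp
  have G: "G \<in> borel_measurable lebesgue" "integrable lebesgue (\<lambda>y. norm (G y) powr q)"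
    using U(1) unfolding sobolev_def G_def in_Lq_def
    by (auto simp: set_borel_measurable_def set_integrable_def)
  have U1: "locally_integrable UNIV U" using U(1) by (simp add: sobolev_def)
  define c where "c = (morrey_const q * C0) powr q * dist z1 z2 powr (q - 2)"
  have c0: "c \<ge> 0" by (simp add: c_def)
  \<comment> \<open>Morrey's inequality is stated for \<tau> > 0 while A may be 0; hence a slightly
    larger A', removed by the epsilon argument at the end.\<close>
  have main: "\<bar>w z1 - w z2\<bar> powr q \<le> c * A'" if A': "A' > A" for A'
  proof -
    have A'0: "A' > 0" using A' Iw Iw0 by linarith
    define \<tau> where "\<tau> = C0 * A' powr (1 / q)"
    have \<tau>: "\<tau> > 0" using C0 A'0 by (simp add: \<tau>_def)
    have \<tau>q: "\<tau> powr q = C0 powr q * A'"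
      using C0 A'0 q by (simp add: \<tau>_def powr_mult powr_powr)
    have IG0: "0 \<le> (\<integral>y. norm (G y) powr q \<partial>lebesgue)" by (intro Bochner_Integration.integral_nonneg) simp
    have "(\<integral>y. norm (G y) powr q \<partial>lebesgue) powr (1 / q) \<le> C0 * sobolev_norm q \<Omega> w"
      using U(3) unfolding sobolev_norm_def[of q UNIV] G_def[symmetric] set_lebesgue_integral_def by simp
    also have "\<dots> \<le> \<tau>"
      unfolding \<tau>_def sobolev_norm_def using C0 Iw Iw0 A' q
      by (intro mult_left_mono powr_mono2) auto
    finally have "((\<integral>y. norm (G y) powr q \<partial>lebesgue) powr (1 / q)) powr q \<le> \<tau> powr q"
      using q by (intro powr_mono2) auto
    then have \<tau>G: "(\<integral>y. norm (G y) powr q \<partial>lebesgue) \<le> \<tau> powr q"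
      using q IG0 by (simp add: powr_powr)
    have "\<bar>w z1 - w z2\<bar> \<le> morrey_const q * \<tau> * dist z1 z2 powr (1 - 2 / q)"
      by (rule Morrey_inequality[OF U1 wG G \<tau>G \<tau> q \<Omega> z contw U(2)])
    then have "\<bar>w z1 - w z2\<bar> powr q \<le> (morrey_const q * \<tau> * dist z1 z2 powr (1 - 2 / q)) powr q"
      using q by (intro powr_mono2) auto
    also have "\<dots> = morrey_const q powr q * \<tau> powr q * dist z1 z2 powr ((1 - 2 / q) * q)"
      using morrey_const_pos[OF q] \<tau> by (simp add: powr_mult powr_powr)
    also have "(1 - 2 / q) * q = q - 2" using q by (simp add: field_simps)
    also have "morrey_const q powr q * \<tau> powr q * dist z1 z2 powr (q - 2) = c * A'"
      using morrey_const_pos[OF q] C0 by (simp add: c_def \<tau>q powr_mult)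
    finally show ?thesis .
  qed
  have "\<bar>w z1 - w z2\<bar> powr q \<le> c * A + e" if e: "e > 0" for e
  proof -
    have "\<bar>w z1 - w z2\<bar> powr q \<le> c * (A + e / (c + 1))"
      using e c0 by (intro main) (simp add: add_nonneg_pos)
    also have "\<dots> \<le> c * A + e" using e c0 by (simp add: field_simps)
    finally show ?thesis .
  qed
  then show ?thesis unfolding c_def[symmetric] by (rule field_le_epsilon)
qed

subsection \<open>Packings and cutoff functions\<close>

text \<open>The elements with e at least half the maximum \<sigma> contribute at most N times
  \<open>\<sigma> powr \<gamma>\<close>; the others are fewer and bounded by \<sigma> / 2, so the
  induction sums a geometric series of ratio \<open>2 powr (- \<gamma>)\<close>.\<close>

lemma dyadic_sum_le:
  fixes e :: "'a \<Rightarrow> real"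
  assumes \<gamma>: "\<gamma> > 0"
  shows "finite P \<Longrightarrow> (\<And>p. p \<in> P \<Longrightarrow> 0 < e p \<and> e p \<le> \<rho>) \<Longrightarrow>
     (\<And>t. t > 0 \<Longrightarrow> real (card {p \<in> P. t \<le> e p \<and> e p \<le> 2 * t}) \<le> N) \<Longrightarrow>
     (\<Sum>p\<in>P. e p powr \<gamma>) \<le> N / (1 - 2 powr (- \<gamma>)) * \<rho> powr \<gamma>"
proof (induction "card P" arbitrary: P \<rho> rule: less_induct)
  case less
  have "2 powr (- \<gamma>) < (2::real) powr 0" using \<gamma> by (intro powr_less_mono) auto
  then have c: "1 - 2 powr (- \<gamma>) > (0::real)" by simp
  have N: "0 \<le> N" using less.prems(3)[of 1] by (meson of_nat_0_le_iff order_trans zero_less_one)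
  show ?case
  proof (cases "P = {}")
    case True
    then show ?thesis using N c by simp
  next
    case False
    define \<sigma> where "\<sigma> = Max (e ` P)"
    have "\<sigma> \<in> e ` P" unfolding \<sigma>_def using False less.prems(1) by (intro Max_in) auto
    then obtain p0 where p0: "p0 \<in> P" "e p0 = \<sigma>" by auto
    have le\<sigma>: "e p \<le> \<sigma>" if "p \<in> P" for p using that less.prems(1) by (simp add: \<sigma>_def)
    have \<sigma>: "0 < \<sigma>" "\<sigma> \<le> \<rho>" using less.prems(2)[OF p0(1)] p0(2) by auto
    define P1 where "P1 = {p \<in> P. \<sigma> / 2 \<le> e p}"
    define P2 where "P2 = {p \<in> P. e p < \<sigma> / 2}"
    have P12: "P = P1 \<union> P2" "P1 \<inter> P2 = {}" "finite P1" "finite P2"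
      using less.prems(1) by (auto simp: P1_def P2_def)
    have "p0 \<in> P1" using p0 \<sigma> by (auto simp: P1_def)
    then have "P2 \<subset> P" using P12 by blast
    then have lt: "card P2 < card P" using less.prems(1) by (rule psubset_card_mono[rotated])
    have "P1 = {p \<in> P. \<sigma> / 2 \<le> e p \<and> e p \<le> 2 * (\<sigma> / 2)}" using le\<sigma> by (auto simp: P1_def)
    then have cP1: "real (card P1) \<le> N" using less.prems(3)[of "\<sigma> / 2"] \<sigma> by simp
    have "(\<Sum>p\<in>P1. e p powr \<gamma>) \<le> real (card P1) * \<sigma> powr \<gamma>"
    proof (rule sum_bounded_above)
      fix p assume "p \<in> P1"
      then show "e p powr \<gamma> \<le> \<sigma> powr \<gamma>"
        using le\<sigma>[of p] less.prems(2)[of p] \<gamma> by (intro powr_mono2) (auto simp: P1_def)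
    qed
    also have "\<dots> \<le> N * \<sigma> powr \<gamma>" by (rule mult_right_mono[OF cP1]) simp
    finally have s1: "(\<Sum>p\<in>P1. e p powr \<gamma>) \<le> N * \<sigma> powr \<gamma>" .
    have s2: "(\<Sum>p\<in>P2. e p powr \<gamma>) \<le> N / (1 - 2 powr (- \<gamma>)) * (\<sigma> / 2) powr \<gamma>"
    proof (rule less.hyps[OF lt P12(4)])
      show "0 < e p \<and> e p \<le> \<sigma> / 2" if "p \<in> P2" for p
        using that less.prems(2) by (auto simp: P2_def)
      show "real (card {p \<in> P2. t \<le> e p \<and> e p \<le> 2 * t}) \<le> N" if "t > 0" for t
      proof -
        have "card {p \<in> P2. t \<le> e p \<and> e p \<le> 2 * t} \<le> card {p \<in> P. t \<le> e p \<and> e p \<le> 2 * t}"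
          using less.prems(1) by (intro card_mono) (auto simp: P2_def)
        then show ?thesis using less.prems(3)[OF that] by simp
      qed
    qed
    have "(\<Sum>p\<in>P. e p powr \<gamma>) = (\<Sum>p\<in>P1. e p powr \<gamma>) + (\<Sum>p\<in>P2. e p powr \<gamma>)"
      unfolding P12(1) by (rule sum.union_disjoint) (use P12 in auto)
    also have "\<dots> \<le> N * \<sigma> powr \<gamma> + N / (1 - 2 powr (- \<gamma>)) * (\<sigma> / 2) powr \<gamma>" using s1 s2 by simp
    also have "(\<sigma> / 2) powr \<gamma> = \<sigma> powr \<gamma> * 2 powr (- \<gamma>)"
      using \<sigma> by (simp add: powr_divide powr_minus_divide)
    also have "N * \<sigma> powr \<gamma> + N / (1 - 2 powr (- \<gamma>)) * (\<sigma> powr \<gamma> * 2 powr (- \<gamma>)) =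
        N / (1 - 2 powr (- \<gamma>)) * \<sigma> powr \<gamma>"
    proof -
      define b where "b = 2 powr (- \<gamma>)"
      have "1 - b \<noteq> 0" using c unfolding b_def by linarith
      then have "N * \<sigma> powr \<gamma> + N / (1 - b) * (\<sigma> powr \<gamma> * b) = N / (1 - b) * \<sigma> powr \<gamma>"
        by (simp add: divide_simps) (simp add: algebra_simps)
      then show ?thesis by (simp add: b_def)
    qed
    also have "\<dots> \<le> N / (1 - 2 powr (- \<gamma>)) * \<rho> powr \<gamma>"
      using \<sigma> \<gamma> N c by (intro mult_left_mono powr_mono2) auto
    finally show ?thesis .
  qed
qed

text \<open>The discs of radius \<open>t / 9\<close> lie in a disc of radius \<open>13 t\<close>, and \<open>117 = 9 \<cdot> 13\<close>.\<close>

lemma card_packing_le: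
  fixes P :: "complex set"
  assumes "finite P" and t: "t > 0" and P: "\<And>p. p \<in> P \<Longrightarrow> t \<le> d p \<and> d p \<le> 2 * t \<and> dist x p \<le> 6 * d p"
    and disj: "disjoint_family_on (\<lambda>p. ball p (d p / 9)) P"
  shows "real (card P) \<le> 117\<^sup>2"
proof -
  have sub: "ball p (t / 9) \<subseteq> ball p (d p / 9)" if "p \<in> P" for p using P[OF that] by auto
  have "(\<Sum>p\<in>P. measure lebesgue (ball p (t / 9))) = measure lebesgue (\<Union>p\<in>P. ball p (t / 9))"
  proof (rule measure_finite_Union[symmetric])
    show "disjoint_family_on (\<lambda>p. ball p (t / 9)) P"
      using disj sub unfolding disjoint_family_on_def by blast
    show "emeasure lebesgue (ball p (t / 9)) \<noteq> \<infinity>" for p :: complex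
      using lmeasurable_ball[of p "t / 9"] unfolding fmeasurable_def by auto
  qed (use \<open>finite P\<close> in auto)
  also have "\<dots> \<le> measure lebesgue (ball x (13 * t))"
  proof (rule measure_mono_fmeasurable)
    \<comment> \<open>A centre p is at distance at most 6 d p <= 12 t from x.\<close>
    show "(\<Union>p\<in>P. ball p (t / 9)) \<subseteq> ball x (13 * t)"
    proof (intro UN_least subsetI)
      fix p y assume "p \<in> P" "y \<in> ball p (t / 9)"
      then show "y \<in> ball x (13 * t)" using P[of p] t dist_triangle[of x y p] by auto
    qed
    show "(\<Union>p\<in>P. ball p (t / 9)) \<in> sets lebesgue"
      using \<open>finite P\<close> by (intro sets.finite_UN) auto
  qed auto
  finally have "real (card P) * (pi * (t / 9)\<^sup>2) \<le> pi * (13 * t)\<^sup>2"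
    using t by (simp add: measure_ball_complex)
  also have "\<dots> = 117\<^sup>2 * (pi * (t / 9)\<^sup>2)" by (simp add: power2_eq_square)
  finally show ?thesis using t by (simp add: mult_le_cancel_right)
qed

text \<open>Positive powers are governed by the largest radius, negative powers by the smallest. The
  second claim uses the inverse radii, whose dyadic classes are again dyadic classes of
  radii.\<close>

lemma packing_sum_powr_le:
  fixes P :: "complex set"
  assumes "finite P" and P: "\<And>p. p \<in> P \<Longrightarrow> 0 < d p \<and> dist x p \<le> 6 * d p"
    and disj: "disjoint_family_on (\<lambda>p. ball p (d p / 9)) P"
  shows "\<gamma> > 0 \<Longrightarrow> (\<And>p. p \<in> P \<Longrightarrow> d p \<le> \<rho>) \<Longrightarrow>
      (\<Sum>p\<in>P. d p powr \<gamma>) \<le> 117\<^sup>2 / (1 - 2 powr (- \<gamma>)) * \<rho> powr \<gamma>"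
    and "\<gamma> > 0 \<Longrightarrow> (\<And>p. p \<in> P \<Longrightarrow> \<rho> \<le> d p) \<Longrightarrow> \<rho> > 0 \<Longrightarrow>
      (\<Sum>p\<in>P. d p powr (- \<gamma>)) \<le> 117\<^sup>2 / (1 - 2 powr (- \<gamma>)) * \<rho> powr (- \<gamma>)"
proof -
  have card: "real (card {p \<in> P. t \<le> d p \<and> d p \<le> 2 * t}) \<le> 117\<^sup>2" if "t > 0" for t
    by (rule card_packing_le[OF _ that, where d = d and x = x])
       (use assms in \<open>auto simp: disjoint_family_on_def\<close>)
  show "(\<Sum>p\<in>P. d p powr \<gamma>) \<le> 117\<^sup>2 / (1 - 2 powr (- \<gamma>)) * \<rho> powr \<gamma>"
    if "\<gamma> > 0" "\<And>p. p \<in> P \<Longrightarrow> d p \<le> \<rho>"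
    by (rule dyadic_sum_le) (use assms that card in auto)
  show "(\<Sum>p\<in>P. d p powr (- \<gamma>)) \<le> 117\<^sup>2 / (1 - 2 powr (- \<gamma>)) * \<rho> powr (- \<gamma>)"
    if \<rho>: "\<gamma> > 0" "\<And>p. p \<in> P \<Longrightarrow> \<rho> \<le> d p" "\<rho> > 0"
  proof -
    have "(\<Sum>p\<in>P. inverse (d p) powr \<gamma>) \<le> 117\<^sup>2 / (1 - 2 powr (- \<gamma>)) * inverse \<rho> powr \<gamma>"
    proof (rule dyadic_sum_le[OF \<rho>(1) \<open>finite P\<close>])
      show "0 < inverse (d p) \<and> inverse (d p) \<le> inverse \<rho>" if "p \<in> P" for p
        using P[OF that] \<rho>(2)[OF that] \<rho>(3) by (simp add: le_imp_inverse_le)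
      fix t :: real assume t: "t > 0"
      have "{p \<in> P. t \<le> inverse (d p) \<and> inverse (d p) \<le> 2 * t} =
          {p \<in> P. inverse (2 * t) \<le> d p \<and> d p \<le> 2 * inverse (2 * t)}"
        using P t by (force simp: field_simps)
      then show "real (card {p \<in> P. t \<le> inverse (d p) \<and> inverse (d p) \<le> 2 * t}) \<le> 117\<^sup>2"
        using card[of "inverse (2 * t)"] t by simp
    qed
    moreover have "inverse x powr \<gamma> = x powr (- \<gamma>)" if "x > 0" for x :: real
      using that by (simp add: powr_minus powr_divide inverse_eq_divide)
    ultimately show ?thesis using P \<rho>(3) by simp
  qed
qed

text \<open>The sum is comparable to its largest term, attained at the smallest radius, so taking
  the q-th power costs only a constant however many scales are present. This stands in for a bounded
  overlap of the discs.\<close>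

lemma packing_powr_sum_le_sum_powr:
  fixes P :: "complex set"
  assumes "finite P" and P: "\<And>p. p \<in> P \<Longrightarrow> 0 < d p \<and> dist x p \<le> 6 * d p"
    and disj: "disjoint_family_on (\<lambda>p. ball p (d p / 9)) P"
    and \<gamma>: "\<gamma> > 0" and q: "q > 0"
  shows "(\<Sum>p\<in>P. d p powr (- \<gamma>)) powr q \<le> (117\<^sup>2 / (1 - 2 powr (- \<gamma>))) powr q * (\<Sum>p\<in>P. (d p powr (- \<gamma>)) powr q)"
proof (cases "P = {}")
  case False
  define \<rho> where "\<rho> = Min (d ` P)"
  have "\<rho> \<in> d ` P" unfolding \<rho>_def using False \<open>finite P\<close> by (intro Min_in) auto
  then obtain p0 where p0: "p0 \<in> P" "d p0 = \<rho>" by auto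
  have \<rho>: "\<rho> > 0" "\<And>p. p \<in> P \<Longrightarrow> \<rho> \<le> d p" using P[OF p0(1)] p0(2) \<open>finite P\<close> by (auto simp: \<rho>_def)
  let ?c = "117\<^sup>2 / (1 - 2 powr (- \<gamma>)) :: real"
  have "2 powr (- \<gamma>) < (2::real) powr 0" using \<gamma> by (intro powr_less_mono) auto
  then have c: "?c \<ge> 0" by simp
  have "(\<Sum>p\<in>P. d p powr (- \<gamma>)) powr q \<le> (?c * \<rho> powr (- \<gamma>)) powr q"
    using packing_sum_powr_le(2)[OF assms(1-3) \<gamma> \<rho>(2,1)] q by (intro powr_mono2) (auto intro: sum_nonneg)
  also have "\<dots> = ?c powr q * (d p0 powr (- \<gamma>)) powr q" using c by (simp only: powr_mult p0 powr_ge_zero)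
  also have "\<dots> \<le> ?c powr q * (\<Sum>p\<in>P. (d p powr (- \<gamma>)) powr q)"
    using p0 \<open>finite P\<close> by (intro mult_left_mono member_le_sum) auto
  finally show ?thesis .
qed simp

section \<open>Cutoff functions and gluing across components\<close>

text \<open>With s = (|z - p|^2 / r^2 - 1) / 3, which is 0 on the circle of radius r and 1 on that
  of radius 2 r, the profile is 0 for s <= 0 and 1 for s >= 1. Squares of positive parts are C^1,
  the regularity that \<open>C1_gradient\<close> asks for.\<close>

definition cutoff :: "complex \<Rightarrow> real \<Rightarrow> complex \<Rightarrow> real" where
  "cutoff p r z = 1 - (max 0 (1 - (max 0 (((z - p) \<bullet> (z - p) / r\<^sup>2 - 1) / 3))\<^sup>2))\<^sup>2"

definition cutoff_grad :: "complex \<Rightarrow> real \<Rightarrow> complex \<Rightarrow> complex" where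
  "cutoff_grad p r z =
     (let s = ((z - p) \<bullet> (z - p) / r\<^sup>2 - 1) / 3
      in (2 * max 0 (1 - (max 0 s)\<^sup>2) * (2 * max 0 s) * (2 / (3 * r\<^sup>2))) *\<^sub>R (z - p))"

lemma DERIV_max_0_square: "((\<lambda>t::real. (max 0 t)\<^sup>2) has_real_derivative 2 * max 0 t) (at t)"
proof -
  consider "t > 0" | "t < 0" | "t = 0" by linarith
  then show ?thesis
  proof cases
    case 1
    have "((\<lambda>t::real. t\<^sup>2) has_real_derivative 2 * t) (at t)" by (auto intro!: derivative_eq_intros)
    then have "((\<lambda>t::real. (max 0 t)\<^sup>2) has_real_derivative 2 * t) (at t)"
      by (rule has_field_derivative_transform_within_open[where S = "{0<..}"]) (use 1 in auto)
    then show ?thesis using 1 by simp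
  next
    case 2
    have "((\<lambda>t::real. 0) has_real_derivative 0) (at t)" by simp
    then have "((\<lambda>t::real. (max 0 t)\<^sup>2) has_real_derivative 0) (at t)"
      by (rule has_field_derivative_transform_within_open[where S = "{..<0}"]) (use 2 in auto)
    then show ?thesis using 2 by simp
  next
    case 3
    have "((\<lambda>h::real. max 0 h) \<longlongrightarrow> max 0 0) (at 0)" by (intro tendsto_intros)
    moreover have "eventually (\<lambda>h::real. max 0 h = ((max 0 (0 + h))\<^sup>2 - (max 0 0)\<^sup>2) / h) (at 0)"
      by (rule eventually_at_filter[THEN iffD2], rule always_eventually) (auto simp: max_def power2_eq_square)
    ultimately show ?thesis unfolding 3 DERIV_def by (simp add: filterlim_cong)
  qed
qed

lemma C1_gradient_cutoff:
  assumes r: "r > 0" shows "C1_gradient S (cutoff p r) (cutoff_grad p r)"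
  unfolding C1_gradient_def
proof (intro conjI ballI)
  show "continuous_on S (cutoff_grad p r)"
    unfolding cutoff_grad_def Let_def using r by (auto intro!: continuous_intros)
  fix z
  define s where "s = (\<lambda>z. ((z - p) \<bullet> (z - p) / r\<^sup>2 - 1) / 3)"
  have "((\<lambda>z. (z - p) \<bullet> (z - p)) has_derivative (\<lambda>h. 2 * ((z - p) \<bullet> h))) (at z)"
    by (auto intro!: derivative_eq_intros simp: inner_commute)
  from has_derivative_mult_right[OF has_derivative_diff[OF has_derivative_mult_right[OF this, of "1 / r\<^sup>2"] has_derivative_const[of 1]], of "1/3"]
  have ds: "(s has_derivative (\<lambda>h. 2 / (3 * r\<^sup>2) * ((z - p) \<bullet> h))) (at z)"
    unfolding s_def by (simp add: mult_ac)
  note sq = has_field_derivative_imp_has_derivative[OF DERIV_max_0_square]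
  have 1: "((\<lambda>z. (max 0 (s z))\<^sup>2) has_derivative (\<lambda>h. 2 * max 0 (s z) * (2 / (3 * r\<^sup>2) * ((z - p) \<bullet> h)))) (at z)"
    using has_derivative_compose[OF ds sq] .
  have 2: "((\<lambda>z. 1 - (max 0 (s z))\<^sup>2) has_derivative (\<lambda>h. - (2 * max 0 (s z) * (2 / (3 * r\<^sup>2) * ((z - p) \<bullet> h))))) (at z)"
    using has_derivative_diff[OF has_derivative_const[of 1] 1] by simp
  have 3: "((\<lambda>z. (max 0 (1 - (max 0 (s z))\<^sup>2))\<^sup>2) has_derivative
     (\<lambda>h. 2 * max 0 (1 - (max 0 (s z))\<^sup>2) * - (2 * max 0 (s z) * (2 / (3 * r\<^sup>2) * ((z - p) \<bullet> h))))) (at z)"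
    using has_derivative_compose[OF 2 sq] .
  have "(cutoff p r has_derivative
     (\<lambda>h. - (2 * max 0 (1 - (max 0 (s z))\<^sup>2) * - (2 * max 0 (s z) * (2 / (3 * r\<^sup>2) * ((z - p) \<bullet> h)))))) (at z)"
    using has_derivative_diff[OF has_derivative_const[of 1] 3] by (simp add: cutoff_def[abs_def] s_def)
  moreover have "(\<lambda>h. - (2 * max 0 (1 - (max 0 (s z))\<^sup>2) * - (2 * max 0 (s z) * (2 / (3 * r\<^sup>2) * ((z - p) \<bullet> h))))) =
      (\<lambda>v. cutoff_grad p r z \<bullet> v)"
    by (auto simp: fun_eq_iff cutoff_grad_def Let_def s_def mult_ac)
  ultimately show "(cutoff p r has_derivative (\<lambda>v. cutoff_grad p r z \<bullet> v)) (at z)" by simp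
qed

lemma cutoff_range: "0 \<le> cutoff p r z" "cutoff p r z \<le> 1"
proof -
  have "\<bar>max 0 (1 - (max 0 (((z - p) \<bullet> (z - p) / r\<^sup>2 - 1) / 3))\<^sup>2)\<bar> \<le> 1" by simp
  then show "0 \<le> cutoff p r z" unfolding cutoff_def by (simp add: abs_square_le_1)
qed (simp add: cutoff_def)

lemma
  assumes r: "r > 0" and z: "dist p z \<le> r"
  shows cutoff_eq_0: "cutoff p r z = 0" and cutoff_grad_eq_0_inside: "cutoff_grad p r z = 0"
proof -
  have "(norm (z - p))\<^sup>2 \<le> r\<^sup>2" using z r by (intro power_mono) (auto simp: dist_norm norm_minus_commute)
  then have "((z - p) \<bullet> (z - p) / r\<^sup>2 - 1) / 3 \<le> 0" using r by (simp add: dot_square_norm)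
  then show "cutoff p r z = 0" "cutoff_grad p r z = 0" by (simp_all add: cutoff_def cutoff_grad_def max_absorb1)
qed

lemma
  assumes r: "r > 0" and z: "dist p z \<ge> 2 * r"
  shows cutoff_eq_1: "cutoff p r z = 1" and cutoff_grad_eq_0_outside: "cutoff_grad p r z = 0"
proof -
  define s where "s = ((z - p) \<bullet> (z - p) / r\<^sup>2 - 1) / 3"
  have "(2 * r)\<^sup>2 \<le> (norm (z - p))\<^sup>2" using z r by (intro power_mono) (auto simp: dist_norm norm_minus_commute)
  then have "s \<ge> 1" using r by (simp add: s_def dot_square_norm field_simps)
  then have "1 - (max 0 s)\<^sup>2 \<le> 0" by simp
  then show "cutoff p r z = 1" "cutoff_grad p r z = 0"
    by (simp_all add: cutoff_def cutoff_grad_def s_def[symmetric] max_absorb1 Let_def)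
qed

text \<open>The product of the bounds of the factors is 16 / (3 r); 6 is a round upper
  bound.\<close>

lemma norm_cutoff_grad_le:
  assumes r: "r > 0"
  shows "norm (cutoff_grad p r z) \<le> 6 / r * indicator (ball p (2 * r)) z"
proof (cases "dist p z < 2 * r")
  case True
  define s where "s = ((z - p) \<bullet> (z - p) / r\<^sup>2 - 1) / 3"
  have zp: "norm (z - p) \<le> 2 * r" using True by (simp add: dist_norm norm_minus_commute)
  then have "(norm (z - p))\<^sup>2 \<le> (2 * r)\<^sup>2" by (intro power_mono) auto
  then have s: "s \<le> 1" using r by (simp add: s_def dot_square_norm field_simps)
  have "norm (cutoff_grad p r z) = 2 * max 0 (1 - (max 0 s)\<^sup>2) * (2 * max 0 s) * (2 / (3 * r\<^sup>2)) * norm (z - p)"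
    using r by (simp add: cutoff_grad_def Let_def s_def[symmetric] abs_mult)
  also have "\<dots> \<le> 2 * 1 * (2 * 1) * (2 / (3 * r\<^sup>2)) * (2 * r)"
    using s r zp by (intro mult_mono) auto
  also have "\<dots> \<le> 6 / r" using r by (simp add: field_simps power2_eq_square)
  finally show ?thesis using True by simp
qed (simp add: cutoff_grad_eq_0_outside[OF r])

lemma C1_gradient_mult:
  "C1_gradient S u f \<Longrightarrow> C1_gradient S v g \<Longrightarrow>
     C1_gradient S (\<lambda>z. u z * v z) (\<lambda>z. u z *\<^sub>R g z + v z *\<^sub>R f z)"
  using C1_gradient_imp_continuous_on[of S u f] C1_gradient_imp_continuous_on[of S v g]
  unfolding C1_gradient_def
  by (auto intro!: continuous_intros derivative_eq_intros simp: fun_eq_iff inner_add_left algebra_simps)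

lemma C1_gradient_sum:
  "finite I \<Longrightarrow> (\<And>i. i \<in> I \<Longrightarrow> C1_gradient S (u i) (g i)) \<Longrightarrow>
     C1_gradient S (\<lambda>z. \<Sum>i\<in>I. a i * u i z) (\<lambda>z. \<Sum>i\<in>I. a i *\<^sub>R g i z)"
  unfolding C1_gradient_def
  by (auto intro!: continuous_intros derivative_eq_intros simp: fun_eq_iff inner_sum_left)

lemma C1_gradient_one_minus: "C1_gradient S u g \<Longrightarrow> C1_gradient S (\<lambda>z. 1 - u z) (\<lambda>z. - g z)"
  unfolding C1_gradient_def
  by (auto intro!: continuous_intros derivative_eq_intros simp: fun_eq_iff)

text \<open>For functions that jump between components. Points of \<Omega> on the boundary of V do
  no harm because u already vanishes on the part of V close to them.\<close>

lemma C1_gradient_restrict: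
  assumes u: "C1_gradient UNIV u (g :: complex \<Rightarrow> complex)" and V: "open V"
    and loc: "\<And>z. z \<in> \<Omega> - V \<Longrightarrow> \<exists>S. open S \<and> z \<in> S \<and> (\<forall>y\<in>S \<inter> V. u y = 0 \<and> g y = 0)"
  shows "C1_gradient \<Omega> (\<lambda>z. if z \<in> V then u z else 0) (\<lambda>z. if z \<in> V then g z else 0)"
proof -
  let ?u = "\<lambda>z. if z \<in> V then u z else 0" and ?g = "\<lambda>z. if z \<in> V then g z else 0"
  have du: "(u has_derivative (\<lambda>v. g z \<bullet> v)) (at z)" and cg: "isCont g z" for z
    using u by (auto simp: C1_gradient_def continuous_on_eq_continuous_at)
  have "(?u has_derivative (\<lambda>v. ?g z \<bullet> v)) (at z) \<and> isCont ?g z" if z: "z \<in> \<Omega>" for z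
  proof (cases "z \<in> V")
    case True
    have "(?u has_derivative (\<lambda>v. g z \<bullet> v)) (at z)"
      by (rule has_derivative_transform_within_open[OF du V True]) simp
    moreover have "isCont ?g z"
    proof -
      have "eventually (\<lambda>y. ?g y = g y) (nhds z)"
        unfolding eventually_nhds using V True by (intro exI[of _ V]) auto
      then have "isCont ?g z \<longleftrightarrow> isCont g z" by (rule isCont_cong)
      then show ?thesis using cg by simp
    qed
    ultimately show ?thesis using True by simp
  next
    case False
    then obtain S where S: "open S" "z \<in> S" "\<forall>y\<in>S \<inter> V. u y = 0 \<and> g y = 0" using loc z by blast
    have "(?u has_derivative (\<lambda>v. 0)) (at z)"
      by (rule has_derivative_transform_within_open[OF has_derivative_const S(1,2)]) (use S(3) in auto)
    moreover have "isCont ?g z"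
    proof -
      have "eventually (\<lambda>y. ?g y = 0) (nhds z)"
        unfolding eventually_nhds using S by (intro exI[of _ S]) auto
      then have "isCont ?g z \<longleftrightarrow> isCont (\<lambda>_. 0 :: complex) z" by (rule isCont_cong)
      then show ?thesis by simp
    qed
    ultimately show ?thesis using False by simp
  qed
  then show ?thesis by (simp add: C1_gradient_def continuous_at_imp_continuous_on)
qed

subsection \<open>Consequences of the extension property\<close>

lemma powr_add_le:
  fixes x y q :: real
  assumes "0 \<le> x" "0 \<le> y" "0 < q"
  shows "(x + y) powr q \<le> 2 powr q * (x powr q + y powr q)"
proof -
  have "(x + y) powr q \<le> (2 * max x y) powr q" using assms by (intro powr_mono2) auto
  also have "\<dots> = 2 powr q * (max x y) powr q" using assms by (simp add: powr_mult)
  also have "(max x y) powr q \<le> x powr q + y powr q" by (cases "x \<le> y") (simp_all add: max_def)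
  finally show ?thesis by simp
qed

text \<open>An integrable majorant H yields both the integrability of the q-th power of the gradient
  and the energy bound, so the later estimates reduce to pointwise ones.\<close>

lemma Hoelder_dominated:
  fixes \<Omega> :: "complex set"
  assumes q: "2 < q" and \<Omega>: "open \<Omega>" and E: "sobolev_extension_operator q C0 \<Omega> E"
    and w: "C1_gradient \<Omega> w g" and H: "integrable lebesgue H"
    and gH: "\<And>z. z \<in> \<Omega> \<Longrightarrow> norm (g z) powr q \<le> H z" and H0: "\<And>z. 0 \<le> H z" and z: "z1 \<in> \<Omega>" "z2 \<in> \<Omega>"
  shows "\<bar>w z1 - w z2\<bar> powr q \<le> (morrey_const q * C0) powr q * dist z1 z2 powr (q - 2) * (\<integral>z. H z \<partial>lebesgue)"
proof (rule extension_operator_Hoelder[OF q \<Omega> E w _ _ z])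
  have cg: "continuous_on \<Omega> g" using w by (simp add: C1_gradient_def)
  then have "continuous_on \<Omega> (\<lambda>z. norm (g z) powr q)"
    using q by (intro continuous_on_powr' continuous_intros) auto
  from borel_measurable_continuous_on_indicator[OF _ this]
  have m: "(\<lambda>z. indicator \<Omega> z *\<^sub>R norm (g z) powr q) \<in> borel_measurable lebesgue"
    using \<Omega> by (intro measurable_completion) simp
  have le: "norm (indicator \<Omega> z *\<^sub>R norm (g z) powr q) \<le> H z" for z
    using gH[of z] H0[of z] by (simp add: indicator_def)
  show i: "set_integrable lebesgue \<Omega> (\<lambda>z. norm (g z) powr q)"
    unfolding set_integrable_def
    by (rule Bochner_Integration.integrable_bound[OF H m])
       (use le H0 in \<open>auto intro!: always_eventually simp: abs_of_nonneg\<close>)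
  show "(LINT x:\<Omega>|lebesgue. norm (g x) powr q) \<le> (\<integral>z. H z \<partial>lebesgue)"
    using i H le unfolding set_lebesgue_integral_def set_integrable_def
    by (intro integral_mono) (auto intro: order_trans[OF abs_ge_self])
qed

lemma integrable_indicator_ball: "integrable lebesgue (indicator (ball (x::complex) r) :: complex \<Rightarrow> real)"
  by (simp add: lmeasurable_iff_integrable[symmetric])

text \<open>If the truncation separates z1 from z2, then 1 - \<open>cutoff\<close>, kept on the
  component of z2 only, jumps by 1 with gradient at most 6 / r0 on a disc of radius 2 r0. Its energy
  is of order \<open>r0 powr (2 - q)\<close>, so a large r0 will rule this case out.\<close>

lemma component_cutoff_estimate:
  fixes \<Omega> :: "complex set"
  assumes q: "2 < q" and \<Omega>: "open \<Omega>" and E: "sobolev_extension_operator q C0 \<Omega> E"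
    and z: "z1 \<in> \<Omega>" "z2 \<in> \<Omega>" and r0: "r0 > 0" "dist z1 z2 \<le> r0"
    and nc: "\<not> connected_component (\<Omega> \<inter> ball z1 (3 * r0)) z1 z2"
  shows "1 \<le> (morrey_const q * C0) powr q * dist z1 z2 powr (q - 2) * ((6 / r0) powr q * (4 * pi * r0\<^sup>2))"
proof -
  define W where "W = \<Omega> \<inter> ball z1 (3 * r0)"
  define V where "V = connected_component_set W z2"
  define \<psi> where "\<psi> = (\<lambda>z. 1 - cutoff z1 r0 z)"
  define g\<psi> where "g\<psi> = (\<lambda>z. - cutoff_grad z1 r0 z)"
  have oW: "open W" using \<Omega> by (simp add: W_def open_Int)
  have oV: "open V" using oW unfolding V_def by (rule open_connected_component)
  have C1: "C1_gradient UNIV \<psi> g\<psi>"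
    unfolding \<psi>_def g\<psi>_def by (intro C1_gradient_one_minus C1_gradient_cutoff r0)
  have far: "\<psi> y = 0" "g\<psi> y = 0" if "2 * r0 \<le> dist z1 y" for y
    using cutoff_eq_1[OF r0(1) that] cutoff_grad_eq_0_outside[OF r0(1) that] by (simp_all add: \<psi>_def g\<psi>_def)
  have zW: "z1 \<in> W" "z2 \<in> W" using z r0 by (auto simp: W_def)
  have zV: "z2 \<in> V" "z1 \<notin> V"
    using zW nc by (auto simp: V_def W_def connected_component_eq_empty intro: connected_component_sym)
  have C1V: "C1_gradient \<Omega> (\<lambda>z. if z \<in> V then \<psi> z else 0) (\<lambda>z. if z \<in> V then g\<psi> z else 0)"
  proof (rule C1_gradient_restrict[OF C1 oV])
    fix z assume z: "z \<in> \<Omega> - V"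
    \<comment> \<open>Beyond 2 r0 the function \<psi> vanishes; otherwise z lies in W, hence in a
      component of W other than V.\<close>
    show "\<exists>S. open S \<and> z \<in> S \<and> (\<forall>y\<in>S \<inter> V. \<psi> y = 0 \<and> g\<psi> y = 0)"
    proof (cases "dist z1 z > 2 * r0")
      case True
      then show ?thesis using far
        by (intro exI[of _ "- cball z1 (2 * r0)"]) auto
    next
      case False
      then have "z \<in> W" using z r0 by (auto simp: W_def)
      then show ?thesis using z oW
        by (intro exI[of _ "connected_component_set W z"])
           (auto simp: V_def open_connected_component dest: connected_component_trans connected_component_sym)
    qed
  qed
  let ?H = "\<lambda>z. (6 / r0) powr q * indicator (ball z1 (2 * r0)) z"
  have main: "\<bar>(if z1 \<in> V then \<psi> z1 else 0) - (if z2 \<in> V then \<psi> z2 else 0)\<bar> powr q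
      \<le> (morrey_const q * C0) powr q * dist z1 z2 powr (q - 2) * (\<integral>z. ?H z \<partial>lebesgue)"
  proof (rule Hoelder_dominated[OF q \<Omega> E C1V _ _ _ z])
    show "integrable lebesgue ?H" using integrable_indicator_ball by simp
    show "norm (if z \<in> V then g\<psi> z else 0) powr q \<le> ?H z" for z
    proof -
      have "norm (if z \<in> V then g\<psi> z else 0) \<le> 6 / r0 * indicator (ball z1 (2 * r0)) z"
        using norm_cutoff_grad_le[OF r0(1), of z1 z] r0 by (auto simp: g\<psi>_def indicator_def)
      then have "norm (if z \<in> V then g\<psi> z else 0) powr q \<le> (6 / r0 * indicator (ball z1 (2 * r0)) z) powr q"
        using q by (intro powr_mono2) auto
      also have "\<dots> = ?H z" using q by (simp add: indicator_def)
      finally show ?thesis .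
    qed
  qed (use r0 in auto)
  have "\<psi> z2 = 1" using cutoff_eq_0[OF r0] by (simp add: \<psi>_def)
  moreover have I: "(\<integral>z. ?H z \<partial>lebesgue) = (6 / r0) powr q * (4 * pi * r0\<^sup>2)"
    using r0 by (simp add: measure_ball_complex power_mult_distrib)
  ultimately show ?thesis using main zV unfolding I by simp
qed

text \<open>Each separating disc carries one slice: the indicator of the component of z2 in W minus
  the disc of radius 2 d, smoothed near that disc by \<kappa> and towards the rim of the large disc
  by \<psi>. It is 0 at z1 and 1 at z2. In the weighted sum the gradients of \<kappa> have energy of
  order S; those of \<psi> give the term with S^q, the truncation error.\<close>

lemma slice_sum_estimate:
  fixes \<Omega> :: "complex set" and q :: real
  defines "\<alpha> \<equiv> (q - 2) / (q - 1)" and "Cp \<equiv> 117\<^sup>2 / (1 - 2 powr (- (1 / (q - 1))))"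
  assumes q: "2 < q" and \<Omega>: "open \<Omega>" and E: "sobolev_extension_operator q C0 \<Omega> E"
    and z: "z1 \<in> \<Omega>" "z2 \<in> \<Omega>" and r0: "r0 > 0" "dist z1 z2 \<le> r0"
    and W: "W = \<Omega> \<inter> ball z1 (3 * r0)"
    and P: "finite P" "\<And>p. p \<in> P \<Longrightarrow> 0 < d p \<and> 6 * d p \<le> dist p z1 \<and> 6 * d p \<le> dist p z2 \<and>
              \<not> connected_component (W - cball p (2 * d p)) z1 z2"
    and disj: "disjoint_family_on (\<lambda>p. ball p (d p / 9)) P"
  shows "(\<Sum>p\<in>P. d p powr \<alpha>) powr q \<le> (morrey_const q * C0) powr q * dist z1 z2 powr (q - 2) *
    (2 powr q * ((2 * Cp) powr q * (36 * pi * (\<Sum>p\<in>P. d p powr \<alpha>)) +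
        (\<Sum>p\<in>P. d p powr \<alpha>) powr q * ((6 / r0) powr q * (4 * pi * r0\<^sup>2))))"
proof -
  define S where "S = (\<Sum>p\<in>P. d p powr \<alpha>)"
  have S0: "0 \<le> S" by (auto simp: S_def intro: sum_nonneg)
  define \<gamma> where "\<gamma> = 1 / (q - 1)"
  have \<gamma>: "\<gamma> > 0" "\<alpha> - 1 = - \<gamma>" using q by (simp_all add: \<gamma>_def \<alpha>_def field_simps)
  define V where "V = (\<lambda>p. connected_component_set (W - cball p (2 * d p)) z2)"
  define \<psi> where "\<psi> = (\<lambda>z. 1 - cutoff z1 r0 z)"
  define g\<psi> where "g\<psi> = (\<lambda>z. - cutoff_grad z1 r0 z)"
  define \<kappa> where "\<kappa> = (\<lambda>p. cutoff p (3 * d p))"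
  define g\<kappa> where "g\<kappa> = (\<lambda>p. cutoff_grad p (3 * d p))"
  define \<phi> where "\<phi> = (\<lambda>p z. \<psi> z * \<kappa> p z)"
  define g\<phi> where "g\<phi> = (\<lambda>p z. \<psi> z *\<^sub>R g\<kappa> p z + \<kappa> p z *\<^sub>R g\<psi> z)"
  have oW: "open W" using \<Omega> by (simp add: W open_Int)
  have oV: "open (V p)" for p
    using oW unfolding V_def by (intro open_connected_component) (simp add: open_Diff)
  have dp: "3 * d p > 0" if "p \<in> P" for p using P(2)[OF that] by simp
  have C1: "C1_gradient UNIV (\<phi> p) (g\<phi> p)" if "p \<in> P" for p
    unfolding \<phi>_def g\<phi>_def \<psi>_def g\<psi>_def \<kappa>_def g\<kappa>_def
    by (intro C1_gradient_mult C1_gradient_one_minus C1_gradient_cutoff r0 dp that)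
  have far: "\<psi> y = 0" "g\<psi> y = 0" if "2 * r0 \<le> dist z1 y" for y
    using cutoff_eq_1[OF r0(1) that] cutoff_grad_eq_0_outside[OF r0(1) that] by (simp_all add: \<psi>_def g\<psi>_def)
  have near: "\<kappa> p y = 0" "g\<kappa> p y = 0" if "p \<in> P" "dist p y \<le> 3 * d p" for p y
    using cutoff_eq_0[OF dp[OF that(1)] that(2)] cutoff_grad_eq_0_inside[OF dp[OF that(1)] that(2)]
    by (simp_all add: \<kappa>_def g\<kappa>_def)
  have zW: "z1 \<in> W" "z2 \<in> W" using z r0 by (auto simp: W)
  have zV: "z2 \<in> V p" "z1 \<notin> V p" if "p \<in> P" for p
  proof -
    have "z2 \<in> W - cball p (2 * d p)" using zW P(2)[OF that] by auto
    then show "z2 \<in> V p" by (simp add: V_def)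
    show "z1 \<notin> V p" using P(2)[OF that] connected_component_sym by (auto simp: V_def)
  qed
  define u where "u = (\<lambda>p z. if z \<in> V p then \<phi> p z else 0)"
  define gu where "gu = (\<lambda>p z. if z \<in> V p then g\<phi> p z else 0)"
  have C1u: "C1_gradient \<Omega> (u p) (gu p)" if p: "p \<in> P" for p
    unfolding u_def gu_def
  proof (rule C1_gradient_restrict[OF C1[OF p] oV])
    fix z assume z: "z \<in> \<Omega> - V p"
    \<comment> \<open>Either z is beyond the support of \<psi>, or \<kappa> vanishes around z, or z
      lies in another component of W minus the closed disc. The gap between the radii 2 d and 3 d
      gives points of the closed disc an open neighbourhood on which \<kappa> vanishes.\<close>
    consider "dist z1 z > 2 * r0" | "dist p z < 3 * d p" | "z \<in> W - cball p (2 * d p)"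
      using z r0 P(2)[OF p] by (force simp: W)
    then show "\<exists>S. open S \<and> z \<in> S \<and> (\<forall>y\<in>S \<inter> V p. \<phi> p y = 0 \<and> g\<phi> p y = 0)"
    proof cases
      case 1
      then show ?thesis using far
        by (intro exI[of _ "- cball z1 (2 * r0)"]) (auto simp: \<phi>_def g\<phi>_def)
    next
      case 2
      then show ?thesis using near[OF p]
        by (intro exI[of _ "ball p (3 * d p)"]) (auto simp: \<phi>_def g\<phi>_def)
    next
      case 3
      have "V p \<inter> connected_component_set (W - cball p (2 * d p)) z = {}"
        using z 3 connected_component_sym unfolding V_def by (subst connected_component_disjoint) auto
      then show ?thesis using 3 oW
        by (intro exI[of _ "connected_component_set (W - cball p (2 * d p)) z"])
           (auto simp: open_connected_component open_Diff)
    qed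
  qed
  define w where "w = (\<lambda>z. \<Sum>p\<in>P. d p powr \<alpha> * u p z)"
  define gw where "gw = (\<lambda>z. \<Sum>p\<in>P. d p powr \<alpha> *\<^sub>R gu p z)"
  have C1w: "C1_gradient \<Omega> w gw"
    unfolding w_def gw_def by (rule C1_gradient_sum[OF P(1) C1u])
  have w1: "w z1 = 0" using zV by (simp add: w_def u_def)
  have w2: "w z2 = S"
    unfolding w_def S_def
  proof (rule sum.cong)
    fix p assume p: "p \<in> P"
    have "\<psi> z2 = 1" using cutoff_eq_0[OF r0] by (simp add: \<psi>_def)
    moreover have "\<kappa> p z2 = 1"
      unfolding \<kappa>_def by (rule cutoff_eq_1[OF dp[OF p]]) (use P(2)[OF p] in simp)
    ultimately show "d p powr \<alpha> * u p z2 = d p powr \<alpha>" using zV[OF p] by (simp add: u_def \<phi>_def)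
  qed simp
  have range: "0 \<le> \<psi> y" "\<psi> y \<le> 1" "0 \<le> \<kappa> p y" "\<kappa> p y \<le> 1" for p y
    using cutoff_range by (auto simp: \<psi>_def \<kappa>_def)
  \<comment> \<open>Only discs with z within 6 d p of p contribute here, since
    \<open>\<kappa> p\<close> is constant beyond; this is also the condition under which
    \<open>packing_powr_sum_le_sum_powr\<close> applies at x = z.\<close>
  define X where "X = (\<lambda>z. \<Sum>p\<in>{p\<in>P. dist z p \<le> 6 * d p}. d p powr (- \<gamma>))"
  define Y where "Y = (\<lambda>z. S * (6 / r0) * indicator (ball z1 (2 * r0)) z)"
  define H where "H = (\<lambda>z. 2 powr q * ((2 * Cp) powr q * (\<Sum>p\<in>P. (d p powr (- \<gamma>)) powr q * indicator (cball p (6 * d p)) z)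
      + S powr q * (6 / r0) powr q * indicator (ball z1 (2 * r0)) z))"
  have gw_le: "norm (gw z) \<le> 2 * X z + Y z" for z
  proof -
    have "norm (gw z) \<le> (\<Sum>p\<in>P. norm (d p powr \<alpha> *\<^sub>R gu p z))" unfolding gw_def by (rule norm_sum)
    also have "\<dots> \<le> (\<Sum>p\<in>P. (if dist z p \<le> 6 * d p then 2 * d p powr (- \<gamma>) else 0)
        + d p powr \<alpha> * (6 / r0 * indicator (ball z1 (2 * r0)) z))"
    proof (rule sum_mono)
      fix p assume p: "p \<in> P"
      have "norm (gu p z) \<le> norm (g\<phi> p z)" by (simp add: gu_def)
      also have "\<dots> \<le> \<psi> z * norm (g\<kappa> p z) + \<kappa> p z * norm (g\<psi> z)"
        unfolding g\<phi>_def using range by (intro order_trans[OF norm_triangle_ineq]) simp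
      also have "\<dots> \<le> norm (g\<kappa> p z) + norm (g\<psi> z)"
        using range by (intro add_mono mult_left_le_one_le) auto
      also have "\<dots> \<le> 6 / (3 * d p) * indicator (ball p (2 * (3 * d p))) z + 6 / r0 * indicator (ball z1 (2 * r0)) z"
        using norm_cutoff_grad_le[OF dp[OF p], of p z] norm_cutoff_grad_le[OF r0(1), of z1 z]
        by (simp add: g\<kappa>_def g\<psi>_def)
      finally have "norm (d p powr \<alpha> *\<^sub>R gu p z) \<le> d p powr \<alpha> *
          (6 / (3 * d p) * indicator (ball p (2 * (3 * d p))) z + 6 / r0 * indicator (ball z1 (2 * r0)) z)"
        by (simp add: mult_left_mono)
      also have "\<dots> = 2 * (d p powr \<alpha> / d p) * indicator (ball p (2 * (3 * d p))) z +
           d p powr \<alpha> * (6 / r0 * indicator (ball z1 (2 * r0)) z)"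
        by (simp add: algebra_simps)
      also have "d p powr \<alpha> / d p = d p powr (- \<gamma>)"
        using powr_diff[of "d p" \<alpha> 1] P(2)[OF p] unfolding \<gamma>(2) by simp
      also have "2 * d p powr (- \<gamma>) * indicator (ball p (2 * (3 * d p))) z \<le>
          (if dist z p \<le> 6 * d p then 2 * d p powr (- \<gamma>) else 0)"
        by (auto simp: indicator_def dist_commute)
      finally show "norm (d p powr \<alpha> *\<^sub>R gu p z) \<le> (if dist z p \<le> 6 * d p then 2 * d p powr (- \<gamma>) else 0)
        + d p powr \<alpha> * (6 / r0 * indicator (ball z1 (2 * r0)) z)" by simp
    qed
    also have "\<dots> = 2 * X z + Y z"
    proof -
      have "(\<Sum>p\<in>P. if dist z p \<le> 6 * d p then 2 * d p powr (- \<gamma>) else 0) = 2 * X z"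
        unfolding X_def sum.inter_filter[OF P(1)] sum_distrib_left by (rule sum.cong) auto
      moreover have "(\<Sum>p\<in>P. d p powr \<alpha> * (6 / r0 * indicator (ball z1 (2 * r0)) z)) = Y z"
        by (simp only: Y_def S_def sum_distrib_right mult.assoc)
      ultimately show ?thesis by (simp only: sum.distrib)
    qed
    finally show ?thesis .
  qed
  have X0: "0 \<le> X z" and Y0: "0 \<le> Y z" for z
    using S0 r0 by (auto simp: X_def Y_def intro: sum_nonneg)
  have Cp: "0 \<le> Cp"
  proof -
    have "2 powr (- \<gamma>) < (2::real) powr 0" using \<gamma> by (intro powr_less_mono) auto
    then show ?thesis by (simp add: Cp_def \<gamma>_def)
  qed
  have Xq: "X z powr q \<le> Cp powr q * (\<Sum>p\<in>P. (d p powr (- \<gamma>)) powr q * indicator (cball p (6 * d p)) z)" for z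
  proof -
    have "X z powr q \<le> (117\<^sup>2 / (1 - 2 powr (- \<gamma>))) powr q * (\<Sum>p\<in>{p\<in>P. dist z p \<le> 6 * d p}. (d p powr (- \<gamma>)) powr q)"
      unfolding X_def
      by (rule packing_powr_sum_le_sum_powr[where x = z])
         (use P disj \<gamma> q in \<open>auto simp: disjoint_family_on_def\<close>)
    also have "(\<Sum>p\<in>{p\<in>P. dist z p \<le> 6 * d p}. (d p powr (- \<gamma>)) powr q) =
        (\<Sum>p\<in>P. (d p powr (- \<gamma>)) powr q * indicator (cball p (6 * d p)) z)"
      unfolding sum.inter_filter[OF P(1)] by (rule sum.cong) (auto simp: indicator_def dist_commute)
    finally show ?thesis by (simp add: Cp_def \<gamma>_def)
  qed
  have gwH: "norm (gw z) powr q \<le> H z" for z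
  proof -
    have "norm (gw z) powr q \<le> (2 * X z + Y z) powr q" using gw_le q by (intro powr_mono2) auto
    also have "\<dots> \<le> 2 powr q * ((2 * X z) powr q + Y z powr q)"
      using X0 Y0 q by (intro powr_add_le) auto
    also have "(2 * X z) powr q \<le> (2 * Cp) powr q * (\<Sum>p\<in>P. (d p powr (- \<gamma>)) powr q * indicator (cball p (6 * d p)) z)"
      using X0 Cp Xq[of z] by (simp add: powr_mult)
    also have "Y z powr q = S powr q * (6 / r0) powr q * indicator (ball z1 (2 * r0)) z"
    proof (cases "z \<in> ball z1 (2 * r0)")
      case True
      have "0 \<le> 6 / r0" using r0 by simp
      then show ?thesis using True S0 by (simp only: Y_def powr_mult indicator_simps mult_1_right)
    next
      case False
      then show ?thesis using q by (simp add: Y_def)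
    qed
    finally show ?thesis by (simp add: H_def)
  qed
  have icb: "integrable lebesgue (indicator (cball p r) :: complex \<Rightarrow> real)" for p :: complex and r
    by (simp add: lmeasurable_iff_integrable[symmetric])
  have iH: "integrable lebesgue H" unfolding H_def using icb integrable_indicator_ball by simp
  have mcb: "measure lborel (cball p r) = pi * r\<^sup>2" if "r > 0" for p :: complex and r
    using that by (simp add: content_cball unit_ball_vol_2)
  have "(\<integral>z. H z \<partial>lebesgue) = 2 powr q * ((2 * Cp) powr q * (\<Sum>p\<in>P. (d p powr (- \<gamma>)) powr q * measure lborel (cball p (6 * d p)))
      + S powr q * (6 / r0) powr q * measure lborel (ball z1 (2 * r0)))"
    unfolding H_def using icb integrable_indicator_ball by simp
  also have "(\<Sum>p\<in>P. (d p powr (- \<gamma>)) powr q * measure lborel (cball p (6 * d p))) = 36 * pi * S"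
    unfolding S_def sum_distrib_left
  proof (rule sum.cong)
    fix p assume p: "p \<in> P"
    \<comment> \<open>The reason for the weight \<open>d p powr \<alpha>\<close>: the q-th power of
      the gradient times the area gives the weight back.\<close>
    have "- \<gamma> * q + 2 = \<alpha>" using q by (simp add: \<gamma>_def \<alpha>_def field_simps)
    then have "(d p powr (- \<gamma>)) powr q * (d p)\<^sup>2 = d p powr \<alpha>"
      using P(2)[OF p] by (simp add: powr_powr powr_add[symmetric] powr_numeral[symmetric] del: powr_numeral)
    then show "(d p powr (- \<gamma>)) powr q * measure lborel (cball p (6 * d p)) = 36 * pi * d p powr \<alpha>"
      using P(2)[OF p] by (simp add: mcb power_mult_distrib)
  qed simp
  also have "measure lborel (ball z1 (2 * r0)) = 4 * pi * r0\<^sup>2"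
    using r0 by (simp add: measure_ball_complex power_mult_distrib)
  finally have IH: "(\<integral>z. H z \<partial>lebesgue) = 2 powr q * ((2 * Cp) powr q * (36 * pi * S) +
        S powr q * ((6 / r0) powr q * (4 * pi * r0\<^sup>2)))" by (simp add: mult.assoc)
  have "\<bar>w z1 - w z2\<bar> powr q \<le> (morrey_const q * C0) powr q * dist z1 z2 powr (q - 2) * (\<integral>z. H z \<partial>lebesgue)"
    by (rule Hoelder_dominated[OF q \<Omega> E C1w iH gwH _ z])
       (use S0 in \<open>auto simp: H_def intro!: add_nonneg_nonneg mult_nonneg_nonneg sum_nonneg\<close>)
  then show ?thesis unfolding IH S_def[symmetric] using w1 w2 S0 by simp
qed

section \<open>Whitney chains and the polygon along them\<close>

text \<open>The sets reachable from a by a chain and the remaining ones have disjoint open unions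
  that cover M; connectedness leaves no point of M for the second.\<close>

lemma connected_finite_cover_chain:
  assumes M: "connected M" "a \<in> M" "b \<in> M" and P: "finite P" "M \<subseteq> (\<Union>p\<in>P. U p)"
    and U: "\<And>p. p \<in> P \<Longrightarrow> open (U p)"
  shows "\<exists>ps. ps \<noteq> [] \<and> distinct ps \<and> set ps \<subseteq> P \<and> a \<in> U (hd ps) \<and> b \<in> U (last ps) \<and>
           successively (\<lambda>p p'. U p \<inter> U p' \<noteq> {}) ps"
proof -
  define chain where "chain = (\<lambda>ps p. ps \<noteq> [] \<and> distinct ps \<and> set ps \<subseteq> P \<and> a \<in> U (hd ps) \<and> last ps = p \<and>
           successively (\<lambda>p p'. U p \<inter> U p' \<noteq> {}) ps)"
  define T where "T = {p \<in> P. \<exists>ps. chain ps p}"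
  have step: "p' \<in> T" if p: "p \<in> T" and p': "p' \<in> P" "U p \<inter> U p' \<noteq> {}" for p p'
  proof -
    obtain ps where ps: "chain ps p" using p by (auto simp: T_def)
    show ?thesis
    proof (cases "p' \<in> set ps")
      \<comment> \<open>Cutting the chain at the earlier occurrence of p' keeps it
        \<open>distinct\<close>, so that sums along a chain are later sums over a set.\<close>
      case True
      then obtain xs ys where "ps = xs @ p' # ys" by (meson split_list)
      then have eq: "ps = (xs @ [p']) @ ys" by simp
      have "chain (xs @ [p']) p'"
        using ps unfolding chain_def eq successively_append_iff[of _ "xs @ [p']" ys]
        by (cases xs) auto
      then show ?thesis using p' by (auto simp: T_def)
    next
      case False
      then have "chain (ps @ [p']) p'"
        using ps p' by (auto simp: chain_def successively_append_iff)
      then show ?thesis using p' by (auto simp: T_def)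
    qed
  qed
  let ?A = "\<Union>p\<in>T. U p" and ?B = "\<Union>p\<in>P - T. U p"
  have TP: "T \<subseteq> P" by (auto simp: T_def)
  have aA: "a \<in> ?A"
  proof -
    obtain p where p: "p \<in> P" "a \<in> U p" using M P by blast
    then have "chain [p] p" by (simp add: chain_def)
    then show ?thesis using p by (auto simp: T_def)
  qed
  have "?B \<inter> M = {}"
  proof (rule ccontr)
    assume "?B \<inter> M \<noteq> {}"
    moreover have "?A \<inter> M \<noteq> {}" using aA M by blast
    moreover have "?A \<inter> ?B \<inter> M = {}" using step by blast
    moreover have "M \<subseteq> ?A \<union> ?B" using P TP by blast
    moreover have "open ?A" "open ?B" using U TP by (auto intro!: open_UN)
    ultimately show False using connectedD[OF M(1), of ?A ?B] by metis
  qed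
  moreover obtain p where p: "p \<in> P" "b \<in> U p" using M(3) P(2) by blast
  ultimately have "p \<in> T" "b \<in> U p" using M(3) by blast+
  then show ?thesis by (auto simp: T_def chain_def)
qed

text \<open>A Vitali-type selection: a fine finite net from compactness, then a maximal subfamily
  whose discs of radius \<delta> / 9 are disjoint. Maximality and the Lipschitz bound on \<delta>
  make the discs of radius \<delta> / 3 cover M.\<close>

lemma Whitney_selection:
  fixes M :: "complex set"
  assumes M: "compact M" and \<delta>: "\<And>x. x \<in> M \<Longrightarrow> 0 < \<delta> x" "\<And>x y. \<bar>\<delta> x - \<delta> y\<bar> \<le> dist x y"
  shows "\<exists>P. finite P \<and> P \<subseteq> M \<and> disjoint_family_on (\<lambda>p. ball p (\<delta> p / 9)) P \<and> M \<subseteq> (\<Union>p\<in>P. ball p (\<delta> p / 3))"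
proof -
  obtain Q where Q: "Q \<subseteq> M" "finite Q" "M \<subseteq> (\<Union>p\<in>Q. ball p (\<delta> p / 20))"
  proof (rule compactE_image[OF M, of M "\<lambda>p. ball p (\<delta> p / 20)"])
    show "M \<subseteq> (\<Union>p\<in>M. ball p (\<delta> p / 20))" using \<delta>(1) by fastforce
  qed (use that in auto)
  define F where "F = {P. P \<subseteq> Q \<and> disjoint_family_on (\<lambda>p. ball p (\<delta> p / 9)) P}"
  have "finite F" using Q by (auto simp: F_def)
  moreover have "{} \<in> F" by (simp add: F_def disjoint_family_on_def)
  ultimately obtain P where P: "P \<in> F" "\<And>P'. P' \<in> F \<Longrightarrow> P \<subseteq> P' \<Longrightarrow> P' = P"
    using finite_has_maximal[of F] by (metis empty_iff)
  have "M \<subseteq> (\<Union>p\<in>P. ball p (\<delta> p / 3))"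
  proof
    fix x assume x: "x \<in> M"
    then obtain s where s: "s \<in> Q" "dist s x < \<delta> s / 20" using Q by auto
    have "\<exists>p\<in>P. ball p (\<delta> p / 9) \<inter> ball s (\<delta> s / 9) \<noteq> {}"
    proof (cases "s \<in> P")
      case True
      have "s \<in> ball s (\<delta> s / 9)" using \<delta>(1)[of s] s Q by auto
      then show ?thesis using True by blast
    next
      case False
      have "insert s P \<notin> F" using P(2)[of "insert s P"] False by blast
      then show ?thesis using P(1) s by (auto simp: F_def disjoint_family_on_def)
    qed
    then obtain p y where p: "p \<in> P" "dist p y < \<delta> p / 9" "dist s y < \<delta> s / 9" by auto
    have 1: "9 * dist p s < \<delta> p + \<delta> s"
      using p dist_triangle[of p s y] by (simp add: dist_commute)
    have 2: "\<delta> s \<le> \<delta> p + dist p s" using \<delta>(2)[of s p] by (simp add: dist_commute)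
    have 3: "dist p x \<le> dist p s + dist s x" by (rule dist_triangle)
    have 4: "0 < \<delta> p" using p(1) P(1) Q(1) \<delta>(1) by (auto simp: F_def)
    \<comment> \<open>Facts 1 and 2 give dist p s < \<delta> p / 4 and hence \<delta> s < 5/4
      \<delta> p; the net adds at most \<delta> s / 20 < \<delta> p / 16, and 1/4 + 1/16 <
      1/3.\<close>
    have 5: "4 * dist p s < \<delta> p" using 1 2 by simp
    then have "4 * \<delta> s < 5 * \<delta> p" using 2 by simp
    then have "16 * dist s x < \<delta> p" using s(2) by simp
    then have "dist p x < \<delta> p / 3" using 3 4 5 by simp
    then show "x \<in> (\<Union>p\<in>P. ball p (\<delta> p / 3))" using p(1) by auto
  qed
  moreover have "finite P" "P \<subseteq> M" using P(1) Q finite_subset by (auto simp: F_def)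
  ultimately show ?thesis using P(1) by (auto simp: F_def)
qed

text \<open>One edge per disc, with vertices in the overlaps of consecutive discs; convexity keeps
  the edge in its disc. There e is at least 2/3 \<delta> p and the edge is no longer than 2/3
  \<delta> p, so it contributes at most
  \<open>(2 / 3 * \<delta> p) powr (1 - \<gamma>)\<close>.\<close>

lemma chain_path_exists:
  fixes \<delta> :: "complex \<Rightarrow> real"
  assumes \<gamma>: "0 < \<gamma>" "\<gamma> < 1" and ps: "ps \<noteq> []" "distinct ps" "a \<in> ball (hd ps) (\<delta> (hd ps) / 3)" "b \<in> ball (last ps) (\<delta> (last ps) / 3)"
    and chain: "successively (\<lambda>p p'. ball p (\<delta> p / 3) \<inter> ball p' (\<delta> p' / 3) \<noteq> {}) ps"
    and \<delta>: "\<And>p. p \<in> set ps \<Longrightarrow> 0 < \<delta> p"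
    and f: "\<And>p z. p \<in> set ps \<Longrightarrow> z \<in> ball p (\<delta> p / 3) \<Longrightarrow> z \<in> S \<and> 2 / 3 * \<delta> p \<le> e z"
  shows "\<exists>g. path g \<and> rectifiable g \<and> path_image g \<subseteq> S \<and> pathstart g = a \<and> pathfinish g = b \<and>
     arc_length_integral g (\<lambda>z. ennreal (e z powr (- \<gamma>))) \<le> ennreal (\<Sum>p\<in>set ps. \<delta> p powr (1 - \<gamma>))"
proof -
  define n where "n = length ps"
  have n: "0 < n" using ps by (simp add: n_def)
  let ?B = "\<lambda>i. ball (ps ! i) (\<delta> (ps ! i) / 3)"
  have "\<exists>y. y \<in> ?B i \<inter> ?B (Suc i)" if "Suc i < n" for i
    using chain that unfolding n_def successively_conv_nth by blast
  then obtain Y where Y: "\<And>i. Suc i < n \<Longrightarrow> Y i \<in> ?B i \<inter> ?B (Suc i)" by metis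
  define v where "v = (\<lambda>j. if j = 0 then a else if j = n then b else Y (j - 1))"
  have hd_last: "hd ps = ps ! 0" "last ps = ps ! (n - 1)"
    using ps by (simp_all add: hd_conv_nth last_conv_nth n_def)
  have v1: "v j \<in> ?B j" if "j < n" for j
  proof (cases j)
    case 0 then show ?thesis using ps hd_last by (simp add: v_def)
  next
    case (Suc i) then show ?thesis using Y[of i] that by (simp add: v_def)
  qed
  have v2: "v (Suc j) \<in> ?B j" if "j < n" for j
  proof (cases "Suc j = n")
    case True
    then have "n - 1 = j" by simp
    then show ?thesis using ps hd_last True by (simp add: v_def)
  next
    case False then show ?thesis using Y[of j] that by (simp add: v_def)
  qed
  have seg: "closed_segment (v j) (v (Suc j)) \<subseteq> ?B j" if "j < n" for j
    using v1[OF that] v2[OF that] by (simp add: closed_segment_subset convex_ball)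
  define c where "c = (\<lambda>j. (2 / 3 * \<delta> (ps ! j)) powr (- \<gamma>))"
  have "\<exists>g. path g \<and> rectifiable g \<and> path_image g \<subseteq> S \<and> pathstart g = v 0 \<and> pathfinish g = v n \<and>
      arc_length_integral g (\<lambda>z. ennreal (e z powr (- \<gamma>))) \<le> ennreal (\<Sum>j<n. c j * dist (v j) (v (Suc j)))"
  proof (rule polygon_path_exists[OF n])
    show "0 \<le> c j" for j by (simp add: c_def)
    fix j z assume j: "j < n" and "z \<in> closed_segment (v j) (v (Suc j))"
    then have z: "z \<in> ?B j" using seg by blast
    have p: "ps ! j \<in> set ps" using j by (simp add: n_def)
    have "e z powr (- \<gamma>) \<le> c j"
      unfolding c_def using f[OF p z] \<delta>[OF p] \<gamma> by (intro powr_mono2') auto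
    then show "z \<in> S \<and> ennreal (e z powr (- \<gamma>)) \<le> ennreal (c j)"
      using f[OF p z] by (simp add: ennreal_leI)
  qed
  moreover have "(\<Sum>j<n. c j * dist (v j) (v (Suc j))) \<le> (\<Sum>p\<in>set ps. \<delta> p powr (1 - \<gamma>))"
  proof -
    have "(\<Sum>j<n. c j * dist (v j) (v (Suc j))) \<le> (\<Sum>j<n. \<delta> (ps ! j) powr (1 - \<gamma>))"
    proof (rule sum_mono)
      fix j assume "j \<in> {..<n}"
      then have j: "j < n" by simp
      have d: "0 < \<delta> (ps ! j)" using j by (intro \<delta>) (simp add: n_def)
      have "dist (v j) (v (Suc j)) \<le> 2 / 3 * \<delta> (ps ! j)"
        using v1[OF j] v2[OF j] dist_triangle[of "v j" "v (Suc j)" "ps ! j"] by (simp add: dist_commute)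
      then have "c j * dist (v j) (v (Suc j)) \<le> (2 / 3 * \<delta> (ps ! j)) powr (- \<gamma>) * (2 / 3 * \<delta> (ps ! j)) powr 1"
        unfolding c_def using d by (intro mult_left_mono) auto
      also have "\<dots> = (2 / 3 * \<delta> (ps ! j)) powr (1 - \<gamma>)"
        by (simp only: powr_add[symmetric]) simp
      also have "\<dots> \<le> \<delta> (ps ! j) powr (1 - \<gamma>)"
        using d \<gamma> by (intro powr_mono2) auto
      finally show "c j * dist (v j) (v (Suc j)) \<le> \<delta> (ps ! j) powr (1 - \<gamma>)" .
    qed
    also have "\<dots> = (\<Sum>p\<in>set ps. \<delta> p powr (1 - \<gamma>))"
      using ps(2) by (simp add: sum.distinct_set_conv_list sum_list_sum_nth n_def atLeast0LessThan)
    finally show ?thesis .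
  qed
  moreover have "v 0 = a" "v n = b" using n by (simp_all add: v_def)
  ultimately show ?thesis by (metis (no_types, lifting) ennreal_leI order_trans)
qed

section \<open>Jordan domains and assembly of the estimates\<close>

text \<open>Being a bounded component, \<Omega> is the inside of the curve. The curve is the whole
  frontier of the outside, so the complement of \<Omega> is the closure of a connected set.\<close>

lemma jordan_domain_facts:
  assumes "jordan_domain \<Omega>"
  shows "open \<Omega>" "bounded \<Omega>" "connected (- \<Omega>)"
proof -
  obtain c where c: "simple_path c" "pathfinish c = pathstart c" "\<Omega> \<in> components (- path_image c)" "bounded \<Omega>"
    using assms by (auto simp: jordan_domain_def)
  let ?P = "path_image c"
  have J: "inside ?P \<noteq> {}" "open (inside ?P)" "connected (inside ?P)" "open (outside ?P)" "connected (outside ?P)"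
    "\<not> bounded (outside ?P)" "inside ?P \<inter> outside ?P = {}" "inside ?P \<union> outside ?P = - ?P"
    "frontier (outside ?P) = ?P"
    using Jordan_inside_outside[OF c(1,2)] by auto
  have \<Omega>: "connected \<Omega>" "\<Omega> \<subseteq> - ?P" "\<Omega> \<noteq> {}"
    using c(3) in_components_connected in_components_subset in_components_nonempty by blast+
  have max: "T \<subseteq> \<Omega>" if "connected T" "T \<subseteq> - ?P" "T \<inter> \<Omega> \<noteq> {}" for T
    using components_maximal[OF c(3) that(1,2)] that(3) by blast
  have out: "outside ?P \<inter> \<Omega> = {}"
  proof (rule ccontr)
    assume "outside ?P \<inter> \<Omega> \<noteq> {}"
    then have "outside ?P \<subseteq> \<Omega>" using J(8) by (intro max J(5)) blast+
    then show False using J(6) c(4) bounded_subset by blast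
  qed
  then have "\<Omega> \<subseteq> inside ?P" using \<Omega>(2) J(8) by blast
  moreover have "inside ?P \<subseteq> \<Omega>" using J(8) \<Omega>(3) calculation by (intro max J(3)) blast+
  ultimately have eq: "\<Omega> = inside ?P" by blast
  show "open \<Omega>" "bounded \<Omega>" using eq J c by auto
  have "- \<Omega> = closure (outside ?P)"
    unfolding eq closure_Un_frontier J(9) using J(7,8) by blast
  then show "connected (- \<Omega>)" using connected_imp_connected_closure[OF J(5)] by simp
qed

lemma powr_absorb:
  fixes S A q :: real
  assumes q: "2 < q" and S: "0 \<le> S" and le: "S powr q \<le> A * S + S powr q / 2"
  shows "S \<le> (2 * A) powr (1 / (q - 1))"
proof (cases "S = 0")
  case False
  then have S: "S > 0" using S by simp
  have "S powr q = S powr (q - 1) * S" using S by (simp add: powr_diff)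
  then have "S powr (q - 1) * S \<le> 2 * A * S" using le by simp
  then have "S powr (q - 1) \<le> 2 * A" using S by simp
  then have "(S powr (q - 1)) powr (1 / (q - 1)) \<le> (2 * A) powr (1 / (q - 1))"
    using q by (intro powr_mono2) auto
  then show ?thesis using q S by (simp add: powr_powr)
qed simp

lemma constant_path_exists:
  fixes f :: "'a::real_normed_vector \<Rightarrow> real"
  assumes "z \<in> S" "0 \<le> f z"
  shows "\<exists>\<gamma>. path \<gamma> \<and> rectifiable \<gamma> \<and> path_image \<gamma> \<subseteq> S \<and> pathstart \<gamma> = z \<and> pathfinish \<gamma> = z \<and>
     arc_length_integral \<gamma> (\<lambda>z. ennreal (f z)) \<le> 0"
  using polygon_path_exists[of 1 "\<lambda>_. f z" "\<lambda>_. z" S "\<lambda>z. ennreal (f z)"] assms by simp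

text \<open>The admissible points contain an open set that joins z1 to z2, hence a path; its compact
  image admits a Whitney selection, and connectedness orders part of that into a chain.\<close>

lemma separating_Whitney_chain:
  fixes W :: "complex set"
  assumes oW: "open W" and bW: "bounded W" and cW: "connected (- W)" and cc: "connected_component W z1 z2"
  defines "\<delta> \<equiv> \<lambda>z. infdist z (- W)"
  shows "\<exists>ps. ps \<noteq> [] \<and> distinct ps \<and> set ps \<subseteq> W \<and> disjoint_family_on (\<lambda>p. ball p (\<delta> p / 9)) (set ps) \<and>
    z1 \<in> ball (hd ps) (\<delta> (hd ps) / 3) \<and> z2 \<in> ball (last ps) (\<delta> (last ps) / 3) \<and>
    successively (\<lambda>p p'. ball p (\<delta> p / 3) \<inter> ball p' (\<delta> p' / 3) \<noteq> {}) ps \<and>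
    (\<forall>p\<in>set ps. z1 \<in> ball p (2 * \<delta> p) \<or> z2 \<in> ball p (2 * \<delta> p) \<or>
       \<not> connected_component (W - cball p (2 * \<delta> p)) z1 z2)"
proof -
  obtain G where G: "open G" "connected_component G z1 z2"
    "G \<subseteq> {z \<in> W. z1 \<in> ball z (2 * \<delta> z) \<or> z2 \<in> ball z (2 * \<delta> z) \<or> \<not> connected_component (W - cball z (2 * \<delta> z)) z1 z2}"
    using separating_points_connect[OF oW bW cW cc] unfolding \<delta>_def by blast
  then have "path_component G z1 z2" using open_path_connected_component by metis
  then obtain g where g: "path g" "path_image g \<subseteq> G" "pathstart g = z1" "pathfinish g = z2"
    by (auto simp: path_component_def)
  define M where "M = path_image g"
  have M: "compact M" "connected M" "z1 \<in> M" "z2 \<in> M" "M \<subseteq> G"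
    using g pathstart_in_path_image[of g] pathfinish_in_path_image[of g]
    by (auto simp: M_def compact_path_image connected_path_image)
  have neW: "- W \<noteq> {}" using bW by (metis Compl_empty_eq double_compl not_bounded_UNIV)
  have \<delta>pos: "0 < \<delta> z" if "z \<in> W" for z
    using that oW neW by (simp add: \<delta>_def infdist_pos_not_in_closed closed_Compl)
  have \<delta>lip: "\<bar>\<delta> x - \<delta> y\<bar> \<le> dist x y" for x y unfolding \<delta>_def by (rule infdist_triangle_abs)
  have "\<exists>P. finite P \<and> P \<subseteq> M \<and> disjoint_family_on (\<lambda>p. ball p (\<delta> p / 9)) P \<and> M \<subseteq> (\<Union>p\<in>P. ball p (\<delta> p / 3))"
    by (rule Whitney_selection[OF M(1) _ \<delta>lip]) (use M G \<delta>pos in blast)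
  then obtain P where P: "finite P" "P \<subseteq> M" "disjoint_family_on (\<lambda>p. ball p (\<delta> p / 9)) P"
    "M \<subseteq> (\<Union>p\<in>P. ball p (\<delta> p / 3))" by blast
  have "\<exists>ps. ps \<noteq> [] \<and> distinct ps \<and> set ps \<subseteq> P \<and> z1 \<in> ball (hd ps) (\<delta> (hd ps) / 3) \<and>
    z2 \<in> ball (last ps) (\<delta> (last ps) / 3) \<and>
    successively (\<lambda>p p'. ball p (\<delta> p / 3) \<inter> ball p' (\<delta> p' / 3) \<noteq> {}) ps"
    by (rule connected_finite_cover_chain[OF M(2,3,4) P(1,4)]) simp
  then obtain ps where ps: "ps \<noteq> []" "distinct ps" "set ps \<subseteq> P" "z1 \<in> ball (hd ps) (\<delta> (hd ps) / 3)"
    "z2 \<in> ball (last ps) (\<delta> (last ps) / 3)"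
    "successively (\<lambda>p p'. ball p (\<delta> p / 3) \<inter> ball p' (\<delta> p' / 3) \<noteq> {}) ps" by blast
  have "set ps \<subseteq> G" using ps(3) P(2) M(5) by blast
  then have "set ps \<subseteq> W" "\<forall>p\<in>set ps. z1 \<in> ball p (2 * \<delta> p) \<or> z2 \<in> ball p (2 * \<delta> p) \<or>
       \<not> connected_component (W - cball p (2 * \<delta> p)) z1 z2" using G(3) by blast+
  moreover have "disjoint_family_on (\<lambda>p. ball p (\<delta> p / 9)) (set ps)"
    using P(3) ps(3) unfolding disjoint_family_on_def by blast
  ultimately show ?thesis using ps by blast
qed

text \<open>First summand: the discs close to z1 and those close to z2, whence the 2;
  \<open>6 * K\<close> comes from the bound 6 K D on \<delta>. Second summand: the separating discs
  after absorption. \<open>c0\<close> stands for \<open>(morrey_const q * C0) powr q\<close> and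
  \<open>M1\<close> for \<open>slice_const q\<close>.\<close>

definition curve_const :: "real \<Rightarrow> real \<Rightarrow> real \<Rightarrow> real \<Rightarrow> real" where
  "curve_const q c0 M1 K = 2 * (117\<^sup>2 / (1 - 2 powr (- ((q - 2) / (q - 1)))) * (6 * K) powr ((q - 2) / (q - 1)))
     + (2 * c0 * M1) powr (1 / (q - 1))"

text \<open>The coefficient of S in \<open>slice_sum_estimate\<close>, without the Hoelder
  factor.\<close>

definition slice_const :: "real \<Rightarrow> real" where
  "slice_const q = 2 powr q * ((2 * (117\<^sup>2 / (1 - 2 powr (- (1 / (q - 1)))))) powr q * (36 * pi))"

text \<open>Discs within 6 \<delta> p of z1 or z2 are summed by the packing bound. For the others
  the disc of radius 2 \<delta> p contains neither point, so \<open>sep\<close> leaves only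
  separation and \<open>slice_sum_estimate\<close> applies; \<open>half\<close> makes its S^q term
  at most half of the left-hand side.\<close>

lemma Whitney_chain_sum_le:
  fixes \<Omega> :: "complex set" and q C0 :: real
  defines "c0 \<equiv> (morrey_const q * C0) powr q" and "\<alpha> \<equiv> (q - 2) / (q - 1)"
  assumes q: "2 < q" and \<Omega>: "open \<Omega>" and E: "sobolev_extension_operator q C0 \<Omega> E"
    and z: "z1 \<in> \<Omega>" "z2 \<in> \<Omega>" and D: "D = dist z1 z2" "D > 0" and r0: "r0 = K * D" and K: "1 \<le> K"
    and half: "c0 * D powr (q - 2) * (2 powr q * ((6 / r0) powr q * (4 * pi * r0\<^sup>2))) \<le> 1 / 2"
    and W: "W = \<Omega> \<inter> ball z1 (3 * r0)"
    and P: "finite P" "P \<subseteq> W" "disjoint_family_on (\<lambda>p. ball p (infdist p (- W) / 9)) P"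
    and sep: "\<And>p. p \<in> P \<Longrightarrow> z1 \<in> ball p (2 * infdist p (- W)) \<or> z2 \<in> ball p (2 * infdist p (- W)) \<or>
        \<not> connected_component (W - cball p (2 * infdist p (- W))) z1 z2"
  shows "(\<Sum>p\<in>P. infdist p (- W) powr \<alpha>) \<le> curve_const q c0 (slice_const q) K * D powr \<alpha>"
proof -
  define \<delta> where "\<delta> = (\<lambda>p. infdist p (- W))"
  define C\<alpha> where "C\<alpha> = (117\<^sup>2 / (1 - 2 powr (- \<alpha>)) :: real)"
  have \<alpha>: "\<alpha> > 0" using q by (simp add: \<alpha>_def)
  have r0': "r0 > 0" "dist z1 z2 \<le> r0" using K D by (auto simp: r0)
  \<comment> \<open>A point at distance exactly 3 r0 from z1 lies outside W; it caps \<delta> by 6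
    r0 on W, however large \<Omega> is.\<close>
  define s where "s = z1 + of_real (3 * r0)"
  have s: "s \<in> - W" "dist z1 s = 3 * r0" using r0' by (auto simp: W s_def dist_norm)
  have oW: "open W" using \<Omega> by (simp add: W open_Int)
  have \<delta>pos: "0 < \<delta> p" if "p \<in> P" for p
    using that P(2) oW s(1) unfolding \<delta>_def
    by (intro infdist_pos_not_in_closed) (auto simp: closed_Compl)
  have \<delta>le: "\<delta> p \<le> 6 * r0" if "p \<in> P" for p
  proof -
    have "\<delta> p \<le> dist p s" unfolding \<delta>_def using s(1) by (rule infdist_le)
    moreover have "dist p s \<le> dist p z1 + dist z1 s" by (rule dist_triangle)
    moreover have "dist p z1 < 3 * r0" using P(2) that by (auto simp: W dist_commute)
    ultimately show ?thesis using s(2) by linarith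
  qed
  have disj: "disjoint_family_on (\<lambda>p. ball p (\<delta> p / 9)) Q" if "Q \<subseteq> P" for Q
    using P(3) that unfolding disjoint_family_on_def \<delta>_def by blast
  define near where "near = (\<lambda>y. {p \<in> P. dist y p \<le> 6 * \<delta> p})"
  have near: "(\<Sum>p\<in>near y. \<delta> p powr \<alpha>) \<le> C\<alpha> * (6 * r0) powr \<alpha>" for y
    unfolding C\<alpha>_def
  proof (rule packing_sum_powr_le(1)[where x = y, OF _ _ disj \<alpha>])
    show "finite (near y)" "near y \<subseteq> P" using P(1) by (auto simp: near_def)
    show "0 < \<delta> p \<and> dist y p \<le> 6 * \<delta> p" "\<delta> p \<le> 6 * r0" if "p \<in> near y" for p
      using that \<delta>pos \<delta>le by (auto simp: near_def)
  qed
  define P3 where "P3 = {p \<in> P. 6 * \<delta> p < dist z1 p \<and> 6 * \<delta> p < dist z2 p}"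
  have finP3: "finite P3" using P(1) by (simp add: P3_def)
  define S where "S = (\<Sum>p\<in>P3. \<delta> p powr \<alpha>)"
  define T where "T = (6 / r0) powr q * (4 * pi * r0\<^sup>2)"
  have S0: "0 \<le> S" by (auto simp: S_def intro: sum_nonneg)
  have c0: "0 \<le> c0" "0 \<le> slice_const q" by (simp_all add: c0_def slice_const_def)
  have "S powr q \<le> c0 * D powr (q - 2) * (2 powr q * ((2 * (117\<^sup>2 / (1 - 2 powr (- (1 / (q - 1)))))) powr q * (36 * pi * S) + S powr q * T))"
    unfolding S_def c0_def D T_def \<alpha>_def
  proof (rule slice_sum_estimate[OF q \<Omega> E z r0' W finP3])
    fix p assume p: "p \<in> P3"
    then have "p \<in> P" "6 * \<delta> p < dist z1 p" "6 * \<delta> p < dist z2 p" by (auto simp: P3_def)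
    then show "0 < \<delta> p \<and> 6 * \<delta> p \<le> dist p z1 \<and> 6 * \<delta> p \<le> dist p z2 \<and>
        \<not> connected_component (W - cball p (2 * \<delta> p)) z1 z2"
      using sep[of p] \<delta>pos[of p] unfolding \<delta>_def by (auto simp: dist_commute)
  qed (rule disj, auto simp: P3_def)
  also have "\<dots> = c0 * slice_const q * D powr (q - 2) * S + S powr q * (c0 * D powr (q - 2) * (2 powr q * T))"
    unfolding slice_const_def by algebra
  also have "\<dots> \<le> c0 * slice_const q * D powr (q - 2) * S + S powr q * (1 / 2)"
    using half unfolding T_def by (intro add_left_mono mult_left_mono) auto
  finally have "S \<le> (2 * (c0 * slice_const q * D powr (q - 2))) powr (1 / (q - 1))"
    by (intro powr_absorb[OF q S0]) simp
  also have "\<dots> = ((2 * c0 * slice_const q) * D powr (q - 2)) powr (1 / (q - 1))" by (simp only: mult_ac)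
  also have "\<dots> = (2 * c0 * slice_const q) powr (1 / (q - 1)) * D powr \<alpha>"
    using c0 D by (simp add: \<alpha>_def powr_mult powr_powr)
  finally have S: "S \<le> (2 * c0 * slice_const q) powr (1 / (q - 1)) * D powr \<alpha>" .
  have fin: "finite (near z1)" "finite (near z2)" using P(1) by (auto simp: near_def)
  have "P \<subseteq> (near z1 \<union> near z2) \<union> P3" by (auto simp: near_def P3_def not_le)
  then have "(\<Sum>p\<in>P. \<delta> p powr \<alpha>) \<le> (\<Sum>p\<in>(near z1 \<union> near z2) \<union> P3. \<delta> p powr \<alpha>)"
    using fin finP3 by (intro sum_mono2) auto
  also have "\<dots> \<le> (\<Sum>p\<in>near z1 \<union> near z2. \<delta> p powr \<alpha>) + S"
    unfolding S_def using fin finP3 by (simp add: sum_Un sum_nonneg)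
  also have "(\<Sum>p\<in>near z1 \<union> near z2. \<delta> p powr \<alpha>) \<le> (\<Sum>p\<in>near z1. \<delta> p powr \<alpha>) + (\<Sum>p\<in>near z2. \<delta> p powr \<alpha>)"
    using fin by (simp add: sum_Un sum_nonneg)
  also have "(\<Sum>p\<in>near z1. \<delta> p powr \<alpha>) + (\<Sum>p\<in>near z2. \<delta> p powr \<alpha>) + S \<le>
      C\<alpha> * (6 * r0) powr \<alpha> + C\<alpha> * (6 * r0) powr \<alpha> + (2 * c0 * slice_const q) powr (1 / (q - 1)) * D powr \<alpha>"
    by (intro add_mono near S)
  also have "(6 * r0) powr \<alpha> = (6 * K) powr \<alpha> * D powr \<alpha>"
    using K D(2) powr_mult[of "6 * K" D \<alpha>] by (simp add: r0 mult.assoc)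
  also have "C\<alpha> * ((6 * K) powr \<alpha> * D powr \<alpha>) + C\<alpha> * ((6 * K) powr \<alpha> * D powr \<alpha>) +
      (2 * c0 * slice_const q) powr (1 / (q - 1)) * D powr \<alpha> = curve_const q c0 (slice_const q) K * D powr \<alpha>"
    unfolding curve_const_def C\<alpha>_def \<alpha>_def by algebra
  finally show ?thesis unfolding \<delta>_def by simp
qed

lemma subhyperbolic_curve_exists:
  fixes q C0 :: real and \<Omega> :: "complex set"
  defines "c0 \<equiv> (morrey_const q * C0) powr q" and "\<alpha> \<equiv> (q - 2) / (q - 1)"
  assumes q: "2 < q" and J: "jordan_domain \<Omega>" and E: "sobolev_extension_operator q C0 \<Omega> E"
    and z: "z1 \<in> \<Omega>" "z2 \<in> \<Omega>" "z1 \<noteq> z2"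
    and K: "1 \<le> K" "c0 * (2 powr q * (6 powr q * (4 * pi))) * K powr (2 - q) \<le> 1 / 2"
  shows "\<exists>\<gamma>. path \<gamma> \<and> rectifiable \<gamma> \<and> path_image \<gamma> \<subseteq> \<Omega> \<and> pathstart \<gamma> = z1 \<and> pathfinish \<gamma> = z2 \<and>
      arc_length_integral \<gamma> (\<lambda>z. ennreal (infdist z (frontier \<Omega>) powr (1 / (1 - q))))
        \<le> ennreal (curve_const q c0 (slice_const q) K * dist z1 z2 powr \<alpha>)"
proof -
  define \<gamma>0 where "\<gamma>0 = 1 / (q - 1)"
  have \<gamma>0: "0 < \<gamma>0" "\<gamma>0 < 1" "1 - \<gamma>0 = \<alpha>" "1 / (1 - q) = - \<gamma>0"
    using q by (simp_all add: \<gamma>0_def \<alpha>_def field_simps)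
  define D where "D = dist z1 z2"
  have D: "D > 0" using z by (simp add: D_def)
  define r0 where "r0 = K * D"
  have r0: "r0 > 0" "dist z1 z2 \<le> r0" using K D by (auto simp: r0_def D_def[symmetric])
  define W where "W = \<Omega> \<inter> ball z1 (3 * r0)"
  note \<Omega> = jordan_domain_facts[OF J]
  have oW: "open W" and bW: "bounded W" using \<Omega> by (auto simp: W_def open_Int bounded_Int)
  \<comment> \<open>The complements of \<Omega> and of the disc are connected, and they meet because
    \<Omega> and the disc are bounded.\<close>
  have cW: "connected (- W)"
  proof -
    have "connected (- ball z1 (3 * r0))" by (rule connected_complement_bounded_convex) auto
    moreover have "- \<Omega> \<inter> - ball z1 (3 * r0) \<noteq> {}"
    proof
      assume "- \<Omega> \<inter> - ball z1 (3 * r0) = {}"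
      then have "\<Omega> \<union> ball z1 (3 * r0) = UNIV" by blast
      then show False using \<Omega>(2) by (metis bounded_Un bounded_ball not_bounded_UNIV)
    qed
    ultimately have "connected (- \<Omega> \<union> - ball z1 (3 * r0))" using \<Omega>(3) connected_Un by blast
    then show ?thesis by (simp add: W_def)
  qed
  define T where "T = (6 / r0) powr q * (4 * pi * r0\<^sup>2)"
  have T0: "0 \<le> T" by (simp add: T_def)
  \<comment> \<open>With r0 = K D all powers of D cancel: \<open>D powr (q - 2) * T\<close> is a
    multiple of \<open>K powr (2 - q)\<close>, which the choice of K makes small.\<close>
  have half: "c0 * D powr (q - 2) * (2 powr q * T) \<le> 1 / 2"
  proof -
    have "T = 6 powr q * (4 * pi) * (r0 powr (- q) * r0 powr 2)"
      using r0 by (simp add: T_def powr_divide powr_minus_divide)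
    also have "r0 powr (- q) * r0 powr 2 = r0 powr (2 - q)" by (simp only: powr_add[symmetric]) simp
    also have "\<dots> = K powr (2 - q) * D powr (2 - q)" using K D by (simp add: r0_def powr_mult)
    finally have T: "T = 6 powr q * (4 * pi) * (K powr (2 - q) * D powr (2 - q))" .
    have DD: "D powr (q - 2) * D powr (2 - q) = 1" using D by (simp only: powr_add[symmetric]) simp
    have "c0 * D powr (q - 2) * (2 powr q * T) =
        c0 * (2 powr q * (6 powr q * (4 * pi))) * K powr (2 - q) * (D powr (q - 2) * D powr (2 - q))"
      unfolding T by (simp only: mult_ac)
    then show ?thesis unfolding DD using K(2) by linarith
  qed
  have cc: "connected_component W z1 z2"
  proof (rule ccontr)
    assume "\<not> connected_component W z1 z2"
    then have "1 \<le> c0 * D powr (q - 2) * T"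
      using component_cutoff_estimate[OF q \<Omega>(1) E z(1,2) r0] unfolding W_def c0_def D_def T_def by blast
    moreover have "0 \<le> c0 * D powr (q - 2)" by (simp add: c0_def)
    moreover have "1 * T \<le> 2 powr q * T"
      using T0 q ge_one_powr_ge_zero[of 2 q] by (intro mult_right_mono) auto
    ultimately have "1 \<le> c0 * D powr (q - 2) * (2 powr q * T)"
      using mult_left_mono[of "1 * T" "2 powr q * T" "c0 * D powr (q - 2)"] by simp
    then show False using half by linarith
  qed
  define \<delta> where "\<delta> = (\<lambda>z. infdist z (- W))"
  obtain ps where ps: "ps \<noteq> []" "distinct ps" "set ps \<subseteq> W" "disjoint_family_on (\<lambda>p. ball p (\<delta> p / 9)) (set ps)"
    "z1 \<in> ball (hd ps) (\<delta> (hd ps) / 3)" "z2 \<in> ball (last ps) (\<delta> (last ps) / 3)"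
    "successively (\<lambda>p p'. ball p (\<delta> p / 3) \<inter> ball p' (\<delta> p' / 3) \<noteq> {}) ps"
    "\<And>p. p \<in> set ps \<Longrightarrow> z1 \<in> ball p (2 * \<delta> p) \<or> z2 \<in> ball p (2 * \<delta> p) \<or>
       \<not> connected_component (W - cball p (2 * \<delta> p)) z1 z2"
    using separating_Whitney_chain[OF oW bW cW cc] unfolding \<delta>_def by blast
  have total: "(\<Sum>p\<in>set ps. \<delta> p powr \<alpha>) \<le> curve_const q c0 (slice_const q) K * D powr \<alpha>"
    unfolding \<delta>_def \<alpha>_def c0_def
    by (rule Whitney_chain_sum_le[OF q \<Omega>(1) E z(1,2) D_def D r0_def K(1) _ W_def])
       (use half ps in \<open>auto simp: T_def c0_def \<delta>_def\<close>)
  have neW: "- W \<noteq> {}" using bW by (metis Compl_empty_eq double_compl not_bounded_UNIV)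
  have \<delta>pos: "0 < \<delta> p" if "p \<in> W" for p
    using that oW neW by (simp add: \<delta>_def infdist_pos_not_in_closed closed_Compl)
  have fr: "frontier \<Omega> \<noteq> {}" "frontier \<Omega> \<subseteq> - W"
  proof -
    have "\<Omega> \<noteq> UNIV" using \<Omega>(2) not_bounded_UNIV by metis
    then show "frontier \<Omega> \<noteq> {}" using z by (intro frontier_not_empty) auto
    show "frontier \<Omega> \<subseteq> - W" using \<Omega>(1) frontier_disjoint_eq[of \<Omega>] by (auto simp: W_def)
  qed
  have "\<exists>g. path g \<and> rectifiable g \<and> path_image g \<subseteq> \<Omega> \<and> pathstart g = z1 \<and> pathfinish g = z2 \<and>
      arc_length_integral g (\<lambda>z. ennreal (infdist z (frontier \<Omega>) powr (- \<gamma>0))) \<le> ennreal (\<Sum>p\<in>set ps. \<delta> p powr (1 - \<gamma>0))"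
  proof (rule chain_path_exists[OF \<gamma>0(1,2) ps(1,2,5,6,7)])
    show "0 < \<delta> p" if "p \<in> set ps" for p using that ps(3) \<delta>pos by blast
    fix p z assume p: "p \<in> set ps" and zp: "z \<in> ball p (\<delta> p / 3)"
    have pos: "0 < \<delta> p" using p ps(3) \<delta>pos by blast
    have "\<delta> p - \<delta> z \<le> dist p z"
      using infdist_triangle_abs[of p "- W" z] unfolding \<delta>_def by linarith
    then have ge: "2 / 3 * \<delta> p \<le> \<delta> z" using zp by simp
    have "z \<in> W"
    proof (rule ccontr)
      assume "z \<notin> W"
      then have "\<delta> z = 0" by (simp add: \<delta>_def)
      then show False using ge pos by simp
    qed
    \<comment> \<open>The frontier of \<Omega> lies outside W. As the exponent of the weight is
      negative, a lower bound for the distance to the frontier bounds the weight from above.\<close>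
    moreover have "\<delta> z \<le> infdist z (frontier \<Omega>)"
      unfolding \<delta>_def by (rule infdist_mono[OF fr(2,1)])
    ultimately show "z \<in> \<Omega> \<and> 2 / 3 * \<delta> p \<le> infdist z (frontier \<Omega>)" using ge by (auto simp: W_def)
  qed
  then obtain g where g: "path g" "rectifiable g" "path_image g \<subseteq> \<Omega>" "pathstart g = z1" "pathfinish g = z2"
    "arc_length_integral g (\<lambda>z. ennreal (infdist z (frontier \<Omega>) powr (1 / (1 - q)))) \<le> ennreal (\<Sum>p\<in>set ps. \<delta> p powr \<alpha>)"
    unfolding \<gamma>0(3,4) by blast
  moreover have "ennreal (\<Sum>p\<in>set ps. \<delta> p powr \<alpha>) \<le> ennreal (curve_const q c0 (slice_const q) K * dist z1 z2 powr \<alpha>)"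
    using total unfolding D_def by (rule ennreal_leI)
  ultimately show ?thesis using order_trans by blast
qed

theorem corollary1p4:
  fixes q C0 :: real
  assumes "2 < q"
  shows "\<exists>C::real. \<forall>\<Omega> E. jordan_domain \<Omega> \<and> sobolev_extension_operator q C0 \<Omega> E \<longrightarrow>
           (\<forall>z1\<in>\<Omega>. \<forall>z2\<in>\<Omega>. \<exists>\<gamma>.
              path \<gamma> \<and> rectifiable \<gamma> \<and> path_image \<gamma> \<subseteq> \<Omega> \<and>
              pathstart \<gamma> = z1 \<and> pathfinish \<gamma> = z2 \<and>
              arc_length_integral \<gamma> (\<lambda>z. ennreal (infdist z (frontier \<Omega>) powr (1 / (1 - q))))
                \<le> ennreal (C * dist z1 z2 powr ((q - 2) / (q - 1))))"
proof -
  define c0 where "c0 = (morrey_const q * C0) powr q"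
  define M where "M = 2 powr q * (6 powr q * (4 * pi))"
  \<comment> \<open>Chosen so that 2 c0 M <= \<open>K powr (q - 2)\<close>. It involves q and C0
    only, hence so does the final constant.\<close>
  define K where "K = max 1 ((2 * c0 * M) powr (1 / (q - 2)))"
  have K: "1 \<le> K" by (simp add: K_def)
  have Kq: "c0 * M * K powr (2 - q) \<le> 1 / 2"
  proof -
    have "((2 * c0 * M) powr (1 / (q - 2))) powr (q - 2) \<le> K powr (q - 2)"
      using assms by (intro powr_mono2) (auto simp: K_def)
    moreover have "((2 * c0 * M) powr (1 / (q - 2))) powr (q - 2) = 2 * c0 * M"
      using assms by (simp add: powr_powr c0_def M_def)
    ultimately have "2 * c0 * M \<le> K powr (q - 2)" by simp
    moreover have "K powr (2 - q) = 1 / K powr (q - 2)" using powr_minus_divide[of K "q - 2"] by simp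
    moreover have "K powr (q - 2) > 0" using K by simp
    ultimately show ?thesis by (simp only: times_divide_eq_right mult_1_right pos_divide_le_eq)
  qed
  show ?thesis
  proof (intro exI[of _ "curve_const q c0 (slice_const q) K"] allI impI ballI, elim conjE)
    fix \<Omega> :: "complex set" and E z1 z2
    assume J: "jordan_domain \<Omega>" and E: "sobolev_extension_operator q C0 \<Omega> E" and z: "z1 \<in> \<Omega>" "z2 \<in> \<Omega>"
    show "\<exists>\<gamma>. path \<gamma> \<and> rectifiable \<gamma> \<and> path_image \<gamma> \<subseteq> \<Omega> \<and>
              pathstart \<gamma> = z1 \<and> pathfinish \<gamma> = z2 \<and>
              arc_length_integral \<gamma> (\<lambda>z. ennreal (infdist z (frontier \<Omega>) powr (1 / (1 - q))))
                \<le> ennreal (curve_const q c0 (slice_const q) K * dist z1 z2 powr ((q - 2) / (q - 1)))"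
    proof (cases "z1 = z2")
      \<comment> \<open>The right-hand side is 0 here, since \<open>0 powr\<close> anything is 0, so
        the constant path is used.\<close>
      case True
      then show ?thesis
        using constant_path_exists[of z1 \<Omega> "\<lambda>z. infdist z (frontier \<Omega>) powr (1 / (1 - q))"] z by simp
    next
      case False
      show ?thesis
        using subhyperbolic_curve_exists[OF assms J E z False K] Kq unfolding c0_def M_def by blast
    qed
  qed
qed

end
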